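(* Let $E$ be the elliptic curve $y^2=x(x+1)(x+t)$ over $\mathbb{F}_p(t)$, where $p$ is a prime. Suppose that $p$ is odd, that $d$ is a positive integer dividing $2(p^f-1)$ with an odd quotient (for some integer $f\ge 1$), that $u^d=t$, and that $q$ is a power of $p$ with $q\equiv 1\pmod d$. Then $$\operatorname{rank} E(\mathbb{F}_q(u))=\operatorname{rank} E(\mathbb{F}_q(u^2))+\frac d2.$$
   Context: $\mathbb{F}_q(u)$ is the rational function field in $u$, viewed as an extension of $\mathbb{F}_p(t)$ via $t=u^d$. Note that $4\mid d$, so $\mathbb{F}_q(u^2)$ is an intermediate field containing $\mathbb{F}_q(t)$. *)

theory Defs
  imports
    "HOL-Library.Cardinality"
    "HOL-Computational_Algebra.Computational_Algebra"
    "HOL-Number_Theory.Cong"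
    "HOL-Algebra.FiniteProduct"
begin

section \<open>Weierstrass curves and their groups of rational points\<close>

text \<open>
  \<open>Weierstrass a1 a2 a3 a4 a6\<close> is
  \[ y^2 + a_1 x y + a_3 y = x^3 + a_2 x^2 + a_4 x + a_6. \]
\<close>

datatype 'a weierstrass =
  Weierstrass (wa1: 'a) (wa2: 'a) (wa3: 'a) (wa4: 'a) (wa6: 'a)

datatype 'a point = Infinity | Affine 'a 'a

fun on_curve :: "'a::field weierstrass \<Rightarrow> 'a point \<Rightarrow> bool" where
  "on_curve E Infinity \<longleftrightarrow> True"
| "on_curve E (Affine x y) \<longleftrightarrow>
     y^2 + wa1 E * x * y + wa3 E * y = x^3 + wa2 E * x^2 + wa4 E * x + wa6 E"

definition discriminant :: "'a::field weierstrass \<Rightarrow> 'a" where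
  "discriminant E =
    (let b2 = wa1 E ^ 2 + 4 * wa2 E;
         b4 = 2 * wa4 E + wa1 E * wa3 E;
         b6 = wa3 E ^ 2 + 4 * wa6 E;
         b8 = wa1 E ^ 2 * wa6 E + 4 * wa2 E * wa6 E - wa1 E * wa3 E * wa4 E
              + wa2 E * wa3 E ^ 2 - wa4 E ^ 2
     in - (b2 ^ 2) * b8 - 8 * b4 ^ 3 - 27 * b6 ^ 2 + 9 * b2 * b4 * b6)"

text \<open>
  The chord-and-tangent law, in the explicit form valid in every characteristic
  (Silverman, \<^emph>\<open>The Arithmetic of Elliptic Curves\<close>, III.2.3): \<open>y = l * x + n\<close> is the
  chord through two points with distinct \<open>x\<close>-coordinates, or the tangent at a point that
  is not its own negative.
\<close>

fun point_add :: "'a::field weierstrass \<Rightarrow> 'a point \<Rightarrow> 'a point \<Rightarrow> 'a point" where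
  "point_add E Infinity Q = Q"
| "point_add E (Affine x1 y1) Infinity = Affine x1 y1"
| "point_add E (Affine x1 y1) (Affine x2 y2) =
    (if x1 = x2 \<and> y1 + y2 + wa1 E * x2 + wa3 E = 0 then Infinity
     else
       let l = (if x1 = x2
                then (3 * x1^2 + 2 * wa2 E * x1 + wa4 E - wa1 E * y1)
                       / (2 * y1 + wa1 E * x1 + wa3 E)
                else (y2 - y1) / (x2 - x1));
           n = y1 - l * x1;
           x3 = l^2 + wa1 E * l - wa2 E - x1 - x2;
           y3 = - (l + wa1 E) * x3 - n - wa3 E
       in Affine x3 y3)"

text \<open>
  \<open>rational_points E K\<close> is \<open>E(K)\<close>, for a subfield \<open>K\<close> of the ambient field which contains
  the coefficients of \<open>E\<close>.
\<close>

definition rational_points :: "'a::field weierstrass \<Rightarrow> 'a set \<Rightarrow> 'a point set" where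
  "rational_points E K = {P. on_curve E P \<and> set_point P \<subseteq> K}"

definition mordell_weil_group :: "'a::field weierstrass \<Rightarrow> 'a set \<Rightarrow> 'a point monoid" where
  "mordell_weil_group E K =
    \<lparr>carrier = rational_points E K, mult = point_add E, one = Infinity\<rparr>"


section \<open>The rank of an abelian group\<close>

text \<open>The groups are written multiplicatively, so that
  \<open>\<Otimes>\<^bsub>G\<^esub>x\<in>S. x [^]\<^bsub>G\<^esub> c x\<close> is the integral linear combination
  of the elements of \<open>S\<close> with coefficients \<open>c\<close>.\<close>

definition Z_independent :: "('a, 'b) monoid_scheme \<Rightarrow> 'a set \<Rightarrow> bool" where
  "Z_independent G S \<longleftrightarrow>
     finite S \<and> S \<subseteq> carrier G \<and>
     (\<forall>c :: 'a \<Rightarrow> int. (\<Otimes>\<^bsub>G\<^esub>x\<in>S. x [^]\<^bsub>G\<^esub> c x) = \<one>\<^bsub>G\<^esub> \<longrightarrow> (\<forall>x\<in>S. c x = 0))"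

text \<open>
  The largest size of an independent set, that is, the dimension of
  \<open>G\<close> tensored with the rationals. There is no default value for infinite rank: the
  result is then unspecified, so every numerical statement about \<open>group_rank G\<close>
  presupposes that this dimension is finite.
\<close>

definition group_rank :: "('a, 'b) monoid_scheme \<Rightarrow> nat" where
  "group_rank G = (GREATEST n. \<exists>S. Z_independent G S \<and> card S = n)"

definition mw_rank :: "'a::field weierstrass \<Rightarrow> 'a set \<Rightarrow> nat" where
  "mw_rank E K = group_rank (mordell_weil_group E K)"


section \<open>Rational function fields\<close>

text \<open>The field \<open>k(u)\<close> is the type \<open>'k poly fract\<close>.\<close>

definition const_fract :: "'k::field \<Rightarrow> 'k poly fract" where
  "const_fract c = Fract [:c:] 1"

definition fract_var :: "'k::field poly fract" where
  "fract_var = Fract [:0, 1:] 1"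

text \<open>The subfield \<open>k(z)\<close> generated over the constants by an element \<open>z\<close> of \<open>k(u)\<close>.\<close>

definition adjoin :: "'k::field poly fract \<Rightarrow> 'k poly fract set" where
  "adjoin z =
    {poly (map_poly const_fract f) z / poly (map_poly const_fract g) z | f g.
       poly (map_poly const_fract g) z \<noteq> 0}"


section \<open>The Legendre curve\<close>

text \<open>\<open>y^2 = x (x + 1) (x + t)\<close> in expanded form.\<close>

definition legendre_curve :: "'a::field \<Rightarrow> 'a weierstrass" where
  "legendre_curve t = Weierstrass 0 (t + 1) 0 t 0"

lemma on_curve_legendre:
  "on_curve (legendre_curve t) (Affine x y) \<longleftrightarrow> y^2 = x * (x + 1) * (x + t)"
  by (simp add: legendre_curve_def algebra_simps power2_eq_square power3_eq_cube)

lemma discriminant_legendre: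
  "discriminant (legendre_curve t) = 16 * t^2 * (t - 1)^2"
  by (simp add: legendre_curve_def discriminant_def Let_def) algebra

end

theory Submission
  imports "HOL-Algebra.Algebraic_Closure_Type" "HOL-Number_Theory.Residues" Defs
begin

hide_const (open) Polynomials.degree Polynomials.lead_coeff
no_notation Polynomials.var (\<open>X\<index>\<close>)

text \<open>
  Write \<open>v = u\<^sup>2\<close>, \<open>t = v\<^sup>e\<close> with \<open>e = d / 2\<close>. Up to 2-torsion, \<open>E(k(u))\<close> is the direct sum of its
  invariant and anti-invariant parts under \<open>u \<mapsto> -u\<close>, that is of \<open>E(k(v))\<close> and of \<open>E'(k(v))\<close> for the
  quadratic twist \<open>E': y\<^sup>2 = x(x + v)(x + v\<^sup>e\<^sup>+\<^sup>1)\<close>, so the claim is that \<open>E'\<close> has rank \<open>e\<close>.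

  The rank is at most \<open>e\<close> by 2-descent: up to finitely many classes, a point is the double of
  another one as soon as the valuations of \<open>x + v\<close> at the primes dividing \<open>v\<^sup>e - 1\<close> are even, and there are at
  most \<open>e\<close> such primes.

  For the lower bound let \<open>Q = p\<^sup>f = e m + 1\<close> and \<open>v = w\<^sup>m\<close>, where \<open>m = 2 r + 1\<close>. Over the algebraic closure
  of \<open>k\<close>, taking \<open>x = \<gamma>\<^sup>2 w\<^sup>2\<^sup>r\<close> with \<open>\<gamma>\<^sup>2\<^sup>Q = \<gamma>\<^sup>2\<close> gives \<open>x + v = w\<^sup>2\<^sup>r (\<gamma>\<^sup>2 + w)\<close> and \<open>x + v\<^sup>e\<^sup>+\<^sup>1 = w\<^sup>2\<^sup>r (\<gamma>\<^sup>2 + w)\<^sup>Q\<close>, so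
  the right-hand side of the equation is a square. The sums of these points over the \<open>\<gamma>\<close> with a fixed
  value of \<open>\<gamma>\<^sup>m\<close> descend to \<open>k(v)\<close>, and they are independent because the parity of the
  valuation of \<open>x + v\<close> at \<open>w + \<gamma>\<^sup>2\<close> separates them.
\<close>

section \<open>The group law\<close>

text \<open>\<open>group_rank\<close> is a maximum without a default value, so independent sets must
  be shown bounded before ranks can be added. 2-descent only shows that the group modulo doubling is
  finite; a height turns this into a bound, and finiteness of k leaves finitely many points of each
  height. Since p^f - 1 is even and the quotient m is odd, 4 divides d, so e is even. The degrees 1
  and e + 1 of the coefficients of the twist are then both odd. Hence the degree parities of the two
  descent values take all four values on the 2-torsion, and translating by 2-torsion removes the
  conditions at v, at infinity and on leading coefficients. One parity per prime divisor of v^e - 1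
  is left, which explains the bound e. In the lower bound Q - 1 = e m, so the condition on \<gamma>
  reads l^(2e) = 1 for l = \<gamma>^m. As 2e = d divides q - 1, all 2e such l lie in k. The points
  of l and -l are opposite, which leaves e of them. The roots \<gamma> themselves need not lie in k,
  whence the closure; invariance under m-th roots of unity and under Frobenius brings the sums back
  to k(v).\<close>

definition curve :: "'a::field \<Rightarrow> 'a \<Rightarrow> 'a weierstrass" where
  "curve \<alpha> \<beta> = Weierstrass 0 (\<alpha> + \<beta>) 0 (\<alpha> * \<beta>) 0"

lemma legendre_curve_eq: "legendre_curve t = curve 1 t"
  by (simp add: legendre_curve_def curve_def add.commute)

lemma on_curve_affine: "on_curve (curve \<alpha> \<beta>) (Affine x y) \<longleftrightarrow> y^2 = x * (x + \<alpha>) * (x + \<beta>)"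
  by (simp add: curve_def algebra_simps power2_eq_square power3_eq_cube)

declare on_curve.simps(2) [simp del]

fun pneg :: "'a::field point \<Rightarrow> 'a point" where
  "pneg Infinity = Infinity"
| "pneg (Affine x y) = Affine x (- y)"

lemma pneg_pneg [simp]: "pneg (pneg P) = P"
  by (cases P) auto

lemma pneg_eq_iff [simp]: "pneg P = pneg Q \<longleftrightarrow> P = Q"
  by (metis pneg_pneg)

text \<open>Both equations hold for the chord as well as for the tangent; the second one comes from dividing
  \<open>y1\<^sup>2 - y2\<^sup>2\<close> by \<open>x1 - x2\<close>. This avoids distinguishing the two cases in the proof of associativity.\<close>

definition slope :: "'a::field \<Rightarrow> 'a \<Rightarrow> 'a \<Rightarrow> 'a \<Rightarrow> 'a \<Rightarrow> 'a \<Rightarrow> 'a \<Rightarrow> bool" where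
  "slope \<alpha> \<beta> l x1 y1 x2 y2 \<longleftrightarrow> y1 - y2 = l * (x1 - x2) \<and>
     l * (y1 + y2) = x1^2 + x1 * x2 + x2^2 + (\<alpha> + \<beta>) * (x1 + x2) + \<alpha> * \<beta>"

section \<open>Chord and tangent formulas on a nonsingular curve with rational 2-torsion\<close>

locale ecurve =
  fixes \<alpha> \<beta> :: "'a::field"
  assumes nz: "\<alpha> \<noteq> 0" "\<beta> \<noteq> 0" "\<alpha> \<noteq> \<beta>" and two: "(2::'a) \<noteq> 0"
begin

abbreviation E where "E \<equiv> curve \<alpha> \<beta>"
abbreviation padd (infixl "\<oplus>\<^sub>E" 65) where "P \<oplus>\<^sub>E Q \<equiv> point_add E P Q"
abbreviation onE where "onE \<equiv> on_curve E"

lemma onE: "onE (Affine x y) \<longleftrightarrow> y^2 = x * (x + \<alpha>) * (x + \<beta>)"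
  by (rule on_curve_affine)

lemma onE_pneg [simp]: "onE (pneg P) \<longleftrightarrow> onE P"
  by (cases P) (auto simp: onE)

lemma twice_eq0: "y + y = (0::'a) \<longleftrightarrow> y = 0"
  using two by (metis mult_2 mult_eq_0_iff add_0_left)

lemma slope_exists:
  assumes "onE (Affine x1 y1)" "onE (Affine x2 y2)" "\<not> (x1 = x2 \<and> y1 + y2 = 0)"
  obtains l where "slope \<alpha> \<beta> l x1 y1 x2 y2"
proof (cases "x1 = x2")
  case True
  have "y1^2 = y2^2" using assms True by (simp add: onE)
  hence y: "y1 = y2" using assms(3) True
    by (metis power2_eq_iff add.left_inverse)
  hence "y1 + y2 \<noteq> 0" using assms(3) True by auto
  thus ?thesis using True y
    by (intro that[of "(x1^2 + x1 * x2 + x2^2 + (\<alpha> + \<beta>) * (x1 + x2) + \<alpha> * \<beta>) / (y1 + y2)"])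
       (auto simp: slope_def)
next
  case False
  define l where "l = (y1 - y2) / (x1 - x2)"
  have l: "y1 - y2 = l * (x1 - x2)" using False by (simp add: l_def)
  have "(x1 - x2) * (l * (y1 + y2)) = (y1 - y2) * (y1 + y2)" by (simp add: l)
  also have "\<dots> = y1^2 - y2^2" by (simp add: power2_eq_square algebra_simps)
  also have "\<dots> = x1 * (x1 + \<alpha>) * (x1 + \<beta>) - x2 * (x2 + \<alpha>) * (x2 + \<beta>)"
    using assms(1,2) by (simp add: onE)
  also have "\<dots> = (x1 - x2) * (x1^2 + x1 * x2 + x2^2 + (\<alpha> + \<beta>) * (x1 + x2) + \<alpha> * \<beta>)"
    by Groebner_Basis.algebra
  finally show ?thesis using False l by (intro that[of l]) (auto simp: slope_def)
qed

text \<open>Both branches of the definition of addition have the same formula once the slope is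
  abstracted. Identities between points thereby become ideal membership problems in l and the
  coordinates.\<close>

lemma add_slope:
  assumes "onE (Affine x1 y1)" "onE (Affine x2 y2)" "\<not> (x1 = x2 \<and> y1 + y2 = 0)"
    and l: "slope \<alpha> \<beta> l x1 y1 x2 y2"
  shows "Affine x1 y1 \<oplus>\<^sub>E Affine x2 y2 =
    Affine (l^2 - (\<alpha> + \<beta>) - x1 - x2) (- (l * (l^2 - (\<alpha> + \<beta>) - x1 - x2 - x1) + y1))"
proof -
  have "l = (if x1 = x2
                then (3 * x1^2 + 2 * wa2 E * x1 + wa4 E - wa1 E * y1)
                       / (2 * y1 + wa1 E * x1 + wa3 E)
                else (y2 - y1) / (x2 - x1))"
  proof (cases "x1 = x2")
    \<comment> \<open>At a tangent the second equation of \<open>slope\<close> reads: l times 2 y1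
      is the derivative of the cubic at x1.\<close>
    case True
    hence y: "y1 = y2" using l by (simp add: slope_def)
    hence "y1 + y1 \<noteq> 0" using assms(3) True by auto
    moreover have "l * (y1 + y1) = x1^2 + x1 * x1 + x1^2 + (\<alpha> + \<beta>) * (x1 + x1) + \<alpha> * \<beta>"
      using l True y by (simp add: slope_def)
    moreover have "x1^2 + x1 * x1 + x1^2 + (\<alpha> + \<beta>) * (x1 + x1) + \<alpha> * \<beta> = 3 * x1^2 + 2 * (\<alpha> + \<beta>) * x1 + \<alpha> * \<beta>"
      by Groebner_Basis.algebra
    ultimately show ?thesis using True
      by (simp add: curve_def nonzero_eq_divide_eq flip: mult_2)
  next
    case False
    have "y1 - y2 = l * (x1 - x2)" using l by (simp add: slope_def)
    hence "y2 - y1 = l * (x2 - x1)" by Groebner_Basis.algebra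
    thus ?thesis using False by simp
  qed
  note l_eq = this[symmetric]
  have "wa1 E = 0" "wa3 E = 0" "wa2 E = \<alpha> + \<beta>" by (simp_all add: curve_def)
  thus ?thesis using assms(3)
    unfolding point_add.simps l_eq Let_def by (auto simp: algebra_simps)
qed

lemma add_opp [simp]: "P \<oplus>\<^sub>E pneg P = Infinity"
  by (cases P) (auto simp: curve_def)

lemma opp_add [simp]: "pneg P \<oplus>\<^sub>E P = Infinity"
  by (cases P) (auto simp: curve_def)

lemma add_Inf [simp]: "P \<oplus>\<^sub>E Infinity = P"
  by (cases P) auto

lemma not_opp: "Affine x2 y2 \<noteq> pneg (Affine x1 y1) \<longleftrightarrow> \<not> (x1 = x2 \<and> y1 + y2 = 0)"
  by (auto simp: eq_neg_iff_add_eq_0 add.commute)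

lemma slope_commute: "slope \<alpha> \<beta> l x1 y1 x2 y2 \<longleftrightarrow> slope \<alpha> \<beta> l x2 y2 x1 y1"
  unfolding slope_def by (intro conj_cong; (simp add: algebra_simps)?) Groebner_Basis.algebra+

lemma point_add_commute:
  assumes "onE P" "onE Q"
  shows "P \<oplus>\<^sub>E Q = Q \<oplus>\<^sub>E P"
proof (cases "P = Infinity \<or> Q = Infinity \<or> Q = pneg P")
  case True thus ?thesis by auto
next
  case False
  then obtain x1 y1 x2 y2 where PQ: "P = Affine x1 y1" "Q = Affine x2 y2"
    by (meson point.exhaust)
  have n: "\<not> (x1 = x2 \<and> y1 + y2 = 0)" using False PQ not_opp by blast
  hence n': "\<not> (x2 = x1 \<and> y2 + y1 = 0)" by (auto simp: add.commute)
  obtain l where l: "slope \<alpha> \<beta> l x1 y1 x2 y2"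
    using slope_exists assms PQ n by metis
  have "y1 - y2 = l * (x1 - x2)" using l by (simp add: slope_def)
  hence y1: "y1 = y2 + l * (x1 - x2)" by (simp add: algebra_simps)
  have "P \<oplus>\<^sub>E Q = Affine (l^2 - (\<alpha> + \<beta>) - x1 - x2) (- (l * (l^2 - (\<alpha> + \<beta>) - x1 - x2 - x1) + y1))"
    using add_slope[OF _ _ n l] assms unfolding PQ by blast
  moreover have "Q \<oplus>\<^sub>E P = Affine (l^2 - (\<alpha> + \<beta>) - x2 - x1) (- (l * (l^2 - (\<alpha> + \<beta>) - x2 - x1 - x2) + y2))"
    using add_slope[OF _ _ n' l[unfolded slope_commute[of l x1]]] assms unfolding PQ by blast
  ultimately show ?thesis by (simp add: y1 algebra_simps)
qed

lemma point_add_closed: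
  assumes "onE P" "onE Q"
  shows "onE (P \<oplus>\<^sub>E Q)"
proof (cases "P = Infinity \<or> Q = Infinity \<or> Q = pneg P")
  case True thus ?thesis using assms by auto
next
  case False
  then obtain x1 y1 x2 y2 where PQ: "P = Affine x1 y1" "Q = Affine x2 y2"
    by (meson point.exhaust)
  have n: "\<not> (x1 = x2 \<and> y1 + y2 = 0)" using False PQ not_opp by blast
  obtain l where l: "slope \<alpha> \<beta> l x1 y1 x2 y2"
    using slope_exists assms PQ n by metis
  have "y1^2 = x1 * (x1 + \<alpha>) * (x1 + \<beta>)"
    using assms PQ by (simp add: onE)
  thus ?thesis unfolding PQ
    using l assms unfolding add_slope[OF assms[unfolded PQ] n l] onE slope_def by Groebner_Basis.algebra
qed

text \<open>Reflecting the chord through P and Q in the x-axis gives the line through -P and P + Q,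
  of slope -l. Its third intersection is the reflection of Q.\<close>

lemma neg_add_cancel:
  assumes "onE P" "onE Q"
  shows "pneg P \<oplus>\<^sub>E (P \<oplus>\<^sub>E Q) = Q"
proof (cases "P = Infinity \<or> Q = Infinity \<or> Q = pneg P")
  case True thus ?thesis by auto
next
  case False
  then obtain x1 y1 x2 y2 where PQ: "P = Affine x1 y1" "Q = Affine x2 y2"
    by (meson point.exhaust)
  have n: "\<not> (x1 = x2 \<and> y1 + y2 = 0)" using False PQ not_opp by blast
  obtain l where l: "slope \<alpha> \<beta> l x1 y1 x2 y2"
    using slope_exists assms PQ n by metis
  define x3 where "x3 = l^2 - (\<alpha> + \<beta>) - x1 - x2"
  define y3 where "y3 = l * (x3 - x1) + y1"
  have PQ3: "P \<oplus>\<^sub>E Q = Affine x3 (- y3)"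
    using add_slope[OF assms[unfolded PQ] n l] by (simp add: PQ x3_def y3_def)
  have on3: "onE (Affine x3 (- y3))" using point_add_closed[OF assms] PQ3 by simp
  have on1: "onE (Affine x1 y1)" using assms PQ by simp
  have c1: "y1^2 = x1 * (x1 + \<alpha>) * (x1 + \<beta>)" using on1 unfolding onE .
  have sl: "slope \<alpha> \<beta> (- l) x1 (- y1) x3 (- y3)"
    using l c1 unfolding slope_def y3_def x3_def by (intro conjI) Groebner_Basis.algebra+
  \<comment> \<open>If P + Q were P, then y1 = 0 and the derivative of the cubic would vanish at its
    root x1; but the three roots are distinct.\<close>
  have n3: "\<not> (x1 = x3 \<and> - y1 + - y3 = 0)"
  proof
    assume *: "x1 = x3 \<and> - y1 + - y3 = 0"
    hence "y3 = y1" by (simp add: y3_def)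
    with * have y0: "y1 = 0" using twice_eq0[of y1] by (metis minus_add_distrib neg_equal_0_iff_equal)
    have "x1^2 + x1 * x1 + x1^2 + (\<alpha> + \<beta>) * (x1 + x1) + \<alpha> * \<beta> = 0"
      using sl * y0 \<open>y3 = y1\<close> by (simp add: slope_def)
    moreover have "x1 = 0 \<or> x1 = - \<alpha> \<or> x1 = - \<beta>"
      using c1 y0 by (auto simp: eq_neg_iff_add_eq_0)
    ultimately have "\<alpha> * \<beta> = 0 \<or> \<alpha> * (\<alpha> - \<beta>) = 0 \<or> \<beta> * (\<alpha> - \<beta>) = 0" by Groebner_Basis.algebra
    thus False using nz by simp
  qed
  have "pneg P \<oplus>\<^sub>E (P \<oplus>\<^sub>E Q) = Affine x1 (- y1) \<oplus>\<^sub>E Affine x3 (- y3)"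
    by (simp only: PQ pneg.simps PQ3[unfolded PQ])
  also have "\<dots> = Affine ((-l)^2 - (\<alpha> + \<beta>) - x1 - x3) (- (- l * ((-l)^2 - (\<alpha> + \<beta>) - x1 - x3 - x1) + - y1))"
    using add_slope[OF _ on3 n3 sl] on1 onE_pneg[of "Affine x1 y1"] by simp
  also have "\<dots> = Q"
    using l by (simp add: PQ x3_def slope_def algebra_simps)
  finally show ?thesis .
qed

lemma add_left_cancel:
  assumes "onE P" "onE Q" "onE R" "P \<oplus>\<^sub>E Q = P \<oplus>\<^sub>E R"
  shows "Q = R"
  by (metis assms neg_add_cancel)

lemma pneg_add:
  assumes "onE P" "onE Q"
  shows "pneg (P \<oplus>\<^sub>E Q) = pneg P \<oplus>\<^sub>E pneg Q"
proof (cases "P = Infinity \<or> Q = Infinity \<or> Q = pneg P")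
  case True thus ?thesis by auto
next
  case False
  then obtain x1 y1 x2 y2 where PQ: "P = Affine x1 y1" "Q = Affine x2 y2"
    by (meson point.exhaust)
  have n: "\<not> (x1 = x2 \<and> y1 + y2 = 0)" using False PQ not_opp by blast
  hence n': "\<not> (x1 = x2 \<and> -y1 + -y2 = 0)" by (metis minus_add_distrib neg_equal_0_iff_equal)
  obtain l where l: "slope \<alpha> \<beta> l x1 y1 x2 y2"
    using slope_exists assms PQ n by metis
  hence l': "slope \<alpha> \<beta> (-l) x1 (-y1) x2 (-y2)" unfolding slope_def by (intro conjI) Groebner_Basis.algebra+
  show ?thesis using assms onE_pneg[of P] onE_pneg[of Q]
    using add_slope[OF _ _ n l] add_slope[OF _ _ n' l']
    by (simp add: PQ)
qed

lemma add_eq_Inf_iff: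
  assumes "onE P" "onE Q"
  shows "P \<oplus>\<^sub>E Q = Infinity \<longleftrightarrow> Q = pneg P"
  by (metis add_Inf add_opp assms neg_add_cancel)

section \<open>Associativity\<close>

fun px :: "'a point \<Rightarrow> 'a option" where
  "px Infinity = None" | "px (Affine x y) = Some x"

lemma px_eq_iff:
  assumes "onE P" "onE Q"
  shows "px P = px Q \<longleftrightarrow> P = Q \<or> P = pneg Q"
proof (cases P; cases Q)
  fix x y x' y' assume [simp]: "P = Affine x y" "Q = Affine x' y'"
  have "x = x' \<Longrightarrow> y^2 = y'^2" using assms by (simp add: onE)
  thus ?thesis by (auto simp: power2_eq_iff)
qed auto

text \<open>As the outer additions involve distinct x-coordinates, their slopes are determined by
  the inner slopes l and m: with w = (x3 - x1) / (m - l) they are w - l and w - m. Both bracketings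
  then agree by a polynomial identity.\<close>

lemma assoc_generic:
  assumes on: "onE P" "onE Q" "onE R"
    and PQ: "Q \<noteq> pneg P" and QR: "R \<noteq> pneg Q"
    and x4: "px (P \<oplus>\<^sub>E Q) \<noteq> px R" and x5: "px P \<noteq> px (Q \<oplus>\<^sub>E R)"
  shows "(P \<oplus>\<^sub>E Q) \<oplus>\<^sub>E R = P \<oplus>\<^sub>E (Q \<oplus>\<^sub>E R)"
proof (cases "P = Infinity \<or> Q = Infinity \<or> R = Infinity")
  case True thus ?thesis by auto
next
  case False
  then obtain x1 y1 x2 y2 x3 y3
    where eqs: "P = Affine x1 y1" "Q = Affine x2 y2" "R = Affine x3 y3"
    by (meson point.exhaust)
  have n12: "\<not> (x1 = x2 \<and> y1 + y2 = 0)" using PQ eqs not_opp by blast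
  have n23: "\<not> (x2 = x3 \<and> y2 + y3 = 0)" using QR eqs not_opp by blast
  obtain l where l: "slope \<alpha> \<beta> l x1 y1 x2 y2" using slope_exists on eqs n12 by metis
  obtain m where m: "slope \<alpha> \<beta> m x2 y2 x3 y3" using slope_exists on eqs n23 by metis
  define x4 y4 where "x4 = l^2 - (\<alpha> + \<beta>) - x1 - x2" and "y4 = - (l * (x4 - x1) + y1)"
  define x5 y5 where "x5 = m^2 - (\<alpha> + \<beta>) - x2 - x3" and "y5 = - (m * (x5 - x2) + y2)"
  have P4: "P \<oplus>\<^sub>E Q = Affine x4 y4"
    using add_slope[OF on(1,2)[unfolded eqs] n12 l] by (simp add: eqs x4_def y4_def)
  have P5: "Q \<oplus>\<^sub>E R = Affine x5 y5"
    using add_slope[OF on(2,3)[unfolded eqs] n23 m] by (simp add: eqs x5_def y5_def)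
  have ne4: "x4 \<noteq> x3" using x4 P4 eqs by simp
  have ne5: "x1 \<noteq> x5" using x5 P5 eqs by simp
  define A B where "A = x1 + x2 + x3 + (\<alpha> + \<beta>) - l^2" and "B = x1 + x2 + x3 + (\<alpha> + \<beta>) - m^2"
  have A: "A = x3 - x4" and B: "B = x1 - x5" by (simp_all add: A_def B_def x4_def x5_def)
  \<comment> \<open>Eliminates y1 and y3 between the second slope equations of the two inner
    chords.\<close>
  have key: "2 * y2 * (m - l) = (x3 - x2) * B - (x1 - x2) * A"
    using l m unfolding slope_def A_def B_def by Groebner_Basis.algebra
  show ?thesis
  proof (cases "m = l")
    \<comment> \<open>Equal inner slopes give A = B, which is nonzero; \<open>key\<close> then
      forces x3 = x1 and R = P, where commutativity suffices.\<close>
    case True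
    hence "A = B" by (simp add: A_def B_def)
    hence "(x3 - x1) * A = 0" using key True by (simp add: left_diff_distrib)
    hence x: "x3 = x1" using ne4 A by simp
    have "y1 - y2 = l * (x1 - x2)" "y2 - y3 = l * (x2 - x1)"
      using l m True x by (simp_all add: slope_def)
    hence "y3 = y1" by Groebner_Basis.algebra
    hence "R = P" using x eqs by simp
    thus ?thesis by (metis on point_add_closed point_add_commute)
  next
    case False
    define w where "w = (x3 - x1) / (m - l)"
    have w: "w * (m - l) = x3 - x1" using False by (simp add: w_def)
    have n43: "\<not> (x4 = x3 \<and> y4 + y3 = 0)" and n15: "\<not> (x1 = x5 \<and> y1 + y5 = 0)"
      using ne4 ne5 by auto
    obtain r where r: "slope \<alpha> \<beta> r x4 y4 x3 y3"
      using slope_exists point_add_closed on P4 eqs n43 by metis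
    obtain s where s: "slope \<alpha> \<beta> s x1 y1 x5 y5"
      using slope_exists point_add_closed on P5 eqs n15 by metis
    have "(m - l) * A * (r + l) = (m - l) * A * w"
      using r l m key w A A_def B_def unfolding slope_def y4_def y5_def by Groebner_Basis.algebra
    moreover have "(m - l) * A \<noteq> 0" using False ne4 A by simp
    ultimately have "r + l = w" by (metis mult_left_cancel)
    hence rw: "r = w - l" by (simp add: algebra_simps)
    have "(m - l) * B * (s + m) = (m - l) * B * w"
      using s l m key w B A_def B_def unfolding slope_def y4_def y5_def by Groebner_Basis.algebra
    moreover have "(m - l) * B \<noteq> 0" using False ne5 B by simp
    ultimately have "s + m = w" by (metis mult_left_cancel)
    hence sw: "s = w - m" by (simp add: algebra_simps)
    have "(P \<oplus>\<^sub>E Q) \<oplus>\<^sub>E R = Affine (r^2 - (\<alpha> + \<beta>) - x4 - x3) (- (r * (r^2 - (\<alpha> + \<beta>) - x4 - x3 - x4) + y4))"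
      using add_slope[OF _ _ n43 r] point_add_closed on P4 eqs by metis
    moreover have "P \<oplus>\<^sub>E (Q \<oplus>\<^sub>E R) = Affine (s^2 - (\<alpha> + \<beta>) - x1 - x5) (- (s * (s^2 - (\<alpha> + \<beta>) - x1 - x5 - x1) + y1))"
      using add_slope[OF _ _ n15 s] point_add_closed on P5 eqs by metis
    moreover have X: "r^2 - (\<alpha> + \<beta>) - x4 - x3 = s^2 - (\<alpha> + \<beta>) - x1 - x5"
      using rw sw w unfolding x4_def x5_def by Groebner_Basis.algebra
    moreover have "r * (r^2 - (\<alpha> + \<beta>) - x4 - x3 - x4) + y4 = s * (s^2 - (\<alpha> + \<beta>) - x1 - x5 - x1) + y1"
    proof -
      have "y1 - y2 = l * (x1 - x2)" using l by (simp add: slope_def)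
      hence "(m - l) * (r * (r^2 - (\<alpha> + \<beta>) - x4 - x3 - x4) + y4) = (m - l) * (s * (s^2 - (\<alpha> + \<beta>) - x1 - x5 - x1) + y1)"
        using rw sw w key unfolding A_def B_def x4_def x5_def y4_def by Groebner_Basis.algebra
      thus ?thesis using False by simp
    qed
    ultimately show ?thesis by (simp only:)
  qed
qed

text \<open>With D = 2S the claim is equivalent to 2D - S = D + S, the generic law for D, D, -S. The
  exceptions express S or D as a small multiple and are settled by cancellation.\<close>

lemma double_triple:
  assumes S: "onE S"
  shows "((S \<oplus>\<^sub>E S) \<oplus>\<^sub>E S) \<oplus>\<^sub>E S = (S \<oplus>\<^sub>E S) \<oplus>\<^sub>E (S \<oplus>\<^sub>E S)"
proof -
  define D where "D = S \<oplus>\<^sub>E S"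
  note cl = point_add_closed and comm = point_add_commute
  have on: "onE D" "onE (D \<oplus>\<^sub>E S)" "onE (D \<oplus>\<^sub>E D)" using S by (simp_all add: D_def cl)
  have DS: "D \<oplus>\<^sub>E pneg S = S" "pneg S \<oplus>\<^sub>E D = S"
    using neg_add_cancel[of S S] comm[of D "pneg S"] S on by (simp_all add: D_def)
  have "(D \<oplus>\<^sub>E S) \<oplus>\<^sub>E S = D \<oplus>\<^sub>E D"
  proof (cases "D = pneg D \<or> D = S \<or> D = pneg S \<or> D \<oplus>\<^sub>E D = S \<or> D \<oplus>\<^sub>E D = pneg S")
    case False
    have "(D \<oplus>\<^sub>E D) \<oplus>\<^sub>E pneg S = D \<oplus>\<^sub>E (D \<oplus>\<^sub>E pneg S)"
      using False S on by (intro assoc_generic) (auto simp: px_eq_iff DS)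
    hence "pneg S \<oplus>\<^sub>E (D \<oplus>\<^sub>E D) = D \<oplus>\<^sub>E S"
      using DS comm[of "D \<oplus>\<^sub>E D" "pneg S"] S on by simp
    thus ?thesis using neg_add_cancel[of "pneg S" "D \<oplus>\<^sub>E D"] comm[of "D \<oplus>\<^sub>E S" S] S on by simp
  next
    case True
    then consider "D = pneg D" | "D = S" | "D = pneg S" | "D \<oplus>\<^sub>E D = S" | "D \<oplus>\<^sub>E D = pneg S" by blast
    thus ?thesis
    proof cases
      case 1
      have "D \<oplus>\<^sub>E S = pneg S"
        using pneg_add[of D "pneg S"] DS 1 S on by simp
      moreover have "D \<oplus>\<^sub>E D = Infinity" using 1 add_opp by metis
      ultimately show ?thesis by simp
    next
      case 2
      have "S = Infinity" using 2 add_left_cancel[of S S Infinity] S by (simp add: D_def)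
      thus ?thesis by (simp add: D_def)
    next
      case 3
      have "D \<oplus>\<^sub>E S = Infinity" using 3 by simp
      moreover have "D \<oplus>\<^sub>E D = S" using 3 DS by simp
      ultimately show ?thesis by simp
    next
      case 4
      have "pneg D \<oplus>\<^sub>E S = D" using 4 neg_add_cancel[of D D] on by simp
      hence "pneg D = S" using pneg_add[of "pneg D" S] DS on S by simp
      thus ?thesis using 4 by auto
    next
      case 5
      have "pneg D \<oplus>\<^sub>E pneg S = D" using 5 neg_add_cancel[of D D] on by simp
      hence "D \<oplus>\<^sub>E S = pneg D" using pneg_add[of "pneg D" "pneg S"] on S by simp
      moreover have "pneg D \<oplus>\<^sub>E S = pneg S" using pneg_add[of D "pneg S"] DS on S by simp
      ultimately show ?thesis using 5 by simp
    qed
  qed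
  thus ?thesis by (simp add: D_def)
qed

text \<open>This is the case R = P + Q that \<open>assoc_generic\<close> excludes. For X = -(Q + S)
  the claim becomes P = X + 2S, which is generic associativity for X, S, S; the exception 2S = X is
  what \<open>double_triple\<close> is for.\<close>

lemma assoc_sum:
  assumes on: "onE P" "onE Q"
  shows "(P \<oplus>\<^sub>E Q) \<oplus>\<^sub>E (P \<oplus>\<^sub>E Q) = P \<oplus>\<^sub>E (Q \<oplus>\<^sub>E (P \<oplus>\<^sub>E Q))"
proof -
  note cl = point_add_closed and comm = point_add_commute
  define S where "S = P \<oplus>\<^sub>E Q"
  have S: "onE S" using on by (simp add: S_def cl)
  have SQ: "pneg Q \<oplus>\<^sub>E S = P" using neg_add_cancel[of Q P] comm[of P Q] on by (simp add: S_def)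
  define X where "X = pneg (Q \<oplus>\<^sub>E S)"
  have X: "onE X" using on S by (simp add: X_def cl)
  have XS: "X \<oplus>\<^sub>E S = pneg Q"
    using neg_add_cancel[of S Q] pneg_add[of "pneg S" "Q \<oplus>\<^sub>E S"] comm[of S Q] comm[of X S] on S X
    by (simp add: X_def cl)
  have goal: ?thesis if "P = X \<oplus>\<^sub>E (S \<oplus>\<^sub>E S)"
  proof -
    have "pneg X \<oplus>\<^sub>E P = S \<oplus>\<^sub>E S" using that neg_add_cancel[of X "S \<oplus>\<^sub>E S"] X S by (simp add: cl)
    thus ?thesis using comm[of P "Q \<oplus>\<^sub>E S"] on S by (simp add: X_def S_def[symmetric] cl)
  qed
  show ?thesis
  proof (cases "Q = Infinity \<or> P = Infinity \<or> S = pneg S \<or> Q = pneg S \<or> px (S \<oplus>\<^sub>E S) = px X")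
    case False
    have "(X \<oplus>\<^sub>E S) \<oplus>\<^sub>E S = X \<oplus>\<^sub>E (S \<oplus>\<^sub>E S)"
    proof (rule assoc_generic)
      show "S \<noteq> pneg X"
        using False comm[of Q S] add_left_cancel[of S Q Infinity] on S by (auto simp: X_def)
      show "px (X \<oplus>\<^sub>E S) \<noteq> px S"
      proof -
        have "Q \<noteq> S" using False add_left_cancel[of Q P Infinity] comm[of P Q] on by (auto simp: S_def)
        thus ?thesis using False on S by (auto simp: XS px_eq_iff)
      qed
    qed (use False X S in auto)
    thus ?thesis using XS SQ goal by simp
  next
    case True
    then consider "Q = Infinity" | "P = Infinity" | "S = pneg S" | "Q = pneg S" | "S \<oplus>\<^sub>E S = pneg X" | "S \<oplus>\<^sub>E S = X"
      using px_eq_iff[of "S \<oplus>\<^sub>E S" X] X S by (auto simp: cl)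
    thus ?thesis
    proof cases
      case 3
      have "Q \<oplus>\<^sub>E S = pneg P" using SQ pneg_add[of "pneg Q" S] on S 3 by simp
      moreover have "S \<oplus>\<^sub>E S = Infinity" using 3 add_opp by metis
      ultimately show ?thesis by (simp add: S_def[symmetric])
    next
      case 4
      have "Q \<oplus>\<^sub>E S = Infinity" "S \<oplus>\<^sub>E S = P" using SQ 4 by simp_all
      thus ?thesis by (simp add: S_def[symmetric])
    next
      case 5
      hence "S \<oplus>\<^sub>E S = S \<oplus>\<^sub>E Q" using comm[of Q S] on S by (simp add: X_def)
      hence "S = Q" using add_left_cancel S on by blast
      hence "P = Infinity" using SQ by (metis opp_add)
      thus ?thesis by simp
    next
      case 6
      have "P = X \<oplus>\<^sub>E (S \<oplus>\<^sub>E S)" using SQ double_triple[OF S] 6 by (simp add: XS)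
      thus ?thesis by (rule goal)
    qed simp_all
  qed
qed

text \<open>Exceptions of \<open>assoc_generic\<close> for the left bracketing are covered by
  cancellation and \<open>assoc_sum\<close>. Those for the right bracketing are the same with P and
  R exchanged.\<close>

theorem point_add_assoc:
  assumes on: "onE P" "onE Q" "onE R"
  shows "(P \<oplus>\<^sub>E Q) \<oplus>\<^sub>E R = P \<oplus>\<^sub>E (Q \<oplus>\<^sub>E R)"
proof -
  note cl = point_add_closed and comm = point_add_commute
  have half: "(A \<oplus>\<^sub>E B) \<oplus>\<^sub>E C = A \<oplus>\<^sub>E (B \<oplus>\<^sub>E C)"
    if on: "onE A" "onE B" "onE C" and c: "B = pneg A \<or> C = A \<oplus>\<^sub>E B \<or> C = pneg (A \<oplus>\<^sub>E B)" for A B C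
    using c
  proof (elim disjE)
    assume B: "B = pneg A"
    show ?thesis using neg_add_cancel[of B C] on B by simp
  next
    assume "C = A \<oplus>\<^sub>E B" thus ?thesis using assoc_sum on by simp
  next
    assume C: "C = pneg (A \<oplus>\<^sub>E B)"
    have "pneg B \<oplus>\<^sub>E (B \<oplus>\<^sub>E A) = A" using on by (simp add: neg_add_cancel)
    hence "pneg A = B \<oplus>\<^sub>E pneg (A \<oplus>\<^sub>E B)"
      using pneg_add[of "pneg B" "B \<oplus>\<^sub>E A"] comm[of A B] on by (simp add: cl)
    thus ?thesis using C by (metis add_opp)
  qed
  show ?thesis
  proof (cases "Q = pneg P \<or> R = P \<oplus>\<^sub>E Q \<or> R = pneg (P \<oplus>\<^sub>E Q)")
    case True thus ?thesis using half on by blast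
  next
    case 1: False
    show ?thesis
    proof (cases "Q = pneg R \<or> P = R \<oplus>\<^sub>E Q \<or> P = pneg (R \<oplus>\<^sub>E Q)")
      case True
      hence "(R \<oplus>\<^sub>E Q) \<oplus>\<^sub>E P = R \<oplus>\<^sub>E (Q \<oplus>\<^sub>E P)" using half on by blast
      thus ?thesis using on comm by (metis cl)
    next
      case 2: False
      show ?thesis
      proof (rule assoc_generic)
        show "R \<noteq> pneg Q" using 2 by auto
        show "px (P \<oplus>\<^sub>E Q) \<noteq> px R" using 1 on px_eq_iff[of "P \<oplus>\<^sub>E Q" R] by (auto simp: cl)
        show "px P \<noteq> px (Q \<oplus>\<^sub>E R)"
          using 2 on px_eq_iff[of P "Q \<oplus>\<^sub>E R"] comm[of Q R] by (auto simp: cl)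
      qed (use 1 on in auto)
    qed
  qed
qed

end

section \<open>Independence and rank in abelian groups\<close>

definition Zcomb :: "('a, 'b) monoid_scheme \<Rightarrow> 'a set \<Rightarrow> ('a \<Rightarrow> int) \<Rightarrow> 'a" where
  "Zcomb G S c = (\<Otimes>\<^bsub>G\<^esub>x\<in>S. x [^]\<^bsub>G\<^esub> c x)"

definition Zspan :: "('a, 'b) monoid_scheme \<Rightarrow> 'a set \<Rightarrow> 'a set" where
  "Zspan G S = range (Zcomb G S)"

text \<open>Guards every use of \<open>group_rank\<close>, which is unspecified when independent
  sets are arbitrarily large.\<close>

definition bounded_rank :: "('a, 'b) monoid_scheme \<Rightarrow> bool" where
  "bounded_rank G \<longleftrightarrow> (\<exists>N. \<forall>S. Z_independent G S \<longrightarrow> card S \<le> N)"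

text \<open>Homomorphisms to Z/2 as predicates, with inequality of truth values as addition. All
  2-descent invariants have this form.\<close>

definition parity_hom :: "('a, 'b) monoid_scheme \<Rightarrow> ('a \<Rightarrow> bool) \<Rightarrow> bool" where
  "parity_hom G \<epsilon> \<longleftrightarrow> (\<forall>x\<in>carrier G. \<forall>y\<in>carrier G. \<epsilon> (x \<otimes>\<^bsub>G\<^esub> y) = (\<epsilon> x \<noteq> \<epsilon> y))"

lemma Z_independent_iff:
  "Z_independent G S \<longleftrightarrow> finite S \<and> S \<subseteq> carrier G \<and> (\<forall>c. Zcomb G S c = \<one>\<^bsub>G\<^esub> \<longrightarrow> (\<forall>x\<in>S. c x = 0))"
  by (simp add: Z_independent_def Zcomb_def)

text \<open>More vectors than coordinates: integral Gaussian elimination.\<close>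

lemma int_relation:
  fixes v :: "'s \<Rightarrow> 'b \<Rightarrow> int"
  assumes "finite B" "finite S" "card B < card S"
  shows "\<exists>z. (\<exists>s\<in>S. z s \<noteq> 0) \<and> (\<forall>b\<in>B. (\<Sum>s\<in>S. z s * v s b) = 0)"
  using assms
proof (induction B arbitrary: S v rule: finite_induct)
  case empty
  then obtain s where "s \<in> S" by fastforce
  thus ?case by (intro exI[of _ "\<lambda>_. 1"]) auto
next
  case (insert b B)
  show ?case
  proof (cases "\<forall>s\<in>S. v s b = 0")
    case True
    have "card B < card S" using insert by simp
    from insert.IH[OF insert.prems(1) this, of v]
    obtain z where "\<exists>s\<in>S. z s \<noteq> 0" "\<forall>b\<in>B. (\<Sum>s\<in>S. z s * v s b) = 0" by blast
    thus ?thesis using True by (intro exI[of _ z]) auto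
  next
    case False
    then obtain t where t: "t \<in> S" "v t b \<noteq> 0" by blast
    \<comment> \<open>Cross-multiplication with the pivot t clears coordinate b and stays
      integral.\<close>
    define w where "w s c = v t b * v s c - v s b * v t c" for s c
    have "card B < card (S - {t})" using insert t by simp
    then obtain z where z: "\<exists>s\<in>S-{t}. z s \<noteq> 0" "\<forall>c\<in>B. (\<Sum>s\<in>S-{t}. z s * w s c) = 0"
      using insert.IH[of "S - {t}" w] insert.prems by blast
    \<comment> \<open>The coefficient of t is the one that cancels coordinate b; the others are
      scaled by the pivot.\<close>
    define z' where "z' s = (if s = t then - (\<Sum>s\<in>S-{t}. z s * v s b) else z s * v t b)" for s
    have sum: "(\<Sum>s\<in>S. z' s * v s c) = (\<Sum>s\<in>S-{t}. z s * w s c)" for c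
    proof -
      have "(\<Sum>s\<in>S. z' s * v s c) = z' t * v t c + (\<Sum>s\<in>S-{t}. z' s * v s c)"
        using t insert.prems by (simp add: sum.remove)
      also have "(\<Sum>s\<in>S-{t}. z' s * v s c) = (\<Sum>s\<in>S-{t}. z s * v t b * v s c)"
        by (intro sum.cong) (auto simp: z'_def)
      finally show ?thesis
        by (simp add: z'_def w_def algebra_simps sum_distrib_left sum_subtractf)
    qed
    have "w s b = 0" for s by (simp add: w_def mult.commute)
    moreover have "\<exists>s\<in>S. z' s \<noteq> 0" using z(1) t by (auto simp: z'_def)
    ultimately show ?thesis using z(2) by (intro exI[of _ z']) (auto simp: sum)
  qed
qed

section \<open>Integral combinations and spans\<close>

context comm_group
begin

lemma Zcomb_closed [simp]: "S \<subseteq> carrier G \<Longrightarrow> Zcomb G S c \<in> carrier G"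
  unfolding Zcomb_def by (intro finprod_closed) auto

lemma Zcomb_add: "S \<subseteq> carrier G \<Longrightarrow> Zcomb G S (\<lambda>x. c x + d x) = Zcomb G S c \<otimes> Zcomb G S d"
  unfolding Zcomb_def
  by (subst finprod_multf[symmetric]) (auto intro!: finprod_cong' simp: int_pow_mult subset_iff simp del: finprod_multf)

lemma Zcomb_zero: "S \<subseteq> carrier G \<Longrightarrow> (\<And>x. x \<in> S \<Longrightarrow> c x = 0) \<Longrightarrow> Zcomb G S c = \<one>"
  unfolding Zcomb_def by (intro finprod_one_eqI) auto

lemma Zcomb_insert:
  "finite S \<Longrightarrow> x \<notin> S \<Longrightarrow> insert x S \<subseteq> carrier G \<Longrightarrow> Zcomb G (insert x S) c = x [^] c x \<otimes> Zcomb G S c"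
  unfolding Zcomb_def by (subst finprod_insert) auto

lemma Zcomb_cong: "S \<subseteq> carrier G \<Longrightarrow> (\<And>x. x \<in> S \<Longrightarrow> c x = d x) \<Longrightarrow> Zcomb G S c = Zcomb G S d"
  unfolding Zcomb_def by (intro finprod_cong') auto

lemma Zcomb_pow:
  assumes "S \<subseteq> carrier G"
  shows "Zcomb G S c [^] (n::int) = Zcomb G S (\<lambda>x. n * c x)"
proof (cases "finite S")
  case True thus ?thesis using assms
  proof (induction S)
    case empty thus ?case by (simp add: Zcomb_def)
  next
    case (insert x S)
    thus ?case by (simp add: Zcomb_insert int_pow_distrib int_pow_pow mult.commute)
  qed
qed (simp add: Zcomb_def)

lemma Zcomb_neg: "S \<subseteq> carrier G \<Longrightarrow> Zcomb G S (\<lambda>x. - c x) = inv (Zcomb G S c)"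
  using Zcomb_pow[of S c "-1"] by (simp add: int_pow_neg)

lemma Zspan_closed: "S \<subseteq> carrier G \<Longrightarrow> g \<in> Zspan G S \<Longrightarrow> g \<in> carrier G"
  unfolding Zspan_def by auto

lemma Zspan_mult:
  assumes "S \<subseteq> carrier G" "g \<in> Zspan G S" "h \<in> Zspan G S" shows "g \<otimes> h \<in> Zspan G S"
proof -
  obtain c d where "g = Zcomb G S c" "h = Zcomb G S d" using assms(2,3) unfolding Zspan_def by blast
  hence "g \<otimes> h = Zcomb G S (\<lambda>x. c x + d x)" using Zcomb_add[OF assms(1), of c d] by simp
  thus ?thesis unfolding Zspan_def by blast
qed

lemma Zspan_pow: "S \<subseteq> carrier G \<Longrightarrow> g \<in> Zspan G S \<Longrightarrow> g [^] (n::int) \<in> Zspan G S"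
  unfolding Zspan_def by (auto simp: Zcomb_pow)

lemma Zspan_one: "S \<subseteq> carrier G \<Longrightarrow> \<one> \<in> Zspan G S"
  using Zcomb_zero[of S "\<lambda>_. 0"] unfolding Zspan_def by (metis rangeI)

lemma Zspan_base:
  assumes "finite S" "S \<subseteq> carrier G" "x \<in> S" shows "x \<in> Zspan G S"
proof -
  have S: "insert x (S - {x}) = S" using assms by auto
  have "Zcomb G (insert x (S - {x})) (\<lambda>y. if y = x then 1 else 0) = x \<otimes> Zcomb G (S - {x}) (\<lambda>y. if y = x then 1 else 0)"
    using assms by (subst Zcomb_insert) auto
  also have "Zcomb G (S - {x}) (\<lambda>y. if y = x then 1 else 0) = \<one>"
    using assms by (intro Zcomb_zero) auto
  finally have "Zcomb G (insert x (S - {x})) (\<lambda>y. if y = x then 1 else 0) = x"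
    using subsetD[OF assms(2,3)] by simp
  hence "x = Zcomb G S (\<lambda>y. if y = x then 1 else 0)" unfolding S by (rule sym)
  thus ?thesis unfolding Zspan_def by blast
qed

lemma Zspan_induct [consumes 3, case_names one step]:
  assumes "finite R" "R \<subseteq> carrier G" "g \<in> Zspan G R"
    and one: "P \<one>" and step: "\<And>x y n. x \<in> R \<Longrightarrow> y \<in> carrier G \<Longrightarrow> P y \<Longrightarrow> P (x [^] (n::int) \<otimes> y)"
  shows "P g"
proof -
  have "P (Zcomb G T c)" if "T \<subseteq> R" for T c
  proof -
    have "finite T" using that assms finite_subset by blast
    thus ?thesis using that
    proof (induction T)
      case empty thus ?case using one by (simp add: Zcomb_def)
    next
      case (insert x T)
      thus ?case using assms(2) by (subst Zcomb_insert) (auto intro!: step)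
    qed
  qed
  thus ?thesis using assms(3) unfolding Zspan_def by auto
qed

lemma Zspan_pow_trans:
  assumes R: "finite R" "R \<subseteq> carrier G" and B: "B \<subseteq> carrier G"
    and g: "g \<in> Zspan G R" and "\<And>r. r \<in> R \<Longrightarrow> r [^] (m::int) \<in> Zspan G B"
  shows "g [^] m \<in> Zspan G B"
proof -
  have "g [^] m \<in> Zspan G B \<and> g \<in> carrier G"
    using R g
  proof (induction rule: Zspan_induct)
    case one thus ?case using B by (simp add: Zspan_one)
  next
    case 2: (step x y n)
    have x: "x \<in> carrier G" using 2 R by auto
    have "(x [^] n \<otimes> y) [^] m = (x [^] m) [^] n \<otimes> y [^] m"
      using x 2 by (simp add: int_pow_distrib int_pow_pow mult.commute)
    moreover have "(x [^] m) [^] n \<in> Zspan G B" using 2 assms(5) B by (simp add: Zspan_pow)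
    ultimately show ?case using 2 x B by (simp add: Zspan_mult)
  qed
  thus ?thesis by blast
qed

lemma Zcomb_sum:
  assumes "finite S" "B \<subseteq> carrier G"
  shows "(\<Otimes>s\<in>S. Zcomb G B (f s)) = Zcomb G B (\<lambda>b. \<Sum>s\<in>S. f s b)"
  using assms
proof (induction S)
  case empty thus ?case by (simp add: Zcomb_zero)
next
  case (insert s S)
  thus ?case by (simp add: Zcomb_add)
qed

text \<open>Multiples of the elements of S have integral coordinates in B. If S were larger than B,
  \<open>int_relation\<close> would give a relation among these multiples, hence one in S.\<close>

lemma independent_card_le:
  assumes S: "Z_independent G S" and B: "finite B" "B \<subseteq> carrier G"
    and mult: "\<And>s. s \<in> S \<Longrightarrow> \<exists>n::int. n \<noteq> 0 \<and> s [^] n \<in> Zspan G B"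
  shows "card S \<le> card B"
proof (rule ccontr)
  assume "\<not> card S \<le> card B"
  hence lt: "card B < card S" by simp
  have S': "finite S" "S \<subseteq> carrier G" using S by (auto simp: Z_independent_iff)
  have "\<forall>s\<in>S. \<exists>n c. n \<noteq> (0::int) \<and> s [^] n = Zcomb G B c"
    using mult unfolding Zspan_def by blast
  then obtain n c where nc: "\<And>s. s \<in> S \<Longrightarrow> n s \<noteq> (0::int) \<and> s [^] n s = Zcomb G B (c s)"
    by metis
  obtain z where z: "\<exists>s\<in>S. z s \<noteq> 0" "\<forall>b\<in>B. (\<Sum>s\<in>S. z s * c s b) = 0"
    using int_relation[OF B(1) S'(1) lt, of c] by blast
  have "Zcomb G S (\<lambda>s. n s * z s) = (\<Otimes>s\<in>S. Zcomb G B (\<lambda>b. z s * c s b))"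
    unfolding Zcomb_def[of G S]
  proof (intro finprod_cong')
    fix s assume "s \<in> S"
    hence "s [^] (n s * z s) = (s [^] n s) [^] z s" using S' by (auto simp: int_pow_pow)
    thus "s [^] (n s * z s) = Zcomb G B (\<lambda>b. z s * c s b)"
      using nc[OF \<open>s \<in> S\<close>] B by (simp add: Zcomb_pow)
  qed (use B in auto)
  also have "\<dots> = Zcomb G B (\<lambda>b. \<Sum>s\<in>S. z s * c s b)"
    using S' B by (simp add: Zcomb_sum)
  also have "\<dots> = \<one>" using z(2) B by (intro Zcomb_zero) auto
  finally have "\<forall>s\<in>S. n s * z s = 0" using S unfolding Z_independent_iff by blast
  thus False using z(1) nc by auto
qed

section \<open>Maximal independent sets\<close>

lemma Z_independent_empty: "Z_independent G {}"
  by (simp add: Z_independent_iff)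

lemma rank_attained:
  assumes "bounded_rank G"
  obtains S where "Z_independent G S" "card S = group_rank G" "\<And>T. Z_independent G T \<Longrightarrow> card T \<le> group_rank G"
proof -
  obtain N where N: "\<And>S. Z_independent G S \<Longrightarrow> card S \<le> N" using assms unfolding bounded_rank_def by blast
  let ?P = "\<lambda>n. \<exists>S. Z_independent G S \<and> card S = n"
  have "?P 0" using Z_independent_empty by (intro exI[of _ "{}"]) simp
  hence "?P (group_rank G)" unfolding group_rank_def
    by (rule GreatestI_nat[where b = N]) (use N in auto)
  moreover have "card T \<le> group_rank G" if "Z_independent G T" for T
    unfolding group_rank_def by (rule Greatest_le_nat[where b = N]) (use N that in auto)
  ultimately show ?thesis using that by blast
qed

text \<open>By maximality g satisfies a relation with S, and independence of S makes the coefficient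
  of g in it nonzero.\<close>

lemma multiple_in_Zspan:
  assumes S: "Z_independent G S" and max: "\<And>T. Z_independent G T \<Longrightarrow> card T \<le> card S" and g: "g \<in> carrier G"
  shows "\<exists>n::int. n \<noteq> 0 \<and> g [^] n \<in> Zspan G S"
proof (cases "g \<in> S")
  case True
  thus ?thesis using S g by (intro exI[of _ 1]) (auto simp: Z_independent_iff Zspan_base)
next
  case False
  have S': "finite S" "S \<subseteq> carrier G" using S by (auto simp: Z_independent_iff)
  have "\<not> Z_independent G (insert g S)" using max[of "insert g S"] False S' by auto
  then obtain c where c: "Zcomb G (insert g S) c = \<one>" "\<exists>x\<in>insert g S. c x \<noteq> 0"
    unfolding Z_independent_iff using S' g by auto
  have eq: "g [^] c g \<otimes> Zcomb G S c = \<one>" using c(1) S' g False by (simp add: Zcomb_insert)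
  have "c g \<noteq> 0"
  proof
    assume "c g = 0"
    hence "Zcomb G S c = \<one>" using eq S' by simp
    thus False using S c(2) \<open>c g = 0\<close> unfolding Z_independent_iff by blast
  qed
  moreover have "g [^] c g = Zcomb G S (\<lambda>x. - c x)"
    using eq S' g by (simp add: Zcomb_neg inv_equality)
  ultimately show ?thesis unfolding Zspan_def by blast
qed

lemma rank_eqI:
  assumes S: "Z_independent G S" and span: "\<And>g. g \<in> carrier G \<Longrightarrow> \<exists>n::int. n \<noteq> 0 \<and> g [^] n \<in> Zspan G S"
  shows "group_rank G = card S" "bounded_rank G"
proof -
  have S': "finite S" "S \<subseteq> carrier G" using S by (auto simp: Z_independent_iff)
  have le: "card T \<le> card S" if "Z_independent G T" for T
    using independent_card_le[OF that S'] span that by (auto simp: Z_independent_iff)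
  thus "bounded_rank G" unfolding bounded_rank_def by blast
  show "group_rank G = card S" unfolding group_rank_def
    by (rule Greatest_equality) (use S le in auto)
qed

lemma Zcomb_Un_disjoint:
  assumes "finite S" "finite T" "S \<subseteq> carrier G" "T \<subseteq> carrier G" "S \<inter> T = {}"
  shows "Zcomb G (S \<union> T) c = Zcomb G S c \<otimes> Zcomb G T c"
  unfolding Zcomb_def using assms by (intro finprod_Un_disjoint) auto

lemma Zspan_mono:
  assumes "finite T" "S \<subseteq> T" "T \<subseteq> carrier G"
  shows "Zspan G S \<subseteq> Zspan G T"
proof
  fix g assume "g \<in> Zspan G S"
  moreover have "finite S" using assms finite_subset by blast
  moreover have "r [^] (1::int) \<in> Zspan G T" if "r \<in> S" for r
    using Zspan_base[of T r] assms that by (metis int_pow_1 subsetD)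
  ultimately have "g [^] (1::int) \<in> Zspan G T"
    using assms Zspan_pow_trans[of S T g 1] by blast
  thus "g \<in> Zspan G T" using assms \<open>g \<in> Zspan G S\<close> Zspan_closed[of S g] by auto
qed

lemma independent_not_torsion:
  assumes S: "Z_independent G S" "s \<in> S" and n: "s [^] (n::int) = \<one>"
  shows "n = 0"
proof -
  have S': "finite S" "S \<subseteq> carrier G" using S by (auto simp: Z_independent_iff)
  let ?c = "\<lambda>y. if y = s then n else 0"
  have e: "insert s (S - {s}) = S" using S by auto
  have "Zcomb G (insert s (S - {s})) ?c = s [^] n \<otimes> Zcomb G (S - {s}) ?c"
    using S S' by (subst Zcomb_insert) auto
  also have "Zcomb G (S - {s}) ?c = \<one>" using S' by (intro Zcomb_zero) auto
  finally have "Zcomb G S ?c = \<one>" using n e by simp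
  from S(1)[unfolded Z_independent_iff, THEN conjunct2, THEN conjunct2, rule_format, OF this S(2)]
  show ?thesis by simp
qed

section \<open>Parities and descent in abelian groups\<close>

lemma parity_one: "parity_hom G \<epsilon> \<Longrightarrow> \<not> \<epsilon> \<one>"
  unfolding parity_hom_def by (metis l_one one_closed)

lemma parity_inv: "parity_hom G \<epsilon> \<Longrightarrow> x \<in> carrier G \<Longrightarrow> \<epsilon> (inv x) = \<epsilon> x"
  using parity_one[of \<epsilon>] unfolding parity_hom_def by (metis inv_closed r_inv)

lemma parity_mult:
  "parity_hom G \<epsilon> \<Longrightarrow> x \<in> carrier G \<Longrightarrow> y \<in> carrier G \<Longrightarrow> \<epsilon> (x \<otimes> y) = (\<epsilon> x \<noteq> \<epsilon> y)"
  unfolding parity_hom_def by blast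

lemma parity_nat_pow:
  assumes "parity_hom G \<epsilon>" "x \<in> carrier G" shows "\<epsilon> (x [^] (n::nat)) = (odd n \<and> \<epsilon> x)"
  by (induction n) (use assms in \<open>auto simp: parity_one[OF assms(1)] parity_mult[OF assms(1)]\<close>)

lemma parity_int_pow:
  assumes "parity_hom G \<epsilon>" "x \<in> carrier G" shows "\<epsilon> (x [^] (n::int)) = (odd n \<and> \<epsilon> x)"
proof (cases "n < 0")
  case True
  hence "\<epsilon> (x [^] n) = \<epsilon> (inv (x [^] nat (- n)))" by (simp only: int_pow_def2 if_True)
  also have "\<dots> = \<epsilon> (x [^] nat (- n))" using assms by (intro parity_inv) auto
  also have "\<dots> = (odd (nat (- n)) \<and> \<epsilon> x)" using assms by (rule parity_nat_pow)
  also have "odd (nat (- n)) = odd n" using True by (simp add: even_nat_iff)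
  finally show ?thesis .
next
  case False
  hence "\<epsilon> (x [^] n) = \<epsilon> (x [^] nat n)" by (simp only: int_pow_def2 if_False)
  also have "\<dots> = (odd (nat n) \<and> \<epsilon> x)" using assms by (rule parity_nat_pow)
  also have "odd (nat n) = odd n" using False by (simp add: even_nat_iff)
  finally show ?thesis .
qed

text \<open>Infinite descent on the coefficients: a relation has even coefficients, and can be halved.\<close>

lemma parity_independent:
  assumes B: "finite B" "B \<subseteq> carrier G"
    and \<epsilon>: "\<And>b. b \<in> B \<Longrightarrow> parity_hom G (\<epsilon> b)" "\<And>b b'. b \<in> B \<Longrightarrow> b' \<in> B \<Longrightarrow> \<epsilon> b b' = (b = b')"
    and tors: "\<And>g. g \<in> Zspan G B \<Longrightarrow> g \<otimes> g = \<one> \<Longrightarrow> g = \<one>"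
  shows "Z_independent G B"
proof -
  have parity: "\<epsilon> b (Zcomb G T c) = (b \<in> T \<and> odd (c b))" if "b \<in> B" "finite T" "T \<subseteq> B" for b T c
    using that(2,3)
  proof (induction T)
    case empty thus ?case using parity_one[OF \<epsilon>(1)[OF that(1)]] by (simp add: Zcomb_def)
  next
    case (insert x T)
    have x: "x \<in> carrier G" "x \<in> B" and T: "T \<subseteq> carrier G" "insert x T \<subseteq> carrier G" using insert B by auto
    have "\<epsilon> b (Zcomb G (insert x T) c) = (\<epsilon> b (x [^] c x) \<noteq> \<epsilon> b (Zcomb G T c))"
      using x T insert by (simp add: Zcomb_insert parity_mult[OF \<epsilon>(1)[OF that(1)]])
    thus ?case using insert x that(1) \<epsilon>(2)[OF that(1) x(2)]
      by (auto simp: parity_int_pow[OF \<epsilon>(1)[OF that(1)] x(1)])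
  qed
  have "\<forall>x\<in>B. c x = 0" if "Zcomb G B c = \<one>" for c
    using that
  proof (induction "\<Sum>b\<in>B. nat \<bar>c b\<bar>" arbitrary: c rule: less_induct)
    case less
    have ev: "even (c b)" if "b \<in> B" for b
      using parity[of b B c] that B less.prems parity_one[OF \<epsilon>(1)[OF that]] by auto
    define d where "d b = c b div 2" for b
    have cd: "c b = 2 * d b" if "b \<in> B" for b using ev[OF that] by (simp add: d_def)
    have "Zcomb G B d \<otimes> Zcomb G B d = Zcomb G B (\<lambda>b. d b + d b)" by (rule Zcomb_add[OF B(2), symmetric])
    also have "\<dots> = Zcomb G B c" by (rule Zcomb_cong[OF B(2)]) (simp add: cd)
    finally have "Zcomb G B d = \<one>" using less.prems tors unfolding Zspan_def by auto
    show ?case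
    proof (rule ccontr)
      assume "\<not> ?case"
      then obtain b where b: "b \<in> B" "c b \<noteq> 0" by blast
      \<comment> \<open>The sum of absolute values of the coefficients is the measure that halving
        decreases.\<close>
      have "(\<Sum>b\<in>B. nat \<bar>d b\<bar>) < (\<Sum>b\<in>B. nat \<bar>c b\<bar>)"
        using B b by (intro sum_strict_mono_ex1) (auto simp: cd intro!: bexI[of _ b])
      from less.hyps[OF this \<open>Zcomb G B d = \<one>\<close>] show False using b cd by auto
    qed
  qed
  thus ?thesis using B by (auto simp: Z_independent_iff)
qed

text \<open>Passing to the kernel of one parity costs at most one element b of H with odd parity,
  while the set of representatives at most doubles. The size of B, not of R, will bound the
  rank.\<close>

lemma parity_reps:
  assumes "finite I" and "\<And>i. i \<in> I \<Longrightarrow> parity_hom G (\<epsilon> i)"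
    and "subgroup H G"
  shows "\<exists>B R. finite B \<and> B \<subseteq> H \<and> card B \<le> card I \<and> finite R \<and> R \<subseteq> H \<inter> Zspan G B \<and>
           (\<forall>P\<in>H. \<exists>r\<in>R. \<forall>i\<in>I. \<not> \<epsilon> i (P \<otimes> inv r))"
  using assms
proof (induction I arbitrary: H rule: finite_induct)
  case empty
  interpret subgroup H G by fact
  show ?case by (intro exI[of _ "{}"] exI[of _ "{\<one>}"]) (auto simp: Zspan_one)
next
  case (insert i I)
  interpret subgroup H G by fact
  have eps: "parity_hom G (\<epsilon> i)" using insert by auto
  define H' where "H' = {P \<in> H. \<not> \<epsilon> i P}"
  have H': "subgroup H' G"
  proof
    show "H' \<subseteq> carrier G" using subset by (auto simp: H'_def)
  next
    fix x y assume "x \<in> H'" "y \<in> H'"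
    thus "x \<otimes> y \<in> H'" using mem_carrier by (auto simp: H'_def parity_mult[OF eps])
  next
    show "\<one> \<in> H'" by (simp add: H'_def parity_one[OF eps])
  next
    fix x assume "x \<in> H'"
    thus "inv x \<in> H'" using mem_carrier by (auto simp: H'_def parity_inv[OF eps])
  qed
  have "\<exists>B R. finite B \<and> B \<subseteq> H' \<and> card B \<le> card I \<and> finite R \<and> R \<subseteq> H' \<inter> Zspan G B \<and>
           (\<forall>P\<in>H'. \<exists>r\<in>R. \<forall>i\<in>I. \<not> \<epsilon> i (P \<otimes> inv r))"
    by (rule insert.IH[OF insert.prems(1)[OF insertI2] H'])
  then obtain B R where BR: "finite B" "B \<subseteq> H'" "card B \<le> card I" "finite R" "R \<subseteq> H' \<inter> Zspan G B"
    and cover: "\<forall>P\<in>H'. \<exists>r\<in>R. \<forall>i\<in>I. \<not> \<epsilon> i (P \<otimes> inv r)"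
    by (elim exE conjE)
  have BH: "B \<subseteq> H" "R \<subseteq> H" and BG: "B \<subseteq> carrier G" "R \<subseteq> carrier G" using BR subset by (auto simp: H'_def)
  show ?case
  proof (cases "\<exists>b\<in>H. \<epsilon> i b")
    case False
    hence "H' = H" by (auto simp: H'_def)
    show ?thesis
    proof (rule exI[of _ B], rule exI[of _ R], intro conjI ballI)
      fix P assume P: "P \<in> H"
      hence "P \<in> H'" using \<open>H' = H\<close> by simp
      then obtain r where r: "r \<in> R" "\<forall>i\<in>I. \<not> \<epsilon> i (P \<otimes> inv r)" using cover by meson
      moreover have "P \<otimes> inv r \<in> H" using P r BH by auto
      ultimately show "\<exists>r\<in>R. \<forall>j\<in>insert i I. \<not> \<epsilon> j (P \<otimes> inv r)" using False by blast
    qed (use BR insert \<open>H' = H\<close> in auto)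
  next
    case True
    then obtain b where b: "b \<in> H" "\<epsilon> i b" by blast
    have bG: "b \<in> carrier G" using b subset by auto
    define R' where "R' = R \<union> (\<lambda>r. r \<otimes> b) ` R"
    have sub: "insert b B \<subseteq> carrier G" using BG bG by auto
    have sp: "R \<subseteq> Zspan G (insert b B)" "b \<in> Zspan G (insert b B)"
      using BR(1,5) Zspan_mono[OF _ subset_insertI[of B b] sub] sub Zspan_base[of "insert b B" b] by blast+
    show ?thesis
    proof (rule exI[of _ "insert b B"], rule exI[of _ R'], intro conjI ballI)
      show "card (insert b B) \<le> card (insert i I)" using BR insert by (simp add: card_insert_if)
      show "R' \<subseteq> H \<inter> Zspan G (insert b B)"
        using sp sub BH b by (auto simp: R'_def intro!: Zspan_mult)
    next
      fix P assume P: "P \<in> H"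
      have PG: "P \<in> carrier G" using P subset by auto
      show "\<exists>r\<in>R'. \<forall>j\<in>insert i I. \<not> \<epsilon> j (P \<otimes> inv r)"
      proof (cases "\<epsilon> i P")
        case False
        hence "P \<in> H'" using P by (simp add: H'_def)
        then obtain r where r: "r \<in> R" "\<forall>i\<in>I. \<not> \<epsilon> i (P \<otimes> inv r)" using cover by meson
        have "\<not> \<epsilon> i r" "r \<in> carrier G" using r BR BG by (auto simp: H'_def)
        hence "\<not> \<epsilon> i (P \<otimes> inv r)" using False PG
          by (simp add: parity_inv[OF eps] parity_mult[OF eps])
        thus ?thesis using r by (auto simp: R'_def)
      next
        case True
        have "P \<otimes> inv b \<in> H'"
          using True b P PG bG by (simp add: H'_def parity_mult[OF eps] parity_inv[OF eps])
        then obtain r where r: "r \<in> R" "\<forall>i\<in>I. \<not> \<epsilon> i (P \<otimes> inv b \<otimes> inv r)" using cover by meson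
        have rr: "\<not> \<epsilon> i r" "r \<in> carrier G" using r BR BG by (auto simp: H'_def)
        have eq: "P \<otimes> inv b \<otimes> inv r = P \<otimes> inv (r \<otimes> b)"
          using PG bG rr by (simp add: inv_mult_group m_assoc)
        have "\<not> \<epsilon> i (P \<otimes> inv b \<otimes> inv r)" using True b rr PG bG
          by (simp add: parity_inv[OF eps] parity_mult[OF eps])
        thus ?thesis using r eq by (intro bexI[of _ "r \<otimes> b"]) (auto simp: R'_def)
      qed
    qed (use BR b BH in \<open>auto simp: R'_def\<close>)
  qed
qed

text \<open>Fermat's descent: halving repeatedly keeps the height bounded, so the sequence of halves is
  eventually periodic.\<close>

lemma height_descent:
  fixes h :: "'a \<Rightarrow> nat"
  assumes R: "finite R" "R \<subseteq> carrier G"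
    and half: "\<And>P. P \<in> carrier G \<Longrightarrow> \<exists>r\<in>R. \<exists>Q\<in>carrier G. P = r \<otimes> (Q \<otimes> Q) \<and> 2 * h Q \<le> h P + C"
    and fin: "\<And>B. finite {P \<in> carrier G. h P \<le> B}"
    and P: "P \<in> carrier G"
  shows "\<exists>n::int. n \<noteq> 0 \<and> P [^] n \<in> Zspan G R"
proof -
  have "\<forall>P\<in>carrier G. \<exists>Q\<in>carrier G. (\<exists>r\<in>R. P = r \<otimes> (Q \<otimes> Q)) \<and> 2 * h Q \<le> h P + C" using half by blast
  then obtain f where f: "\<And>P. P \<in> carrier G \<Longrightarrow> f P \<in> carrier G \<and> (\<exists>r\<in>R. P = r \<otimes> (f P \<otimes> f P)) \<and> 2 * h (f P) \<le> h P + C"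
    by metis
  have cl: "(f ^^ n) P \<in> carrier G" for n by (induction n) (use P f in auto)
  have bd: "h ((f ^^ n) P) \<le> max (h P) C" for n
  proof (induction n)
    case (Suc n)
    thus ?case using f[OF cl[of n]] by auto
  qed simp
  have "\<not> inj_on (\<lambda>n. (f ^^ n) P) (UNIV :: nat set)"
  proof
    assume "inj_on (\<lambda>n. (f ^^ n) P) (UNIV :: nat set)"
    moreover have "finite (range (\<lambda>n. (f ^^ n) P))"
      by (rule finite_subset[OF _ fin[of "max (h P) C"]]) (use cl bd in auto)
    ultimately show False using finite_imageD by blast
  qed
  then obtain i k where ik: "(f ^^ (i + k)) P = (f ^^ i) P" "k > 0"
    unfolding inj_on_def by (metis UNIV_I less_imp_add_positive linorder_neqE_nat)
  \<comment> \<open>Unrolling the halving n times collects all remainders r, weighted by powers of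
    2, in one element s of the span.\<close>
  have step: "\<exists>s\<in>Zspan G R. Q = s \<otimes> (f ^^ n) Q [^] (2 ^ n :: int)" if "Q \<in> carrier G" for Q n
    using that
  proof (induction n arbitrary: Q)
    case 0 thus ?case using R by (auto intro!: bexI[of _ \<one>] simp: Zspan_one)
  next
    case (Suc n)
    obtain r where r: "r \<in> R" "Q = r \<otimes> (f Q \<otimes> f Q)" and fQ: "f Q \<in> carrier G" using f[OF Suc.prems] by blast
    obtain s where s: "s \<in> Zspan G R" "f Q = s \<otimes> (f ^^ n) (f Q) [^] (2 ^ n :: int)"
      using Suc.IH[OF fQ] by blast
    define T where "T = (f ^^ n) (f Q)"
    have T: "T \<in> carrier G" unfolding T_def by (induction n) (use fQ f in auto)
    have sG: "s \<in> carrier G" "r \<in> carrier G" using s r R Zspan_closed by auto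
    have sq: "x \<otimes> x = x [^] (2::int)" if "x \<in> carrier G" for x
      using int_pow_mult[OF that, of 1 1] that by simp
    have "Q = r \<otimes> (s \<otimes> T [^] (2 ^ n :: int)) [^] (2::int)"
      using r(2) s(2) sq[OF fQ] by (simp add: T_def)
    also have "\<dots> = (r \<otimes> s [^] (2::int)) \<otimes> T [^] (2 ^ n * 2 :: int)"
      using sG T by (simp add: int_pow_distrib int_pow_pow m_assoc)
    finally have "Q = (r \<otimes> s [^] (2::int)) \<otimes> (f ^^ Suc n) Q [^] (2 ^ Suc n :: int)"
      by (simp add: T_def funpow_swap1 mult.commute)
    moreover have "r \<otimes> s [^] (2::int) \<in> Zspan G R"
      using R r s by (simp add: Zspan_mult Zspan_pow Zspan_base)
    ultimately show ?case by blast
  qed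
  define Q where "Q = (f ^^ i) P"
  have Q: "Q \<in> carrier G" using cl by (simp add: Q_def)
  have "(f ^^ k) Q = Q" using ik by (simp add: Q_def add.commute[of i] funpow_add)
  then obtain s where s: "s \<in> Zspan G R" "Q = s \<otimes> Q [^] (2 ^ k :: int)" using step[OF Q, of k] by auto
  obtain s' where s': "s' \<in> Zspan G R" "P = s' \<otimes> Q [^] (2 ^ i :: int)" using step[OF P, of i] by (auto simp: Q_def)
  \<comment> \<open>A period k turns the unrolled equation into (1 - 2^k) Q = s, written additively;
    the factor is nonzero since k > 0.\<close>
  define n where "n = (1 - 2 ^ k :: int)"
  have "(2::int) ^ k \<noteq> 1" using ik by simp
  hence n: "n \<noteq> 0" by (simp add: n_def)
  have sG: "s \<in> carrier G" "s' \<in> carrier G" using s s' R Zspan_closed by auto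
  have "Q [^] n = Q \<otimes> inv (Q [^] (2 ^ k :: int))" unfolding n_def using Q by (subst int_pow_diff) simp_all
  also have "\<dots> = s" using s(2) sG Q by (metis int_pow_closed inv_solve_right')
  finally have Qn: "Q [^] n = s" .
  have "P [^] n = s' [^] n \<otimes> (Q [^] n) [^] (2 ^ i :: int)"
    by (subst s'(2)) (use sG Q in \<open>simp add: int_pow_distrib int_pow_pow mult.commute\<close>)
  also have "\<dots> \<in> Zspan G R" using R s s' Qn by (auto intro!: Zspan_mult Zspan_pow)
  finally show ?thesis using n by blast
qed

end

section \<open>Transport along injective homomorphisms and additivity of the rank\<close>

lemma hom_Zcomb:
  assumes G: "comm_group G" "comm_group H" and \<phi>: "\<phi> \<in> hom G H" "inj_on \<phi> (carrier G)"
    and S: "finite S" "S \<subseteq> carrier G"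
  shows "\<phi> (Zcomb G S (\<lambda>x. c (\<phi> x))) = Zcomb H (\<phi> ` S) c"
  using S
proof (induction S)
  case empty
  interpret group_hom G H \<phi> using G \<phi> by (simp add: group_hom_def group_hom_axioms_def comm_group.axioms)
  interpret G: comm_group G by fact
  interpret H: comm_group H by fact
  show ?case by (simp add: Zcomb_def)
next
  case (insert x S)
  interpret group_hom G H \<phi> using G \<phi> by (simp add: group_hom_def group_hom_axioms_def comm_group.axioms)
  interpret G: comm_group G by fact
  interpret H: comm_group H by fact
  have "\<phi> x \<notin> \<phi> ` S" using insert \<phi>(2) by (auto simp: inj_on_def)
  moreover have "insert (\<phi> x) (\<phi> ` S) \<subseteq> carrier H" using insert by auto
  ultimately show ?case using insert by (simp add: G.Zcomb_insert H.Zcomb_insert hom_int_pow)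
qed

lemma independent_hom:
  assumes G: "comm_group G" "comm_group H" and \<phi>: "\<phi> \<in> hom G H" "inj_on \<phi> (carrier G)"
    and S: "S \<subseteq> carrier G"
  shows "Z_independent H (\<phi> ` S) \<longleftrightarrow> Z_independent G S"
proof -
  interpret group_hom G H \<phi> using G \<phi> by (simp add: group_hom_def group_hom_axioms_def comm_group.axioms)
  interpret G: comm_group G by fact
  interpret H: comm_group H by fact
  have inj: "inj_on \<phi> S" using \<phi>(2) S inj_on_subset by blast
  have fin: "finite (\<phi> ` S) \<longleftrightarrow> finite S" using inj finite_image_iff by blast
  show ?thesis
  proof (cases "finite S")
    case True
    note hz = hom_Zcomb[OF G \<phi> True S]
    have one: "\<phi> g = \<one>\<^bsub>H\<^esub> \<longleftrightarrow> g = \<one>\<^bsub>G\<^esub>" if "g \<in> carrier G" for g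
      using \<phi>(2) that by (metis inj_on_def G.one_closed hom_one)
    have "(\<forall>c. Zcomb H (\<phi> ` S) c = \<one>\<^bsub>H\<^esub> \<longrightarrow> (\<forall>x\<in>\<phi> ` S. c x = 0)) \<longleftrightarrow>
          (\<forall>c. Zcomb G S c = \<one>\<^bsub>G\<^esub> \<longrightarrow> (\<forall>x\<in>S. c x = 0))" (is "?L \<longleftrightarrow> ?R")
    proof
      assume L: ?L
      show ?R
      proof (intro allI impI)
        fix c assume c: "Zcomb G S c = \<one>\<^bsub>G\<^esub>"
        define d where "d y = c (the_inv_into S \<phi> y)" for y
        have d: "d (\<phi> x) = c x" if "x \<in> S" for x using inj that by (simp add: d_def the_inv_into_f_f)
        have "Zcomb G S (\<lambda>x. d (\<phi> x)) = \<one>\<^bsub>G\<^esub>" using c d S G.Zcomb_cong[of S "\<lambda>x. d (\<phi> x)" c] by simp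
        hence "Zcomb H (\<phi> ` S) d = \<one>\<^bsub>H\<^esub>" using hz[of d] by simp
        thus "\<forall>x\<in>S. c x = 0" using L d by force
      qed
    next
      assume R: ?R
      show ?L
      proof (intro allI impI)
        fix c assume "Zcomb H (\<phi> ` S) c = \<one>\<^bsub>H\<^esub>"
        hence "Zcomb G S (\<lambda>x. c (\<phi> x)) = \<one>\<^bsub>G\<^esub>" using hz[of c] one S by (metis G.Zcomb_closed)
        thus "\<forall>x\<in>\<phi> ` S. c x = 0" using R[rule_format, of "\<lambda>x. c (\<phi> x)"] by blast
      qed
    qed
    thus ?thesis using True S by (auto simp: Z_independent_iff)
  qed (use fin in \<open>auto simp: Z_independent_iff\<close>)
qed

lemma hom_Zspan:
  assumes G: "comm_group G" "comm_group H" and \<phi>: "\<phi> \<in> hom G H" "inj_on \<phi> (carrier G)"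
    and S: "finite S" "S \<subseteq> carrier G" and g: "g \<in> Zspan G S"
  shows "\<phi> g \<in> Zspan H (\<phi> ` S)"
proof -
  interpret G: comm_group G by fact
  have inj: "inj_on \<phi> S" using \<phi>(2) S inj_on_subset by blast
  obtain c where c: "g = Zcomb G S c" using g unfolding Zspan_def by blast
  define d where "d y = c (the_inv_into S \<phi> y)" for y
  have d: "d (\<phi> x) = c x" if "x \<in> S" for x using inj that by (simp add: d_def the_inv_into_f_f)
  have "g = Zcomb G S (\<lambda>x. d (\<phi> x))" using c d S G.Zcomb_cong[of S "\<lambda>x. d (\<phi> x)" c] by simp
  thus ?thesis using hom_Zcomb[OF G \<phi> S, of d] unfolding Zspan_def by auto
qed

text \<open>The sum need only be direct up to torsion and up to multiples, because splitting by an
  involution expresses 2g rather than g, and its two parts may share 2-torsion.\<close>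

lemma rank_add:
  assumes G: "comm_group G1" "comm_group G2" "comm_group G"
    and \<phi>1: "\<phi>1 \<in> hom G1 G" "inj_on \<phi>1 (carrier G1)" and \<phi>2: "\<phi>2 \<in> hom G2 G" "inj_on \<phi>2 (carrier G2)"
    and disj: "\<And>x y. x \<in> carrier G1 \<Longrightarrow> y \<in> carrier G2 \<Longrightarrow> \<phi>1 x \<otimes>\<^bsub>G\<^esub> \<phi>2 y = \<one>\<^bsub>G\<^esub> \<Longrightarrow>
             \<exists>n::int. n \<noteq> 0 \<and> \<phi>1 x [^]\<^bsub>G\<^esub> n = \<one>\<^bsub>G\<^esub>"
    and sum: "\<And>g. g \<in> carrier G \<Longrightarrow>
             \<exists>n::int. n \<noteq> 0 \<and> (\<exists>x\<in>carrier G1. \<exists>y\<in>carrier G2. g [^]\<^bsub>G\<^esub> n = \<phi>1 x \<otimes>\<^bsub>G\<^esub> \<phi>2 y)"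
    and bd: "bounded_rank G1" "bounded_rank G2"
  shows "group_rank G = group_rank G1 + group_rank G2"
proof -
  interpret G1: comm_group G1 by fact
  interpret G2: comm_group G2 by fact
  interpret G: comm_group G by fact
  interpret h1: group_hom G1 G \<phi>1 using G \<phi>1 by (simp add: group_hom_def group_hom_axioms_def comm_group.axioms)
  interpret h2: group_hom G2 G \<phi>2 using G \<phi>2 by (simp add: group_hom_def group_hom_axioms_def comm_group.axioms)
  obtain S1 where S1: "Z_independent G1 S1" "card S1 = group_rank G1" "\<And>T. Z_independent G1 T \<Longrightarrow> card T \<le> card S1"
    using G1.rank_attained[OF bd(1)] by metis
  obtain S2 where S2: "Z_independent G2 S2" "card S2 = group_rank G2" "\<And>T. Z_independent G2 T \<Longrightarrow> card T \<le> card S2"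
    using G2.rank_attained[OF bd(2)] by metis
  have c1: "finite S1" "S1 \<subseteq> carrier G1" and c2: "finite S2" "S2 \<subseteq> carrier G2"
    using S1 S2 by (auto simp: Z_independent_iff)
  define T1 T2 where "T1 = \<phi>1 ` S1" and "T2 = \<phi>2 ` S2"
  have T1: "Z_independent G T1" and T2: "Z_independent G T2"
    using independent_hom[OF G(1,3) \<phi>1 c1(2)] independent_hom[OF G(2,3) \<phi>2 c2(2)] S1 S2 by (simp_all add: T1_def T2_def)
  have T: "finite T1" "finite T2" "T1 \<subseteq> carrier G" "T2 \<subseteq> carrier G"
    using T1 T2 by (auto simp: Z_independent_iff)
  have cards: "card T1 = card S1" "card T2 = card S2"
    unfolding T1_def T2_def by (intro card_image; use \<phi>1 \<phi>2 c1 c2 inj_on_subset in blast)+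
  \<comment> \<open>A common element would be torsion, but members of an independent set have
    infinite order.\<close>
  have dis: "T1 \<inter> T2 = {}"
  proof (rule ccontr)
    assume "\<not> ?thesis"
    then obtain x y where xy: "x \<in> S1" "y \<in> S2" "\<phi>1 x = \<phi>2 y" by (auto simp: T1_def T2_def)
    hence "\<phi>1 x \<otimes>\<^bsub>G\<^esub> \<phi>2 (inv\<^bsub>G2\<^esub> y) = \<one>\<^bsub>G\<^esub>" using c1 c2 by auto
    then obtain n :: int where "n \<noteq> 0" "\<phi>1 x [^]\<^bsub>G\<^esub> n = \<one>\<^bsub>G\<^esub>"
      using disj[of x "inv\<^bsub>G2\<^esub> y"] xy c1 c2 by auto
    moreover have "\<phi>1 x \<in> T1" unfolding T1_def using xy(1) by (rule imageI)
    ultimately show False using G.independent_not_torsion[OF T1] by blast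
  qed
  have "Z_independent G (T1 \<union> T2)"
    unfolding Z_independent_iff
  proof (intro conjI allI impI)
    fix c assume "Zcomb G (T1 \<union> T2) c = \<one>\<^bsub>G\<^esub>"
    hence eq: "Zcomb G T1 c \<otimes>\<^bsub>G\<^esub> Zcomb G T2 c = \<one>\<^bsub>G\<^esub>" using T dis by (simp add: G.Zcomb_Un_disjoint)
    have e1: "Zcomb G T1 c = \<phi>1 (Zcomb G1 S1 (\<lambda>x. c (\<phi>1 x)))"
      unfolding T1_def using hom_Zcomb[OF G(1,3) \<phi>1 c1] by simp
    have e2: "Zcomb G T2 c = \<phi>2 (Zcomb G2 S2 (\<lambda>x. c (\<phi>2 x)))"
      unfolding T2_def using hom_Zcomb[OF G(2,3) \<phi>2 c2] by simp
    obtain n :: int where n: "n \<noteq> 0" "Zcomb G T1 c [^]\<^bsub>G\<^esub> n = \<one>\<^bsub>G\<^esub>"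
      using disj[OF _ _ eq[unfolded e1 e2]] c1 c2 unfolding e1 by auto
    hence "Zcomb G T1 (\<lambda>x. n * c x) = \<one>\<^bsub>G\<^esub>" using T by (simp add: G.Zcomb_pow)
    hence "\<forall>x\<in>T1. n * c x = 0" using T1[unfolded Z_independent_iff, THEN conjunct2, THEN conjunct2] by blast
    hence z1: "\<forall>x\<in>T1. c x = 0" using n by simp
    hence "Zcomb G T1 c = \<one>\<^bsub>G\<^esub>" using T by (simp add: G.Zcomb_zero)
    hence "Zcomb G T2 c = \<one>\<^bsub>G\<^esub>" using eq T by simp
    hence "\<forall>x\<in>T2. c x = 0" using T2 by (simp add: Z_independent_iff)
    thus "\<forall>x\<in>T1 \<union> T2. c x = 0" using z1 by blast
  qed (use T in auto)
  moreover have "\<exists>n::int. n \<noteq> 0 \<and> g [^]\<^bsub>G\<^esub> n \<in> Zspan G (T1 \<union> T2)" if g: "g \<in> carrier G" for g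
  proof -
    obtain n :: int and x y where n: "n \<noteq> 0" and x: "x \<in> carrier G1" and y: "y \<in> carrier G2"
      and e: "g [^]\<^bsub>G\<^esub> n = \<phi>1 x \<otimes>\<^bsub>G\<^esub> \<phi>2 y" using sum[OF g] by blast
    obtain n1 :: int where n1: "n1 \<noteq> 0" "x [^]\<^bsub>G1\<^esub> n1 \<in> Zspan G1 S1"
      using G1.multiple_in_Zspan[OF S1(1,3) x] by blast
    obtain n2 :: int where n2: "n2 \<noteq> 0" "y [^]\<^bsub>G2\<^esub> n2 \<in> Zspan G2 S2"
      using G2.multiple_in_Zspan[OF S2(1,3) y] by blast
    have U: "T1 \<union> T2 \<subseteq> carrier G" "finite (T1 \<union> T2)" using T by auto
    have "\<phi>1 x [^]\<^bsub>G\<^esub> n1 \<in> Zspan G T1"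
      using hom_Zspan[OF G(1,3) \<phi>1 c1 n1(2)] x by (simp add: T1_def h1.hom_int_pow)
    hence m1: "\<phi>1 x [^]\<^bsub>G\<^esub> n1 \<in> Zspan G (T1 \<union> T2)" using G.Zspan_mono[OF U(2) _ U(1)] by blast
    have "\<phi>2 y [^]\<^bsub>G\<^esub> n2 \<in> Zspan G T2"
      using hom_Zspan[OF G(2,3) \<phi>2 c2 n2(2)] y by (simp add: T2_def h2.hom_int_pow)
    hence m2: "\<phi>2 y [^]\<^bsub>G\<^esub> n2 \<in> Zspan G (T1 \<union> T2)" using G.Zspan_mono[OF U(2) _ U(1)] by blast
    have "g [^]\<^bsub>G\<^esub> (n * (n1 * n2)) = (g [^]\<^bsub>G\<^esub> n) [^]\<^bsub>G\<^esub> (n1 * n2)"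
      using g by (simp add: G.int_pow_pow)
    also have "\<dots> = (\<phi>1 x [^]\<^bsub>G\<^esub> n1) [^]\<^bsub>G\<^esub> n2 \<otimes>\<^bsub>G\<^esub> (\<phi>2 y [^]\<^bsub>G\<^esub> n2) [^]\<^bsub>G\<^esub> n1"
      using x y by (simp add: e G.int_pow_distrib G.int_pow_pow mult.commute)
    also have "\<dots> \<in> Zspan G (T1 \<union> T2)" using m1 m2 U by (auto intro!: G.Zspan_mult G.Zspan_pow)
    finally show ?thesis using n n1 n2 by (intro exI[of _ "n * (n1 * n2)"]) auto
  qed
  ultimately have "group_rank G = card (T1 \<union> T2)" by (rule G.rank_eqI)
  also have "\<dots> = card T1 + card T2" using T dis by (simp add: card_Un_disjoint)
  finally show ?thesis using cards S1 S2 by simp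
qed

section \<open>Complete 2-descent\<close>

declare point_add.simps(3) [simp del]

definition is_sq :: "'a::field \<Rightarrow> bool" where "is_sq x \<longleftrightarrow> (\<exists>r. x = r^2)"

lemma is_sq_mult: "is_sq x \<Longrightarrow> is_sq y \<Longrightarrow> is_sq (x * y)"
  unfolding is_sq_def by (metis power_mult_distrib)

lemma is_sq_square [simp]: "is_sq (x * x)" "is_sq (x ^ 2)"
  unfolding is_sq_def by (metis power2_eq_square)+

lemma is_sq_div: "is_sq x \<Longrightarrow> is_sq y \<Longrightarrow> is_sq (x / y)"
  unfolding is_sq_def by (metis power_divide)

lemma is_sq_cancel: "is_sq (x * y) \<Longrightarrow> is_sq y \<Longrightarrow> y \<noteq> 0 \<Longrightarrow> is_sq x"
  by (metis is_sq_div nonzero_mult_div_cancel_right)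

text \<open>The intermediate field is a subset of the ambient type. Division is total with x / 0 =
  0, so closure under it can be stated without excluding 0.\<close>

definition subfield_set :: "'a::field set \<Rightarrow> bool" where
  "subfield_set K \<longleftrightarrow> 1 \<in> K \<and> (\<forall>x\<in>K. \<forall>y\<in>K. x - y \<in> K \<and> x * y \<in> K \<and> x / y \<in> K)"

lemma subfield_UNIV: "subfield_set UNIV" by (simp add: subfield_set_def)

lemma subfield_closed:
  assumes "subfield_set K"
  shows "0 \<in> K" "1 \<in> K" "x \<in> K \<Longrightarrow> y \<in> K \<Longrightarrow> x + y \<in> K" "x \<in> K \<Longrightarrow> y \<in> K \<Longrightarrow> x - y \<in> K"
    "x \<in> K \<Longrightarrow> y \<in> K \<Longrightarrow> x * y \<in> K" "x \<in> K \<Longrightarrow> y \<in> K \<Longrightarrow> x / y \<in> K" "x \<in> K \<Longrightarrow> - x \<in> K" "x \<in> K \<Longrightarrow> x ^ n \<in> K"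
proof -
  have d: "x - y \<in> K" if "x \<in> K" "y \<in> K" for x y using assms that by (simp add: subfield_set_def)
  show z: "0 \<in> K" using d[of 1 1] assms by (simp add: subfield_set_def)
  have n: "- x \<in> K" if "x \<in> K" for x using d[OF z that] by simp
  show "x \<in> K \<Longrightarrow> y \<in> K \<Longrightarrow> x + y \<in> K" using d[OF _ n] by fastforce
  show "1 \<in> K" and m: "x \<in> K \<Longrightarrow> y \<in> K \<Longrightarrow> x * y \<in> K" and "x \<in> K \<Longrightarrow> y \<in> K \<Longrightarrow> x / y \<in> K"
    using assms by (simp_all add: subfield_set_def)
  show "x \<in> K \<Longrightarrow> x ^ n \<in> K" by (induction n) (use assms in \<open>auto simp: subfield_set_def\<close>)
qed (use assms in \<open>simp_all add: subfield_set_def\<close>, metis subfield_set_def diff_0 diff_self)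

lemma subfield_numeral: "subfield_set K \<Longrightarrow> numeral n \<in> K"
proof (induction n)
  case (Bit0 n) thus ?case by (metis numeral_Bit0 subfield_closed(3))
next
  case (Bit1 n) thus ?case by (metis numeral_Bit1 numeral_One subfield_closed(2,3))
qed (simp add: subfield_closed)

section \<open>Groups of points over subfields and the descent maps\<close>

context ecurve
begin

abbreviation MW where "MW \<equiv> mordell_weil_group E UNIV"

lemma MW_simps [simp]:
  "carrier (mordell_weil_group E K) = {P. onE P \<and> set_point P \<subseteq> K}"
  "x \<otimes>\<^bsub>mordell_weil_group E K\<^esub> y = x \<oplus>\<^sub>E y" "\<one>\<^bsub>mordell_weil_group E K\<^esub> = Infinity"
  by (auto simp: mordell_weil_group_def rational_points_def)

lemma point_add_rational:
  assumes K: "subfield_set K" "\<alpha> \<in> K" "\<beta> \<in> K" and "set_point P \<subseteq> K" "set_point Q \<subseteq> K"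
  shows "set_point (P \<oplus>\<^sub>E Q) \<subseteq> K"
proof (cases "P = Infinity \<or> Q = Infinity")
  case False
  then obtain x1 y1 x2 y2 where [simp]: "P = Affine x1 y1" "Q = Affine x2 y2" by (meson point.exhaust)
  have in_K: "x1 \<in> K" "y1 \<in> K" "x2 \<in> K" "y2 \<in> K" using assms by auto
  note cl = subfield_closed[OF K(1)] subfield_numeral[OF K(1)] K in_K
  have a: "wa1 E = 0" "wa2 E = \<alpha> + \<beta>" "wa3 E = 0" "wa4 E = \<alpha> * \<beta>" by (simp_all add: curve_def)
  have l: "(if x1 = x2 then (3 * x1^2 + 2 * wa2 E * x1 + wa4 E - wa1 E * y1) / (2 * y1 + wa1 E * x1 + wa3 E)
            else (y2 - y1) / (x2 - x1)) \<in> K"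
    unfolding a by (auto intro!: cl)
  show ?thesis using l unfolding a
    by (auto simp: point_add.simps(3) Let_def a intro!: cl)
qed (use assms in auto)

lemma pneg_rational: "subfield_set K \<Longrightarrow> set_point P \<subseteq> K \<Longrightarrow> set_point (pneg P) \<subseteq> K"
  by (cases P) (auto simp: subfield_closed)

lemma comm_group_subfield:
  assumes K: "subfield_set K" "\<alpha> \<in> K" "\<beta> \<in> K"
  shows "comm_group (mordell_weil_group E K)"
proof (rule comm_groupI; (unfold MW_simps)?)
  fix P Q assume "P \<in> {P. onE P \<and> set_point P \<subseteq> K}" "Q \<in> {P. onE P \<and> set_point P \<subseteq> K}"
  thus "P \<oplus>\<^sub>E Q \<in> {P. onE P \<and> set_point P \<subseteq> K}" "P \<oplus>\<^sub>E Q = Q \<oplus>\<^sub>E P"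
    using point_add_rational[OF K] point_add_closed point_add_commute by blast+
next
  fix P Q R assume "P \<in> {P. onE P \<and> set_point P \<subseteq> K}" "Q \<in> {P. onE P \<and> set_point P \<subseteq> K}"
    "R \<in> {P. onE P \<and> set_point P \<subseteq> K}"
  thus "P \<oplus>\<^sub>E Q \<oplus>\<^sub>E R = P \<oplus>\<^sub>E (Q \<oplus>\<^sub>E R)" using point_add_assoc by blast
next
  fix P assume "P \<in> {P. onE P \<and> set_point P \<subseteq> K}"
  thus "\<exists>Q\<in>{P. onE P \<and> set_point P \<subseteq> K}. Q \<oplus>\<^sub>E P = Infinity"
    using pneg_rational[OF K(1)] onE_pneg opp_add by blast
qed simp_all

lemma comm_group_MW: "comm_group MW"
  by (rule comm_group_subfield) (simp_all add: subfield_UNIV)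

lemma inv_MW: "onE P \<Longrightarrow> inv\<^bsub>MW\<^esub> P = pneg P"
proof -
  interpret comm_group MW by (rule comm_group_MW)
  assume "onE P" thus ?thesis by (intro inv_equality) auto
qed

text \<open>The descent map at the 2-torsion point \<open>(c, 0)\<close>; there the value of the derivative of the
  cubic replaces \<open>x - c\<close>.\<close>

definition is_root :: "'a \<Rightarrow> bool" where "is_root c \<longleftrightarrow> c = 0 \<or> c = - \<alpha> \<or> c = - \<beta>"

definition fder :: "'a \<Rightarrow> 'a" where "fder c = 3 * c^2 + 2 * (\<alpha> + \<beta>) * c + \<alpha> * \<beta>"

fun dmap :: "'a \<Rightarrow> 'a point \<Rightarrow> 'a" where
  "dmap c Infinity = 1"
| "dmap c (Affine x y) = (if x = c then fder c else x - c)"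

lemma fder_values: "fder 0 = \<alpha> * \<beta>" "fder (- \<alpha>) = \<alpha> * (\<alpha> - \<beta>)" "fder (- \<beta>) = \<beta> * (\<beta> - \<alpha>)"
proof -
  show "fder 0 = \<alpha> * \<beta>" by (simp add: fder_def)
  show "fder (- \<alpha>) = \<alpha> * (\<alpha> - \<beta>)" unfolding fder_def by Groebner_Basis.algebra
  show "fder (- \<beta>) = \<beta> * (\<beta> - \<alpha>)" unfolding fder_def by Groebner_Basis.algebra
qed

lemma fder_nz: "is_root c \<Longrightarrow> fder c \<noteq> 0"
  unfolding is_root_def using nz fder_values by auto

lemma is_root_cubic: "is_root c \<Longrightarrow> c * (c + \<alpha>) * (c + \<beta>) = 0"
  by (auto simp: is_root_def)

lemma on_root: "is_root c \<Longrightarrow> onE (Affine c y) \<longleftrightarrow> y = 0"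
  by (simp add: onE is_root_cubic)

lemma onE_y0: "onE (Affine x 0) \<longleftrightarrow> is_root x"
  by (auto simp: onE is_root_def eq_neg_iff_add_eq_0)

lemma dmap_nz: "is_root c \<Longrightarrow> dmap c P \<noteq> 0"
  by (cases P) (auto simp: fder_nz)

lemma dmap_pneg [simp]: "dmap c (pneg P) = dmap c P"
  by (cases P) auto

text \<open>Translation by (c, 0) takes x - c to f'(c) / (x - c), where f is the cubic. The product
  in question is therefore the square of f'(c), the value of the map at (c, 0) itself.\<close>

lemma dmap_root_add:
  assumes c: "is_root c" and P: "onE P"
  shows "is_sq (dmap c (Affine c 0) * dmap c P * dmap c (Affine c 0 \<oplus>\<^sub>E P))"
proof (cases P)
  case Infinity thus ?thesis by simp
next
  case (Affine x y)
  have T: "onE (Affine c 0)" using c on_root by simp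
  show ?thesis
  proof (cases "x = c")
    case True
    hence "P = Affine c 0" using P Affine on_root[OF c] by simp
    thus ?thesis using add_opp[of "Affine c 0"] by simp
  next
    case False
    have n: "\<not> (c = x \<and> 0 + y = 0)" using False by simp
    obtain l where l: "slope \<alpha> \<beta> l c 0 x y" using slope_exists[OF T _ n] P Affine by metis
    define x3 where "x3 = l^2 - (\<alpha> + \<beta>) - c - x"
    have sum: "Affine c 0 \<oplus>\<^sub>E P = Affine x3 (- (l * (x3 - c) + 0))"
      using add_slope[OF T _ n l] P Affine by (simp add: x3_def)
    have c0: "c * (c + \<alpha>) * (c + \<beta>) = 0" using is_root_cubic[OF c] .
    have "l * (y * (x - c)) = (x - c) * (c^2 + c * x + x^2 + (\<alpha> + \<beta>) * (c + x) + \<alpha> * \<beta>)"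
      using l unfolding slope_def by Groebner_Basis.algebra
    hence "l^2 * (x - c) = c^2 + c * x + x^2 + (\<alpha> + \<beta>) * (c + x) + \<alpha> * \<beta>"
      using l False unfolding slope_def by Groebner_Basis.algebra
    hence e: "(x - c) * (x3 - c) = fder c" unfolding x3_def fder_def by Groebner_Basis.algebra
    hence "x3 \<noteq> c" using fder_nz[OF c] by auto
    hence "dmap c (Affine c 0) * dmap c P * dmap c (Affine c 0 \<oplus>\<^sub>E P) = fder c * fder c"
    proof -
      have "dmap c (Affine c 0 \<oplus>\<^sub>E P) = x3 - c" using sum Affine \<open>x3 \<noteq> c\<close> by simp
      moreover have "dmap c P = x - c" using Affine False by simp
      ultimately show ?thesis using e by (simp add: mult.assoc)
    qed
    thus ?thesis by (simp only: is_sq_square)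
  qed
qed

text \<open>The cubic minus the square of the chord has the roots x1, x2, x3. Evaluated at c, where
  the cubic vanishes, it shows that the product of the three x - c is a square. Cases with one of
  the three points at (c, 0) reduce to \<open>dmap_root_add\<close>.\<close>

lemma dmap_add:
  assumes c: "is_root c" and on: "onE P" "onE Q"
  shows "is_sq (dmap c P * dmap c Q * dmap c (P \<oplus>\<^sub>E Q))"
proof -
  define T where "T = Affine c 0"
  have T: "onE T" using c on_root by (simp add: T_def)
  have isT: "R = T" if "onE (R)" "R = Affine c y" for R y using that on_root[OF c] by (simp add: T_def)
  consider "P = Infinity" | "Q = Infinity" | "Q = pneg P" | "P = T" | "Q = T" | "P \<oplus>\<^sub>E Q = T"
    | x1 y1 x2 y2 x3 y3 where "P = Affine x1 y1" "Q = Affine x2 y2" "P \<oplus>\<^sub>E Q = Affine x3 y3"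
      "x1 \<noteq> c" "x2 \<noteq> c" "x3 \<noteq> c" "Q \<noteq> pneg P"
    using isT on point_add_closed[OF on] add_eq_Inf_iff[OF on] by (metis point.exhaust)
  thus ?thesis
  proof cases
    case 4 thus ?thesis using dmap_root_add[OF c on(2)] by (simp add: T_def)
  next
    case 5 thus ?thesis using dmap_root_add[OF c on(1)] point_add_commute[OF on]
      by (simp add: T_def mult.commute mult.left_commute)
  next
    case 6
    have "pneg P \<oplus>\<^sub>E T = Q" using neg_add_cancel[OF on] 6 by simp
    hence "T \<oplus>\<^sub>E pneg P = Q" using point_add_commute[of "pneg P" T] T on by simp
    thus ?thesis using dmap_root_add[OF c, of "pneg P"] on 6
      by (simp add: T_def mult.commute mult.left_commute)
  next
    case 7
    have n: "\<not> (x1 = x2 \<and> y1 + y2 = 0)" using 7 not_opp by blast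
    obtain l where l: "slope \<alpha> \<beta> l x1 y1 x2 y2" using slope_exists[OF _ _ n] on 7 by metis
    have x3: "x3 = l^2 - (\<alpha> + \<beta>) - x1 - x2" using add_slope[OF _ _ n l] on 7 by simp
    have y1: "y1^2 = x1 * (x1 + \<alpha>) * (x1 + \<beta>)" using on 7 by (simp add: onE)
    have "(x1 - c) * (x2 - c) * (x3 - c) = (l * (c - x1) + y1)^2"
      using l y1 is_root_cubic[OF c] unfolding x3 slope_def by Groebner_Basis.algebra
    thus ?thesis using 7 by simp
  qed simp_all
qed

text \<open>Two of the factors x, x + \<alpha>, x + \<beta> being squares, the equation makes the
  third one a square as well. With square roots r1, r2, r3 whose signs satisfy y = r1 r2 r3, a half
  of P can be written down.\<close>

lemma halving:
  assumes P: "onE P" and sq: "is_sq (dmap 0 P)" "is_sq (dmap (- \<alpha>) P)"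
  shows "\<exists>Q. onE Q \<and> P = Q \<oplus>\<^sub>E Q"
proof (cases P)
  case Infinity thus ?thesis by (intro exI[of _ Infinity]) auto
next
  case (Affine x y)
  have cub: "y^2 = x * (x + \<alpha>) * (x + \<beta>)" using P Affine onE by simp
  have "\<exists>r1 r2 r3. x = r1^2 \<and> x + \<alpha> = r2^2 \<and> x + \<beta> = r3^2 \<and> y = r1 * r2 * r3"
  proof (cases "y = 0")
    case False
    hence n: "x \<noteq> 0" "x \<noteq> - \<alpha>" "x + \<alpha> \<noteq> 0" using cub by (auto simp: eq_neg_iff_add_eq_0)
    then obtain r1 r2 where r: "x = r1^2" "x + \<alpha> = r2^2" using sq Affine by (auto simp: is_sq_def)
    have r0: "r1 \<noteq> 0" "r2 \<noteq> 0" using n r by auto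
    have "r1^2 * r2^2 * (x + \<beta>) = y^2" using cub unfolding r(2)[symmetric] by (simp flip: r(1))
    hence "x + \<beta> = (y / (r1 * r2))^2" using r0 by (simp add: field_simps power2_eq_square)
    thus ?thesis using r r0 by (intro exI[of _ r1] exI[of _ r2] exI[of _ "y / (r1 * r2)"]) auto
  next
    case True
    \<comment> \<open>At a 2-torsion point one factor is 0; the derivative value is the product of
      the other two up to the order of factors, so both of these are squares.\<close>
    hence "is_root x" using P Affine onE_y0 by simp
    then consider "x = 0" | "x = - \<alpha>" | "x = - \<beta>" unfolding is_root_def by blast
    thus ?thesis
    proof cases
      case 1
      have a: "is_sq \<alpha>" using sq(2) 1 Affine nz by simp
      have "is_sq (\<beta> * \<alpha>)" using sq(1) 1 Affine by (simp add: fder_values mult.commute)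
      hence "is_sq \<beta>" using a nz is_sq_cancel by blast
      then obtain r2 r3 where "\<alpha> = r2^2" "\<beta> = r3^2" using a unfolding is_sq_def by blast
      thus ?thesis using True 1 by (intro exI[of _ 0] exI[of _ r2] exI[of _ r3]) auto
    next
      case 2
      have a: "is_sq (- \<alpha>)" using sq(1) 2 Affine nz by simp
      have "is_sq ((\<beta> - \<alpha>) * (- \<alpha>))" using sq(2) 2 Affine by (simp add: fder_values algebra_simps)
      hence "is_sq (\<beta> - \<alpha>)" using a nz is_sq_cancel by (metis neg_equal_0_iff_equal)
      then obtain r1 r3 where "- \<alpha> = r1^2" "\<beta> - \<alpha> = r3^2" using a unfolding is_sq_def by blast
      moreover have "x + \<alpha> = 0" "x + \<beta> = \<beta> - \<alpha>" using 2 by simp_all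
      ultimately have "x = r1^2 \<and> x + \<alpha> = 0^2 \<and> x + \<beta> = r3^2 \<and> y = r1 * 0 * r3" using 2 True by auto
      thus ?thesis by blast
    next
      case 3
      have a: "is_sq (- \<beta>)" using sq(1) 3 Affine nz by simp
      have "is_sq (\<alpha> - \<beta>)" using sq(2) 3 Affine nz by (simp add: algebra_simps)
      then obtain r1 r2 where "- \<beta> = r1^2" "\<alpha> - \<beta> = r2^2" using a unfolding is_sq_def by blast
      moreover have "x + \<alpha> = \<alpha> - \<beta>" "x + \<beta> = 0" using 3 by simp_all
      ultimately have "x = r1^2 \<and> x + \<alpha> = r2^2 \<and> x + \<beta> = 0^2 \<and> y = r1 * r2 * 0" using 3 True by auto
      thus ?thesis by blast
    qed
  qed
  then obtain r1 r2 r3 where r: "x = r1^2" "\<alpha> = r2^2 - r1^2" "\<beta> = r3^2 - r1^2" "y = r1 * r2 * r3"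
    by (metis add_diff_cancel_left')
  \<comment> \<open>The tangent at (X, Y) has slope r1 + r2 + r3 and meets the curve again in -P.
    Other choices of signs of the roots give the other halves.\<close>
  define X Y l where "X = x + r1 * r2 + r1 * r3 + r2 * r3" and "Y = (r1 + r2) * (r1 + r3) * (r2 + r3)"
    and "l = r1 + r2 + r3"
  have "Y^2 = X * (X + \<alpha>) * (X + \<beta>)" unfolding X_def Y_def r by Groebner_Basis.algebra
  hence on: "onE (Affine X Y)" by (simp add: onE)
  have sl: "slope \<alpha> \<beta> l X Y X Y" unfolding slope_def X_def Y_def l_def r by (intro conjI) Groebner_Basis.algebra+
  have "r1 + r2 \<noteq> 0" "r1 + r3 \<noteq> 0" "r2 + r3 \<noteq> 0"
  proof -
    \<comment> \<open>These products are \<alpha>, \<beta> and \<beta> - \<alpha>, so distinctness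
      of the roots of the cubic gives Y nonzero.\<close>
    have "(r2 - r1) * (r1 + r2) \<noteq> 0" "(r3 - r1) * (r1 + r3) \<noteq> 0" "(r3 - r2) * (r2 + r3) \<noteq> 0"
      using nz unfolding r by (simp_all add: algebra_simps power2_eq_square)
    thus "r1 + r2 \<noteq> 0" "r1 + r3 \<noteq> 0" "r2 + r3 \<noteq> 0" by auto
  qed
  hence "Y \<noteq> 0" by (simp add: Y_def)
  hence n: "\<not> (X = X \<and> Y + Y = 0)" using twice_eq0[of Y] by blast
  have "l^2 - (\<alpha> + \<beta>) - X - X = x" unfolding l_def X_def r by Groebner_Basis.algebra
  moreover have "- (l * (x - X) + Y) = y" unfolding l_def X_def Y_def r by Groebner_Basis.algebra
  ultimately have "Affine X Y \<oplus>\<^sub>E Affine X Y = P" using add_slope[OF on on n sl] Affine by simp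
  thus ?thesis using on by metis
qed

section \<open>Formulas for x-coordinates and characters on the group\<close>

lemma double_x:
  assumes "onE (Affine x y)" "y \<noteq> 0"
  obtains X Y where "Affine x y \<oplus>\<^sub>E Affine x y = Affine X Y"
    "4 * (x * (x + \<alpha>) * (x + \<beta>)) * X = (x^2 - \<alpha> * \<beta>)^2"
proof -
  have n: "\<not> (x = x \<and> y + y = 0)" using twice_eq0[of y] assms by blast
  obtain l where l: "slope \<alpha> \<beta> l x y x y" using slope_exists[OF assms(1,1) n] by metis
  have "y^2 = x * (x + \<alpha>) * (x + \<beta>)" using assms(1) unfolding onE .
  hence "4 * (x * (x + \<alpha>) * (x + \<beta>)) * (l^2 - (\<alpha> + \<beta>) - x - x) = (x^2 - \<alpha> * \<beta>)^2"
    using l unfolding slope_def by Groebner_Basis.algebra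
  thus ?thesis using add_slope[OF assms(1,1) n l] that by blast
qed

text \<open>The roots of this quadratic are the x-coordinates of P + Q and P - Q. Its coefficients
  involve only x1 and x2, so a height bound can be read off without the y-coordinates.\<close>

lemma add_x_quadratic:
  assumes "onE (Affine x1 y1)" "onE (Affine x2 y2)" "x1 \<noteq> x2"
  obtains X Y where "Affine x1 y1 \<oplus>\<^sub>E Affine x2 y2 = Affine X Y"
    "(x1 - x2)^2 * X^2 - 2 * ((x1 * x2 + \<alpha> * \<beta>) * (x1 + x2) + 2 * (\<alpha> + \<beta>) * x1 * x2) * X + (x1 * x2 - \<alpha> * \<beta>)^2 = 0"
proof -
  have n: "\<not> (x1 = x2 \<and> y1 + y2 = 0)" using assms by simp
  obtain l where l: "slope \<alpha> \<beta> l x1 y1 x2 y2" using slope_exists[OF assms(1,2) n] by metis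
  have c: "y1^2 = x1 * (x1 + \<alpha>) * (x1 + \<beta>)" "y2^2 = x2 * (x2 + \<alpha>) * (x2 + \<beta>)"
    using assms(1,2) unfolding onE by blast+
  define X where "X = l^2 - (\<alpha> + \<beta>) - x1 - x2"
  have "(x1 - x2)^2 * ((x1 - x2)^2 * X^2 - 2 * ((x1 * x2 + \<alpha> * \<beta>) * (x1 + x2) + 2 * (\<alpha> + \<beta>) * x1 * x2) * X + (x1 * x2 - \<alpha> * \<beta>)^2) = 0"
  proof -
    have "(x1 - x2)^2 * X = (y1 - y2)^2 - (\<alpha> + \<beta> + x1 + x2) * (x1 - x2)^2"
      using l unfolding slope_def X_def by Groebner_Basis.algebra
    \<comment> \<open>Isolating y1 y2 before squaring allows both curve equations to be
      substituted.\<close>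
    hence "(x1 - x2)^2 * X - ((x1 * x2 + \<alpha> * \<beta>) * (x1 + x2) + 2 * (\<alpha> + \<beta>) * x1 * x2) = - (2 * y1 * y2)"
      using c by Groebner_Basis.algebra
    hence "((x1 - x2)^2 * X - ((x1 * x2 + \<alpha> * \<beta>) * (x1 + x2) + 2 * (\<alpha> + \<beta>) * x1 * x2))^2 = 4 * y1^2 * y2^2"
      by Groebner_Basis.algebra
    thus ?thesis unfolding c by Groebner_Basis.algebra
  qed
  hence "(x1 - x2)^2 * X^2 - 2 * ((x1 * x2 + \<alpha> * \<beta>) * (x1 + x2) + 2 * (\<alpha> + \<beta>) * x1 * x2) * X + (x1 * x2 - \<alpha> * \<beta>)^2 = 0"
    using assms(3) by simp
  thus ?thesis using add_slope[OF assms(1,2) n l] that unfolding X_def by blast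
qed

lemma two_torsion:
  assumes "onE P" "P \<oplus>\<^sub>E P = Infinity"
  shows "P = Infinity \<or> (\<exists>c. is_root c \<and> P = Affine c 0)"
proof (cases P)
  case (Affine x y)
  have "P = pneg P" using assms add_eq_Inf_iff[of P P] by simp
  hence "y + y = 0" using Affine by (simp add: eq_neg_iff_add_eq_0)
  hence "y = 0" using twice_eq0[of y] by blast
  thus ?thesis using assms Affine onE_y0 by auto
qed simp

text \<open>A Z/2-valued character of the multiplicative group vanishes on squares, and
  \<open>dmap\<close> is multiplicative up to squares.\<close>

lemma parity_hom_dmap:
  assumes c: "is_root c"
    and chi: "\<And>x y. x \<noteq> 0 \<Longrightarrow> y \<noteq> 0 \<Longrightarrow> \<chi> (x * y) = (\<chi> x \<noteq> \<chi> y)"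
  shows "parity_hom MW (\<lambda>P. \<chi> (dmap c P))"
  unfolding parity_hom_def
proof (intro ballI)
  fix P Q assume "P \<in> carrier MW" "Q \<in> carrier MW"
  hence "is_sq (dmap c P * dmap c Q * dmap c (P \<oplus>\<^sub>E Q))" using dmap_add[OF c] by simp
  then obtain r where r: "dmap c P * dmap c Q * dmap c (P \<oplus>\<^sub>E Q) = r * r"
    by (auto simp: is_sq_def power2_eq_square)
  have nzd: "dmap c P \<noteq> 0" "dmap c Q \<noteq> 0" "dmap c (P \<oplus>\<^sub>E Q) \<noteq> 0" using dmap_nz[OF c] by blast+
  hence "r \<noteq> 0" using r by auto
  hence "\<not> \<chi> (dmap c P * dmap c Q * dmap c (P \<oplus>\<^sub>E Q))" unfolding r using chi[of r r] by simp
  moreover have "\<chi> (dmap c P * dmap c Q * dmap c (P \<oplus>\<^sub>E Q)) =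
      ((\<chi> (dmap c P) \<noteq> \<chi> (dmap c Q)) \<noteq> \<chi> (dmap c (P \<oplus>\<^sub>E Q)))"
    using nzd chi[of "dmap c P * dmap c Q" "dmap c (P \<oplus>\<^sub>E Q)"] chi[of "dmap c P" "dmap c Q"] by simp
  ultimately show "\<chi> (dmap c (P \<otimes>\<^bsub>MW\<^esub> Q)) = (\<chi> (dmap c P) \<noteq> \<chi> (dmap c Q))" by auto
qed

end

section \<open>Coprime polynomials over a field\<close>

lemma poly_bezout:
  fixes a b :: "'k::field poly"
  assumes "coprime a b"
  shows "\<exists>r s. r * a + s * b = 1"
proof -
  \<comment> \<open>A nonzero element of least degree in the ideal generated by a and b divides all
    of it, by division with remainder.\<close>
  define S where "S = {p. p \<noteq> 0 \<and> (\<exists>r s. p = r * a + s * b)}"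
  have "a \<noteq> 0 \<or> b \<noteq> 0" using assms by auto
  moreover have "a = 1 * a + 0 * b" "b = 0 * a + 1 * b" by simp_all
  ultimately have "\<exists>p. p \<in> S" unfolding S_def by blast
  then obtain g where g: "g \<in> S" "\<And>p. p \<in> S \<Longrightarrow> degree g \<le> degree p"
    using ex_has_least_nat[of "\<lambda>p. p \<in> S" _ degree] by blast
  obtain r s where rs: "g = r * a + s * b" and g0: "g \<noteq> 0" using g(1) by (auto simp: S_def)
  have dvd: "g dvd x" if x: "\<exists>r s. x = r * a + s * b" for x
  proof (rule ccontr)
    assume "\<not> g dvd x"
    hence nz: "x mod g \<noteq> 0" by (simp add: dvd_eq_mod_eq_0)
    obtain r' s' where "x = r' * a + s' * b" using x by blast
    hence "x mod g = (r' - x div g * r) * a + (s' - x div g * s) * b"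
      using div_mult_mod_eq[of x g] unfolding rs by (simp add: algebra_simps)
    hence "x mod g \<in> S" using nz unfolding S_def by blast
    thus False using g(2) degree_mod_less'[OF g0 nz] by fastforce
  qed
  have "a = 1 * a + 0 * b" "b = 0 * a + 1 * b" by simp_all
  hence "g dvd a" "g dvd b" using dvd by blast+
  hence "is_unit g" using assms by (meson not_coprimeI)
  then obtain u where u: "1 = g * u" by (auto elim: dvdE)
  hence "(u * r) * a + (u * s) * b = 1" by (simp add: rs algebra_simps)
  thus ?thesis by blast
qed

lemma poly_coprimeI: "r * a + s * b = 1 \<Longrightarrow> coprime a (b :: 'k::field poly)"
  by (metis coprimeI dvd_add dvd_mult)

lemma poly_coprime_dvd_mult:
  assumes "coprime a b" "a dvd b * (c :: 'k::field poly)"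
  shows "a dvd c"
proof -
  obtain r s where "r * a + s * b = 1" using poly_bezout[OF assms(1)] by blast
  hence "c = (r * a + s * b) * c" by simp
  also have "\<dots> = a * (r * c) + s * (b * c)" by (simp add: algebra_simps)
  finally have eq: "c = a * (r * c) + s * (b * c)" .
  have "a dvd a * (r * c) + s * (b * c)" by (rule dvd_add[OF dvd_triv_left dvd_mult[OF assms(2)]])
  with eq show ?thesis by (rule ssubst[where P = "\<lambda>x. a dvd x"])
qed

lemma poly_coprime_mult:
  assumes "coprime a b" "coprime a (c :: 'k::field poly)"
  shows "coprime a (b * c)"
proof (rule coprimeI)
  fix x assume x: "x dvd a" "x dvd b * c"
  have "coprime x b" using x(1) assms(1) by (meson coprime_divisors dvd_refl)
  hence "x dvd c" using x(2) poly_coprime_dvd_mult by blast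
  thus "is_unit x" using x(1) assms(2) by (meson not_coprimeI)
qed

lemma poly_coprime_power: "coprime a b \<Longrightarrow> coprime a ((b :: 'k::field poly) ^ n)"
  by (induction n) (auto intro: poly_coprime_mult)

section \<open>Valuations and heights in rational function fields\<close>

lemma poly_is_unit: "is_unit (p :: 'k::field poly) \<longleftrightarrow> p \<noteq> 0 \<and> degree p = 0"
  by (metis is_unit_iff_degree not_is_unit_0)

text \<open>A denominator of least degree works: a common factor of positive degree could be
  cancelled.\<close>

lemma Fract_coprime:
  fixes x :: "'k::field poly fract"
  obtains n d where "d \<noteq> 0" "coprime n d" "x = Fract n d"
proof -
  define P where "P d \<longleftrightarrow> d \<noteq> 0 \<and> (\<exists>n. x = Fract n d)" for d
  have "\<exists>d. P d" unfolding P_def by (cases x) blast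
  then obtain d where d: "P d" "\<And>d'. P d' \<Longrightarrow> degree d \<le> degree d'"
    using ex_has_least_nat[of P _ degree] by blast
  obtain n where n: "x = Fract n d" and d0: "d \<noteq> 0" using d(1) by (auto simp: P_def)
  have "coprime n d"
  proof (rule coprimeI)
    fix c assume "c dvd n" "c dvd d"
    then obtain n' d' where c: "n = c * n'" "d = c * d'" by (auto elim!: dvdE)
    hence cd: "c \<noteq> 0" "d' \<noteq> 0" using d0 by auto
    have "x = Fract n' d'" using n c cd by (simp add: mult_fract_cancel)
    hence "degree d \<le> degree d'" using d(2) cd unfolding P_def by blast
    hence "degree c = 0" using c cd by (simp add: degree_mult_eq)
    thus "is_unit c" using cd poly_is_unit by blast
  qed
  thus ?thesis using that n d0 by blast
qed

lemma Fract_eq_0_iff [simp]: "b \<noteq> 0 \<Longrightarrow> Fract a b = 0 \<longleftrightarrow> a = 0"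
  by (simp add: Zero_fract_def eq_fract)

lemma nonzero_FractE:
  fixes x :: "'a::idom fract"
  assumes "x \<noteq> 0" obtains a b where "a \<noteq> 0" "b \<noteq> 0" "x = Fract a b"
  using assms by (cases x) (auto simp: fract_collapse intro: that)

text \<open>Extends a map taking products to sums from a domain to its fraction field; the order at
  a prime and the degree are the instances. No value is specified at 0.\<close>

definition fext :: "('a::idom \<Rightarrow> 'b::ab_group_add) \<Rightarrow> 'a fract \<Rightarrow> 'b" where
  "fext \<phi> x = (THE z. \<exists>a b. a \<noteq> 0 \<and> b \<noteq> 0 \<and> x = Fract a b \<and> z = \<phi> a - \<phi> b)"

locale additive_fn =
  fixes \<phi> :: "'a::idom \<Rightarrow> 'b::ab_group_add"
  assumes add: "a \<noteq> 0 \<Longrightarrow> b \<noteq> 0 \<Longrightarrow> \<phi> (a * b) = \<phi> a + \<phi> b"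
begin

lemma ext_Fract: "a \<noteq> 0 \<Longrightarrow> b \<noteq> 0 \<Longrightarrow> fext \<phi> (Fract a b) = \<phi> a - \<phi> b"
  unfolding fext_def
proof (rule the_equality)
  fix z assume ab: "a \<noteq> 0" "b \<noteq> 0" and "\<exists>c d. c \<noteq> 0 \<and> d \<noteq> 0 \<and> Fract a b = Fract c d \<and> z = \<phi> c - \<phi> d"
  then obtain c d where cd: "c \<noteq> 0" "d \<noteq> 0" "Fract a b = Fract c d" "z = \<phi> c - \<phi> d" by blast
  hence "a * d = c * b" using ab by (simp add: eq_fract)
  hence "\<phi> a + \<phi> d = \<phi> c + \<phi> b" using ab cd add by metis
  hence "\<phi> a = \<phi> c + \<phi> b - \<phi> d" by (simp add: eq_diff_eq)
  thus "z = \<phi> a - \<phi> b" using cd(4) by simp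
qed blast

lemma ext_mult: "x \<noteq> 0 \<Longrightarrow> y \<noteq> 0 \<Longrightarrow> fext \<phi> (x * y) = fext \<phi> x + fext \<phi> y"
proof -
  assume "x \<noteq> 0" "y \<noteq> 0"
  then obtain a b c d where "a \<noteq> 0" "b \<noteq> 0" "x = Fract a b" "c \<noteq> 0" "d \<noteq> 0" "y = Fract c d"
    by (metis nonzero_FractE)
  thus ?thesis by (simp add: ext_Fract add)
qed

lemma ext_one: "fext \<phi> 1 = 0"
  using ext_mult[of 1 1] by simp

end

definition pmult :: "'k::field poly \<Rightarrow> 'k poly \<Rightarrow> nat" where
  "pmult \<pi> f = (GREATEST n. \<pi> ^ n dvd f)"

lemma pmult_eqI:
  assumes pi: "prime_elem \<pi>" and f: "f = \<pi> ^ n * g" "\<not> \<pi> dvd g"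
  shows "pmult \<pi> f = n"
  unfolding pmult_def
proof (rule Greatest_equality)
  have p0: "\<pi> \<noteq> 0" using pi by auto
  fix m assume "\<pi> ^ m dvd f"
  show "m \<le> n"
  proof (rule ccontr)
    assume "\<not> m \<le> n"
    then obtain k where "m = n + Suc k" by (metis less_imp_Suc_add not_le add_Suc_right)
    hence "\<pi> ^ n * (\<pi> ^ k * \<pi>) dvd \<pi> ^ n * g" using \<open>\<pi> ^ m dvd f\<close> f by (simp add: power_add mult_ac)
    hence "\<pi> ^ k * \<pi> dvd g" using p0 by simp
    thus False using f(2) dvd_mult_right by blast
  qed
qed (use f in simp)

lemma pmultE:
  assumes pi: "prime_elem \<pi>" and f: "f \<noteq> (0 :: 'k::field poly)"
  obtains g where "f = \<pi> ^ pmult \<pi> f * g" "\<not> \<pi> dvd g" "g \<noteq> 0"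
proof -
  have p0: "\<pi> \<noteq> 0" "\<not> is_unit \<pi>" using pi by (auto simp: prime_elem_def)
  hence deg: "degree \<pi> > 0" by (simp add: poly_is_unit)
  have bound: "n \<le> degree f" if "\<pi> ^ n dvd f" for n
  proof -
    have "n * degree \<pi> \<le> degree f" using dvd_imp_degree_le[OF that f] p0 by (simp add: degree_power_eq)
    moreover have "n * 1 \<le> n * degree \<pi>" using deg by (intro mult_le_mono2) simp
    ultimately show ?thesis by linarith
  qed
  have "\<pi> ^ pmult \<pi> f dvd f" unfolding pmult_def
    by (rule GreatestI_nat[where k = 0 and b = "degree f"]) (use bound in auto)
  then obtain g where g: "f = \<pi> ^ pmult \<pi> f * g" by (elim dvdE)
  have "\<not> \<pi> dvd g"
  proof
    assume "\<pi> dvd g"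
    then obtain h where "g = \<pi> * h" by (elim dvdE)
    hence "f = \<pi> ^ Suc (pmult \<pi> f) * h" by (subst g) (simp add: mult_ac)
    hence "\<pi> ^ Suc (pmult \<pi> f) dvd f" by (metis dvd_triv_left)
    hence "Suc (pmult \<pi> f) \<le> pmult \<pi> f" unfolding pmult_def
      by (rule Greatest_le_nat[where b = "degree f"]) (use bound in auto)
    thus False by simp
  qed
  thus ?thesis using that g f by auto
qed

lemma pmult_mult:
  assumes pi: "prime_elem \<pi>" and "f \<noteq> 0" "g \<noteq> (0 :: 'k::field poly)"
  shows "pmult \<pi> (f * g) = pmult \<pi> f + pmult \<pi> g"
proof -
  obtain f' where f: "f = \<pi> ^ pmult \<pi> f * f'" "\<not> \<pi> dvd f'" by (rule pmultE[OF pi assms(2)])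
  obtain g' where g: "g = \<pi> ^ pmult \<pi> g * g'" "\<not> \<pi> dvd g'" by (rule pmultE[OF pi assms(3)])
  have "f * g = \<pi> ^ (pmult \<pi> f + pmult \<pi> g) * (f' * g')"
    by (subst f(1), subst g(1)) (simp add: power_add mult_ac)
  moreover have "\<not> \<pi> dvd f' * g'" using f g pi by (simp add: prime_elem_dvd_mult_iff)
  ultimately show ?thesis by (rule pmult_eqI[OF pi])
qed

lemma pmult_eq_0: "prime_elem \<pi> \<Longrightarrow> \<not> \<pi> dvd f \<Longrightarrow> pmult \<pi> f = 0"
  by (rule pmult_eqI[of \<pi> f 0 f]) auto

lemma pmult_pos: "prime_elem \<pi> \<Longrightarrow> \<pi> dvd f \<Longrightarrow> f \<noteq> 0 \<Longrightarrow> pmult \<pi> f > 0"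
  by (metis gr0I mult_1 pmultE power_0)

lemma pmult_add_less:
  assumes pi: "prime_elem \<pi>" and "f \<noteq> 0" "g \<noteq> (0 :: 'k::field poly)" and lt: "pmult \<pi> f < pmult \<pi> g"
  shows "pmult \<pi> (f + g) = pmult \<pi> f"
proof -
  obtain f' where f: "f = \<pi> ^ pmult \<pi> f * f'" "\<not> \<pi> dvd f'" by (rule pmultE[OF pi assms(2)])
  obtain g' where g: "g = \<pi> ^ pmult \<pi> g * g'" by (rule pmultE[OF pi assms(3)])
  obtain k where k: "pmult \<pi> g = pmult \<pi> f + Suc k" using lt less_iff_Suc_add by auto
  have "g = \<pi> ^ pmult \<pi> f * (\<pi> * (\<pi> ^ k * g'))" using g k by (simp add: power_add mult_ac)
  hence "f + g = \<pi> ^ pmult \<pi> f * (f' + \<pi> * (\<pi> ^ k * g'))" using f(1) by (metis distrib_left)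
  moreover have "\<not> \<pi> dvd f' + \<pi> * (\<pi> ^ k * g')" using f(2) by (metis dvd_add_left_iff dvd_triv_left)
  ultimately show ?thesis by (rule pmult_eqI[OF pi])
qed

definition vord :: "'k::field poly \<Rightarrow> 'k poly fract \<Rightarrow> int" where
  "vord \<pi> = fext (\<lambda>f. int (pmult \<pi> f))"

text \<open>Minus the valuation at infinity.\<close>

definition vdeg :: "'k::field poly fract \<Rightarrow> int" where
  "vdeg = fext (\<lambda>f. int (degree f))"

lemma additive_pmult: "prime_elem \<pi> \<Longrightarrow> additive_fn (\<lambda>f. int (pmult \<pi> f))"
  by unfold_locales (simp add: pmult_mult)

lemma additive_degree: "additive_fn (\<lambda>f :: 'k::field poly. int (degree f))"
  by unfold_locales (simp add: degree_mult_eq)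

lemma vord_Fract: "prime_elem \<pi> \<Longrightarrow> a \<noteq> 0 \<Longrightarrow> b \<noteq> 0 \<Longrightarrow> vord \<pi> (Fract a b) = int (pmult \<pi> a) - int (pmult \<pi> b)"
  unfolding vord_def by (rule additive_fn.ext_Fract[OF additive_pmult])

lemma vdeg_Fract: "a \<noteq> 0 \<Longrightarrow> b \<noteq> 0 \<Longrightarrow> vdeg (Fract a b) = int (degree a) - int (degree b)"
  unfolding vdeg_def by (rule additive_fn.ext_Fract[OF additive_degree])

lemma vord_mult: "prime_elem \<pi> \<Longrightarrow> x \<noteq> 0 \<Longrightarrow> y \<noteq> 0 \<Longrightarrow> vord \<pi> (x * y) = vord \<pi> x + vord \<pi> y"
  unfolding vord_def by (rule additive_fn.ext_mult[OF additive_pmult])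

lemma vdeg_mult: "x \<noteq> 0 \<Longrightarrow> y \<noteq> 0 \<Longrightarrow> vdeg (x * y) = vdeg x + vdeg y"
  unfolding vdeg_def by (rule additive_fn.ext_mult[OF additive_degree])

text \<open>The equality case of the ultrametric inequality. That the sum is nonzero is part of the
  conclusion because \<open>vord\<close> is unspecified at 0.\<close>

lemma vord_add_less:
  assumes pi: "prime_elem \<pi>" and "x \<noteq> 0" "y \<noteq> 0" "vord \<pi> x < vord \<pi> y"
  shows "x + y \<noteq> 0" "vord \<pi> (x + y) = vord \<pi> x"
proof -
  obtain a b c d where ab: "a \<noteq> 0" "b \<noteq> 0" "x = Fract a b" "c \<noteq> 0" "d \<noteq> 0" "y = Fract c d"
    using assms by (metis nonzero_FractE)
  have lt: "pmult \<pi> (a * d) < pmult \<pi> (c * b)"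
    using assms ab by (simp add: vord_Fract pmult_mult)
  hence e: "pmult \<pi> (a * d + c * b) = pmult \<pi> (a * d)"
    using ab by (intro pmult_add_less[OF pi]) auto
  have "a * d + c * b \<noteq> 0"
  proof
    assume "a * d + c * b = 0"
    hence "c * b = - (a * d)" by (simp add: eq_neg_iff_add_eq_0 add.commute)
    hence "pmult \<pi> (c * b) = pmult \<pi> (a * d)" by (simp add: pmult_def)
    thus False using lt by simp
  qed
  thus "x + y \<noteq> 0" "vord \<pi> (x + y) = vord \<pi> x"
    using e ab by (simp_all add: vord_Fract[OF pi] pmult_mult[OF pi])
qed

lemma vord_one: "prime_elem \<pi> \<Longrightarrow> vord \<pi> 1 = 0"
  unfolding vord_def by (rule additive_fn.ext_one[OF additive_pmult])

lemma vord_minus: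
  assumes pi: "prime_elem \<pi>" shows "vord \<pi> (- x) = vord \<pi> x"
proof (cases "x = 0")
  case False
  have "vord \<pi> (- 1 * - 1) = vord \<pi> (- 1) + vord \<pi> (- 1)" by (rule vord_mult[OF pi]) simp_all
  hence "vord \<pi> (- 1) = 0" using vord_one[OF pi] by simp
  thus ?thesis using vord_mult[OF pi, of "- 1" x] False by simp
qed simp

text \<open>Detects the constant factor, which no valuation sees: all valuations being even makes an
  element a constant times a square, and \<open>lc\<close> decides about the constant.\<close>

definition lc :: "'k::field poly fract \<Rightarrow> 'k" where
  "lc x = (THE z. \<exists>a b. a \<noteq> 0 \<and> b \<noteq> 0 \<and> x = Fract a b \<and> z = lead_coeff a / lead_coeff b)"

lemma lc_Fract: "a \<noteq> 0 \<Longrightarrow> b \<noteq> 0 \<Longrightarrow> lc (Fract a b) = lead_coeff a / lead_coeff b"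
  unfolding lc_def
proof (rule the_equality)
  fix z assume ab: "a \<noteq> 0" "b \<noteq> 0" and "\<exists>c d. c \<noteq> 0 \<and> d \<noteq> 0 \<and> Fract a b = Fract c d \<and> z = lead_coeff c / lead_coeff d"
  then obtain c d where cd: "c \<noteq> 0" "d \<noteq> 0" "Fract a b = Fract c d" "z = lead_coeff c / lead_coeff d" by blast
  hence "a * d = c * b" using ab by (simp add: eq_fract)
  hence "lead_coeff a * lead_coeff d = lead_coeff c * lead_coeff b" by (metis lead_coeff_mult)
  thus "z = lead_coeff a / lead_coeff b" using ab cd(1,2,4) by (simp add: frac_eq_eq)
qed blast

lemma lc_mult: "x \<noteq> 0 \<Longrightarrow> y \<noteq> 0 \<Longrightarrow> lc (x * y) = lc x * lc y"
proof -
  assume "x \<noteq> 0" "y \<noteq> 0"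
  then obtain a b c d where "a \<noteq> 0" "b \<noteq> 0" "x = Fract a b" "c \<noteq> 0" "d \<noteq> 0" "y = Fract c d"
    by (metis nonzero_FractE)
  thus ?thesis by (simp add: lc_Fract lead_coeff_mult)
qed

lemma lc_nz: "x \<noteq> 0 \<Longrightarrow> lc x \<noteq> 0"
  by (metis nonzero_FractE lc_Fract divide_eq_0_iff leading_coeff_0_iff)

lemma vdeg_lc_add_less:
  assumes "x \<noteq> 0" "y \<noteq> 0" "vdeg y < vdeg x"
  shows "x + y \<noteq> 0" "vdeg (x + y) = vdeg x" "lc (x + y) = lc x"
proof -
  obtain a b c d where ab: "a \<noteq> 0" "b \<noteq> 0" "x = Fract a b" "c \<noteq> 0" "d \<noteq> 0" "y = Fract c d"
    using assms by (metis nonzero_FractE)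
  have lt: "degree (c * b) < degree (a * d)"
    using assms ab by (simp add: vdeg_Fract degree_mult_eq)
  have e: "degree (a * d + c * b) = degree (a * d)" "lead_coeff (a * d + c * b) = lead_coeff (a * d)"
    using lt by (simp_all add: degree_add_eq_left lead_coeff_add_le coeff_eq_0)
  have nz: "a * d + c * b \<noteq> 0" using e(2) ab by (metis leading_coeff_0_iff mult_eq_0_iff)
  show "x + y \<noteq> 0" "vdeg (x + y) = vdeg x"
    using e ab nz by (simp_all add: vdeg_Fract degree_mult_eq)
  have "lc (x + y) = lc (Fract (a * d + c * b) (b * d))" using ab by simp
  also have "\<dots> = lead_coeff (a * d) / lead_coeff (b * d)"
    using ab nz by (simp only: lc_Fract mult_eq_0_iff e(2) simp_thms)
  also have "\<dots> = lc x" using ab by (simp only: lead_coeff_mult) (simp add: lc_Fract)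
  finally show "lc (x + y) = lc x" .
qed

section \<open>Squares in the rational function field\<close>

lemma prime_divisor_exists_poly:
  fixes f :: "'k::field poly"
  assumes "degree f > 0"
  obtains \<pi> where "prime_elem \<pi>" "\<pi> dvd f"
proof -
  have "degree f > 0 \<and> f dvd f" using assms by simp
  hence "\<exists>p. degree p > 0 \<and> p dvd f" by (rule exI)
  then obtain p where p: "degree p > 0 \<and> p dvd f" "\<And>r. degree r > 0 \<and> r dvd f \<Longrightarrow> degree p \<le> degree r"
    using ex_has_least_nat[of "\<lambda>p. degree p > 0 \<and> p dvd f" _ degree] by blast
  have "irreducible p"
  proof (rule irreducibleI)
    show "p \<noteq> 0" "\<not> is_unit p" using p(1) by (auto simp: poly_is_unit)
    fix a b assume ab: "p = a * b"
    hence nz: "a \<noteq> 0" "b \<noteq> 0" using p(1) by auto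
    show "is_unit a \<or> is_unit b"
    proof (rule ccontr)
      assume "\<not> ?thesis"
      hence d: "degree a > 0" "degree b > 0" using nz by (auto simp: poly_is_unit)
      have "a dvd f" using p(1) ab by (metis dvd_mult_left)
      hence "degree p \<le> degree a" using p(2) d by blast
      thus False using ab nz d by (simp add: degree_mult_eq)
    qed
  qed
  thus ?thesis using that field_poly_irreducible_imp_prime p(1) by blast
qed

text \<open>Divide by the squares of prime factors until only a constant is left.\<close>

lemma poly_square_criterion:
  fixes f :: "'k::field poly"
  assumes "f \<noteq> 0" "\<And>\<pi>. prime_elem \<pi> \<Longrightarrow> even (pmult \<pi> f)"
  shows "\<exists>c g. f = [:c:] * g^2"
  using assms
proof (induction "degree f" arbitrary: f rule: less_induct)
  case less
  show ?case
  proof (cases "degree f = 0")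
    case True
    then obtain c where "f = [:c:]" using degree_eq_zeroE by blast
    thus ?thesis by (intro exI[of _ c] exI[of _ 1]) simp
  next
    case False
    then obtain \<pi> where pi: "prime_elem \<pi>" "\<pi> dvd f" using prime_divisor_exists_poly by blast
    have "pmult \<pi> f > 0" using pmult_pos pi less.prems(1) by blast
    hence "2 \<le> pmult \<pi> f" using less.prems(2)[OF pi(1)] by (metis One_nat_def Suc_leI less_2_cases not_less odd_one less_numeral_extra(3))
    hence "\<pi>^2 dvd \<pi> ^ pmult \<pi> f" by (rule le_imp_power_dvd)
    moreover have "\<pi> ^ pmult \<pi> f dvd f" using pmultE[OF pi(1) less.prems(1)] by (metis dvd_triv_left)
    ultimately obtain g where g: "f = \<pi>^2 * g" by (meson dvdE dvd_trans)
    have g0: "g \<noteq> 0" "\<pi> \<noteq> 0" using g less.prems(1) by auto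
    have "degree \<pi> > 0" using pi g0 by (metis gr0I poly_is_unit prime_elem_def)
    hence "degree g < degree f" using g g0 by (simp add: degree_mult_eq degree_power_eq)
    moreover have "even (pmult \<rho> g)" if "prime_elem \<rho>" for \<rho>
    proof -
      have "pmult \<rho> f = 2 * pmult \<rho> \<pi> + pmult \<rho> g"
        using g0 unfolding g power2_eq_square by (simp add: pmult_mult[OF that])
      thus ?thesis using less.prems(2)[OF that] by simp
    qed
    ultimately obtain c h where "g = [:c:] * h^2" using less.hyps g0 by blast
    hence "f = [:c:] * (\<pi> * h)^2" using g by (simp add: power_mult_distrib mult_ac)
    thus ?thesis by blast
  qed
qed

text \<open>Modulo squares n / d equals the polynomial n d, to which the previous criterion applies
  up to a constant.\<close>

lemma fract_square_criterion:
  fixes x :: "'k::field poly fract"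
  assumes "x \<noteq> 0" "\<And>\<pi>. prime_elem \<pi> \<Longrightarrow> even (vord \<pi> x)" "is_sq (lc x)"
  shows "is_sq x"
proof -
  obtain n d where nd: "n \<noteq> 0" "d \<noteq> 0" "x = Fract n d" using assms(1) by (rule nonzero_FractE)
  have "even (pmult \<pi> (n * d))" if "prime_elem \<pi>" for \<pi>
    using assms(2)[OF that] nd by (auto simp: vord_Fract[OF that] pmult_mult[OF that])
  then obtain c g where g: "n * d = [:c:] * g^2" using poly_square_criterion[of "n * d"] nd by auto
  have c0: "c \<noteq> 0" "g \<noteq> 0" using g nd by auto
  have "lead_coeff n * lead_coeff d = c * (lead_coeff g)^2"
    using arg_cong[OF g, of lead_coeff] by (simp add: lead_coeff_mult lead_coeff_power)
  moreover have "is_sq (lead_coeff n / lead_coeff d * (lead_coeff d)^2)"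
    using assms(3) nd by (intro is_sq_mult) (simp_all add: lc_Fract)
  ultimately have "is_sq (c * (lead_coeff g)^2)" using nd by (simp add: power2_eq_square)
  hence "is_sq c" using c0 by (intro is_sq_cancel[of c "(lead_coeff g)^2"]) auto
  then obtain r where r: "c = r^2" unfolding is_sq_def by blast
  have "n * d = ([:r:] * g)^2" using g r by (simp add: power2_eq_square mult_ac)
  moreover have "x = Fract (n * d) (d * d)" using nd by (simp add: eq_fract mult_ac)
  ultimately have "x = (Fract ([:r:] * g) d)^2" by (simp add: power2_eq_square)
  thus ?thesis unfolding is_sq_def by blast
qed

lemma vord_square_even:
  assumes pi: "prime_elem \<pi>" and "x \<noteq> 0" shows "vord \<pi> (x^2) = 2 * vord \<pi> x"
  using vord_mult[OF pi, of x x] assms(2) by (simp add: power2_eq_square)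

section \<open>Heights of rational functions\<close>

lemma finite_degree_le: "finite {p :: 'k::{finite,zero} poly. degree p \<le> B}"
proof (rule finite_subset)
  show "{p :: 'k poly. degree p \<le> B} \<subseteq> Poly ` {xs. set xs \<subseteq> UNIV \<and> length xs \<le> Suc B}"
  proof
    fix p :: "'k poly" assume "p \<in> {p. degree p \<le> B}"
    hence "length (coeffs p) \<le> Suc B" by (cases "p = 0") (auto simp: length_coeffs)
    thus "p \<in> Poly ` {xs. set xs \<subseteq> UNIV \<and> length xs \<le> Suc B}" by (intro image_eqI[of _ _ "coeffs p"]) auto
  qed
qed (intro finite_imageI finite_lists_length_le finite)

text \<open>A minimum over all representations, which makes upper bounds immediate;
  \<open>height_coprime\<close> supplies the lower bounds by showing that lowest terms attain
  it.\<close>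

definition height :: "'k::field poly fract \<Rightarrow> nat" where
  "height x = (LEAST m. \<exists>n d. d \<noteq> 0 \<and> x = Fract n d \<and> degree n \<le> m \<and> degree d \<le> m)"

lemma height_le: "d \<noteq> 0 \<Longrightarrow> degree n \<le> m \<Longrightarrow> degree d \<le> m \<Longrightarrow> height (Fract n d) \<le> m"
  unfolding height_def by (rule Least_le) blast

lemma height_attained: "\<exists>n d. d \<noteq> 0 \<and> x = Fract n d \<and> degree n \<le> height x \<and> degree d \<le> height x"
  unfolding height_def
proof (rule LeastI_ex)
  obtain a b where "b \<noteq> 0" "x = Fract a b" by (cases x) auto
  thus "\<exists>m n d. d \<noteq> 0 \<and> x = Fract n d \<and> degree n \<le> m \<and> degree d \<le> m"
    by (intro exI[of _ "max (degree a) (degree b)"] exI[of _ a] exI[of _ b]) auto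
qed

lemma finite_height_le: "finite {x :: 'k::{field,finite} poly fract. height x \<le> B}"
proof (rule finite_subset)
  show "{x :: 'k poly fract. height x \<le> B} \<subseteq> (\<lambda>(n, d). Fract n d) ` ({p. degree p \<le> B} \<times> {p. degree p \<le> B})"
  proof
    fix x :: "'k poly fract" assume "x \<in> {x. height x \<le> B}"
    moreover obtain n d where "x = Fract n d" "degree n \<le> height x" "degree d \<le> height x"
      using height_attained[of x] by blast
    ultimately show "x \<in> (\<lambda>(n, d). Fract n d) ` ({p. degree p \<le> B} \<times> {p. degree p \<le> B})"
      by (intro image_eqI[of _ _ "(n, d)"]) auto
  qed
qed (intro finite_imageI finite_cartesian_product finite_degree_le)

lemma height_coprime:
  assumes "d \<noteq> 0" "coprime n (d :: 'k::field poly)"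
  shows "degree n \<le> height (Fract n d)" "degree d \<le> height (Fract n d)"
proof -
  obtain a b where ab: "b \<noteq> 0" "Fract n d = Fract a b" "degree a \<le> height (Fract n d)" "degree b \<le> height (Fract n d)"
    using height_attained by blast
  have e: "n * b = a * d" using ab assms by (simp add: eq_fract)
  have "d dvd n * b" using e by simp
  hence "d dvd b" using poly_coprime_dvd_mult assms(2) coprime_commute by blast
  thus "degree d \<le> height (Fract n d)" using dvd_imp_degree_le[of d b] ab by simp
  show "degree n \<le> height (Fract n d)"
  proof (cases "a = 0")
    case True thus ?thesis using e ab by auto
  next
    case False
    have "n dvd d * a" using e by (metis dvd_triv_left mult.commute)
    hence "n dvd a" using poly_coprime_dvd_mult assms(2) by blast
    thus ?thesis using dvd_imp_degree_le[of n a] ab False by simp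
  qed
qed

text \<open>By the rational root theorem, a root of a quadratic is no more complicated than the
  coefficients.\<close>

lemma height_quadratic_root:
  fixes X :: "'k::field poly fract"
  assumes "A \<noteq> 0" and deg: "degree A \<le> M" "degree B \<le> M" "degree C \<le> M"
    and root: "Fract A 1 * X^2 + Fract B 1 * X + Fract C 1 = 0"
  shows "height X \<le> M"
proof -
  obtain n d where nd: "d \<noteq> 0" "coprime n d" "X = Fract n d" by (rule Fract_coprime)
  have "Fract A 1 * X^2 + Fract B 1 * X + Fract C 1 = Fract (A * n^2 + B * n * d + C * d^2) (d^2)"
    using nd by (simp add: power2_eq_square eq_fract algebra_simps)
  hence e: "A * n^2 + B * n * d + C * d^2 = 0" using root nd(1) by simp
  have cop: "coprime d (n^2)" "coprime n (d^2)"
    using nd(2) poly_coprime_power coprime_commute by blast+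
  have "n^2 * A = d * (- B * n - C * d)" using e by (simp add: algebra_simps power2_eq_square eq_neg_iff_add_eq_0)
  hence "d dvd n^2 * A" by (metis dvd_triv_left)
  hence dA: "d dvd A" using cop(1) poly_coprime_dvd_mult by blast
  hence d: "degree d \<le> M" using dvd_imp_degree_le[OF dA assms(1)] deg by simp
  have "d^2 * C = n * (- A * n - B * d)" using e by (simp add: algebra_simps power2_eq_square eq_neg_iff_add_eq_0)
  hence "n dvd d^2 * C" by (metis dvd_triv_left)
  hence nC: "n dvd C" using cop(2) poly_coprime_dvd_mult by blast
  have n: "degree n \<le> M"
  proof (cases "C = 0 \<and> n \<noteq> 0")
    case False
    thus ?thesis using dvd_imp_degree_le[OF nC] deg by (cases "n = 0") auto
  next
    \<comment> \<open>When C = 0 the divisibility n dvd C is empty, but X then solves A X + B = 0,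
      and n divides B instead.\<close>
    case True
    hence "n * (A * n + B * d) = 0" using e by (simp add: algebra_simps power2_eq_square)
    hence e2: "A * n + B * d = 0" using True by simp
    hence "n dvd d * B" by (metis add_eq_0_iff dvd_minus_iff dvd_triv_right mult.commute)
    hence nB: "n dvd B" using poly_coprime_dvd_mult nd(2) by blast
    have "B \<noteq> 0" using e2 True assms(1) by auto
    thus ?thesis using dvd_imp_degree_le[OF nB] deg by simp
  qed
  show ?thesis unfolding nd(3) using nd(1) n d by (intro height_le)
qed

lemma numeral_Fract: "numeral k = Fract (numeral k) (1 :: 'a::idom)"
  using Fract_of_nat_eq[of "numeral k"] by (metis of_nat_numeral)

text \<open>A Bezout identity for the duplication formula; swapping the roles of \<open>n\<close> and \<open>d\<close>
  (that is, substituting \<open>b d\<close> for \<open>n\<close> and \<open>n\<close> for \<open>d\<close>) gives a second one.\<close>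

definition dupl_F where "dupl_F b n d = (n^2 - b * d^2)^2"
definition dupl_G where "dupl_G a b n d = 4 * (n * d * (n^2 + a * n * d + b * d^2))"
definition bez_f where
  "bez_f a b n d = 4 * d * ((a^2 - 4 * b) * ((n^2 - b * d^2)^2 - 2 * n^2 * (n^2 - 2 * b * d^2)) * d^2
     + n^2 * (n^2 - 2 * b * d^2)^2)"
definition bez_g where
  "bez_g a b n d = - ((n^2 - a * n * d + b * d^2) * n * (n^2 - 2 * b * d^2)^2)"

lemma dupl_bezout:
  fixes a b n d :: "'a::idom"
  shows "bez_f a b n d * dupl_F b n d + bez_g a b n d * dupl_G a b n d = 4 * (a^2 - 4 * b) * b^4 * d^11"
  unfolding bez_f_def bez_g_def dupl_F_def dupl_G_def by Groebner_Basis.algebra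

lemma dupl_swap:
  fixes a b n d :: "'a::idom"
  shows "dupl_F b (b * d) n = b^2 * dupl_F b n d" "dupl_G a b (b * d) n = b^2 * dupl_G a b n d"
  unfolding dupl_F_def dupl_G_def by Groebner_Basis.algebra+

lemma deg_mult: "degree p \<le> P \<Longrightarrow> degree q \<le> Q \<Longrightarrow> P + Q \<le> R \<Longrightarrow> degree (p * q) \<le> (R::nat)"
  by (meson add_mono degree_mult_le le_trans)

lemma deg_power: "degree p \<le> P \<Longrightarrow> k * P \<le> R \<Longrightarrow> degree (p ^ k) \<le> (R::nat)"
  by (metis degree_power_le le_trans mult.commute mult_le_mono1)

lemma deg_numeral: "degree (numeral k :: 'a::comm_semiring_1 poly) \<le> R"
  by (metis degree_numeral le0)

text \<open>Both multipliers are homogeneous of degree 7 in n and d, whence 7 h. The coefficient of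
  m is just large enough for a uniform bound.\<close>

lemma bez_degree:
  fixes a b n d :: "'k::field poly"
  assumes "degree a \<le> m" "degree b \<le> 2 * m" "degree n \<le> h" "degree d \<le> h"
  shows "degree (bez_f a b n d) \<le> 7 * h + 8 * m" "degree (bez_g a b n d) \<le> 7 * h + 8 * m"
proof -
  have bd: "degree (b * d^2) \<le> 2 * h + 2 * m"
    by (rule deg_mult[OF assms(2) deg_power[OF assms(4) order_refl]]) simp
  have n2: "degree (n^2) \<le> 2 * h" "degree (n^2) \<le> 2 * h + 2 * m" "degree (d^2) \<le> 2 * h"
    using deg_power[OF assms(3), of 2] deg_power[OF assms(4), of 2] by auto
  have b2: "degree (2 * b * d^2) \<le> 2 * h + 2 * m"
    unfolding mult.assoc[of 2] by (rule deg_mult[OF deg_numeral bd]) simp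
  have e1: "degree (n^2 - b * d^2) \<le> 2 * h + 2 * m" "degree (n^2 - 2 * b * d^2) \<le> 2 * h + 2 * m"
    by (intro degree_diff_le n2 bd b2)+
  have e2: "degree ((n^2 - b * d^2)^2) \<le> 4 * h + 4 * m" "degree ((n^2 - 2 * b * d^2)^2) \<le> 4 * h + 4 * m"
    by (rule deg_power[OF e1(1)], simp, rule deg_power[OF e1(2)], simp)
  have e3: "degree (2 * n^2 * (n^2 - 2 * b * d^2)) \<le> 4 * h + 4 * m"
    by (rule deg_mult[OF deg_mult[OF deg_numeral[of _ 0] n2(1) order_refl] e1(2)]) simp
  have e4: "degree ((n^2 - b * d^2)^2 - 2 * n^2 * (n^2 - 2 * b * d^2)) \<le> 4 * h + 4 * m"
    by (intro degree_diff_le e2 e3)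
  have b4: "degree (4 * b) \<le> 2 * m" by (rule deg_mult[OF deg_numeral[of _ 0] assms(2)]) simp
  have a2: "degree (a^2) \<le> 2 * m" using deg_power[OF assms(1), of 2] by simp
  have del: "degree (a^2 - 4 * b) \<le> 2 * m" by (intro degree_diff_le a2 b4)
  have e5: "degree ((a^2 - 4 * b) * ((n^2 - b * d^2)^2 - 2 * n^2 * (n^2 - 2 * b * d^2)) * d^2) \<le> 6 * h + 8 * m"
    by (rule deg_mult[OF deg_mult[OF del e4 order_refl] n2(3)]) simp
  have e6: "degree (n^2 * (n^2 - 2 * b * d^2)^2) \<le> 6 * h + 8 * m"
    by (rule deg_mult[OF n2(1) e2(2)]) simp
  have d4: "degree (4 * d) \<le> h" by (rule deg_mult[OF deg_numeral[of _ 0] assms(4)]) simp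
  show "degree (bez_f a b n d) \<le> 7 * h + 8 * m" unfolding bez_f_def
    by (rule deg_mult[OF d4 degree_add_le[OF e5 e6]]) simp
  have xand: "degree (a * n * d) \<le> 2 * h + 2 * m"
    by (rule deg_mult[OF deg_mult[OF assms(1,3) order_refl] assms(4)]) simp
  have e7: "degree (n^2 - a * n * d + b * d^2) \<le> 2 * h + 2 * m"
    by (intro degree_add_le degree_diff_le n2(2) xand bd)
  show "degree (bez_g a b n d) \<le> 7 * h + 8 * m" unfolding bez_g_def degree_minus
    by (rule deg_mult[OF deg_mult[OF e7 assms(3) order_refl] e2(2)]) simp
qed

text \<open>Polynomial coefficients cover both the Legendre curve, with 1 and X^(2e), and its twist,
  with X and X^(e+1).\<close>

locale function_field_curve =
  fixes a0 b0 :: "'k::{field,finite} poly"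
  assumes ab: "a0 \<noteq> 0" "b0 \<noteq> 0" "a0 \<noteq> b0" and two_k: "(2::'k) \<noteq> 0"
begin

abbreviation \<alpha> where "\<alpha> \<equiv> Fract a0 1"
abbreviation \<beta> where "\<beta> \<equiv> Fract b0 1"

lemma two_poly: "(2 :: 'k poly) \<noteq> 0" "(4 :: 'k poly) \<noteq> 0"
proof -
  show t: "(2 :: 'k poly) \<noteq> 0" using two_k by (metis numeral_poly pCons_eq_0_iff)
  have "(4 :: 'k poly) = 2 * 2" by simp
  thus "(4 :: 'k poly) \<noteq> 0" using t by (metis mult_eq_0_iff)
qed

sublocale ecurve \<alpha> \<beta>
proof
  show "\<alpha> \<noteq> 0" "\<beta> \<noteq> 0" "\<alpha> \<noteq> \<beta>" using ab by (simp_all add: eq_fract)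
  show "(2 :: 'k poly fract) \<noteq> 0" unfolding numeral_Fract using two_poly by simp
qed

abbreviation padd' (infixl "\<oplus>\<^sub>E" 65) where "P \<oplus>\<^sub>E Q \<equiv> point_add E P Q"

section \<open>Heights of points under doubling and translation\<close>

definition m0 where "m0 = max (degree a0) (degree b0)"

lemma degs: "degree (a0 + b0) \<le> m0" "degree (a0 * b0) \<le> 2 * m0" "degree a0 \<le> m0" "degree b0 \<le> m0"
  using degree_mult_le[of a0 b0] by (auto simp: m0_def intro: degree_add_le)

text \<open>The degree bounds the cancellation in the duplication formula, as a common factor
  divides this polynomial. The factor 50 is generous; the estimate uses 26.\<close>

definition Cdbl where "Cdbl = 50 * m0 + degree (4 * ((a0 + b0)^2 - 4 * (a0 * b0)) * (a0 * b0)^4)"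

text \<open>A common factor \<open>e\<close> of the numerator F and the denominator G divides both
  \<Delta> d^11 and \<Delta> n^11, hence \<Delta>. So F and G have degree at most that of \<Delta>
  plus the height of X. The Bezout identities then bound 11 h by 7 h plus this quantity, and the
  difference is the factor 4.\<close>

lemma height_double:
  assumes P: "onE (Affine x y)" "y \<noteq> 0" and D: "Affine x y \<oplus>\<^sub>E Affine x y = Affine X Y"
  shows "4 * height x \<le> height X + Cdbl"
proof -
  obtain n d where nd: "d \<noteq> 0" "coprime n d" "x = Fract n d" by (rule Fract_coprime)
  obtain n' d' where nd': "d' \<noteq> 0" "coprime n' d'" "X = Fract n' d'" by (rule Fract_coprime)
  define s p where "s = a0 + b0" and "p = a0 * b0"
  define F G where "F = dupl_F p n d" and "G = dupl_G s p n d"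
  define \<Delta> where "\<Delta> = 4 * (s^2 - 4 * p) * p^4"
  have D0: "\<Delta> \<noteq> 0"
  proof -
    have "s^2 - 4 * p = (a0 - b0)^2" unfolding s_def p_def by Groebner_Basis.algebra
    thus ?thesis using ab two_poly by (simp add: \<Delta>_def p_def)
  qed
  have "4 * (x * (x + \<alpha>) * (x + \<beta>)) * X = (x^2 - \<alpha> * \<beta>)^2"
    using double_x[OF P] D by (metis point.inject)
  moreover have "4 * (x * (x + \<alpha>) * (x + \<beta>)) * X = Fract (4 * (n * (n + a0 * d) * (n + b0 * d)) * n') (d * d * d * d')"
    using nd(1) nd'(1) unfolding nd(3) nd'(3) numeral_Fract[of "num.Bit0 (num.Bit0 num.One)"] by (simp add: mult_ac)
  moreover have "(x^2 - \<alpha> * \<beta>)^2 = Fract F (d * d * d * d)"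
    using nd(1) unfolding nd(3) by (simp add: F_def dupl_F_def p_def power2_eq_square mult_ac)
  ultimately have "Fract (4 * (n * (n + a0 * d) * (n + b0 * d)) * n') (d * d * d * d') = Fract F (d * d * d * d)" by simp
  hence "4 * (n * (n + a0 * d) * (n + b0 * d)) * n' * (d * d * d * d) = F * (d * d * d * d')"
    using nd(1) nd'(1) by (simp add: eq_fract)
  moreover have "4 * (n * (n + a0 * d) * (n + b0 * d)) * n' * (d * d * d * d) = (d * d * d) * (G * n')"
    unfolding G_def dupl_G_def s_def p_def by Groebner_Basis.algebra
  moreover have "F * (d * d * d * d') = (d * d * d) * (F * d')" by (simp add: mult_ac)
  ultimately have GF: "G * n' = F * d'" using nd(1) by simp
  have "d' dvd G * n'" using GF by simp
  hence "d' dvd G" using nd'(2) poly_coprime_dvd_mult coprime_commute by (metis mult.commute)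
  then obtain e where e: "G = d' * e" by (elim dvdE)
  hence "d' * (e * n') = d' * F" using GF by (simp add: mult_ac)
  hence e': "F = n' * e" using nd'(1) by (simp add: mult.commute)
  have bz1: "bez_f s p n d * F + bez_g s p n d * G = \<Delta> * d^11"
    unfolding F_def G_def \<Delta>_def by (rule dupl_bezout)
  \<comment> \<open>Exchanging n and d in the identity corresponds to translation by the 2-torsion
    point (0, 0), which takes x to p / x.\<close>
  have "bez_f s p (p * d) n * dupl_F p (p * d) n + bez_g s p (p * d) n * dupl_G s p (p * d) n = \<Delta> * n^11"
    unfolding \<Delta>_def by (rule dupl_bezout)
  hence bz2: "p^2 * bez_f s p (p * d) n * F + p^2 * bez_g s p (p * d) n * G = \<Delta> * n^11"
    unfolding dupl_swap F_def G_def by (simp add: mult_ac)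
  have eD1: "e dvd \<Delta> * d^11" unfolding bz1[symmetric] unfolding e e' by (intro dvd_add dvd_mult) auto
  have eD2: "e dvd \<Delta> * n^11" unfolding bz2[symmetric] unfolding e e' by (intro dvd_add dvd_mult) auto
  have "\<exists>r t. r * n^11 + t * d^11 = 1"
    by (intro poly_bezout) (metis nd(2) poly_coprime_power coprime_commute)
  then obtain r t where rt: "r * n^11 + t * d^11 = 1" by blast
  have "\<Delta> = \<Delta> * (r * n^11 + t * d^11)" using rt by simp
  also have "\<dots> = r * (\<Delta> * n^11) + t * (\<Delta> * d^11)" by (simp add: algebra_simps)
  finally have De: "\<Delta> = r * (\<Delta> * n^11) + t * (\<Delta> * d^11)" .
  have "e dvd r * (\<Delta> * n^11) + t * (\<Delta> * d^11)" by (rule dvd_add[OF dvd_mult[OF eD2] dvd_mult[OF eD1]])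
  hence "e dvd \<Delta>" using De by simp
  hence edeg: "degree e \<le> degree \<Delta>" using dvd_imp_degree_le D0 by blast
  define h where "h = height x"
  have hn: "degree n \<le> h" "degree d \<le> h" using height_coprime[OF nd(1,2)] nd(3) by (simp_all add: h_def)
  have hX: "degree n' \<le> height X" "degree d' \<le> height X" using height_coprime[OF nd'(1,2)] nd'(3) by simp_all
  define M where "M = height X + degree \<Delta>"
  have FG: "degree F \<le> M" "degree G \<le> M"
    unfolding e e' M_def using hX edeg by (auto intro!: deg_mult[OF _ _ order_refl, THEN le_trans])
  note sp = degs(1,2)[folded s_def p_def]
  have b1: "degree (bez_f s p n d) \<le> 7 * h + 8 * m0" "degree (bez_g s p n d) \<le> 7 * h + 8 * m0"
    by (rule bez_degree[OF sp hn])+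
  have pd: "degree (p * d) \<le> h + 2 * m0" "degree n \<le> h + 2 * m0"
    by (rule deg_mult[OF sp(2) hn(2)]) (use hn in simp_all)
  have b2: "degree (bez_f s p (p * d) n) \<le> 7 * h + 22 * m0" "degree (bez_g s p (p * d) n) \<le> 7 * h + 22 * m0"
    using bez_degree[OF sp pd] by simp_all
  have p2: "degree (p^2) \<le> 4 * m0" using deg_power[OF sp(2), of 2] by simp
  have "degree (\<Delta> * d^11) \<le> 7 * h + 26 * m0 + M" unfolding bz1[symmetric]
    by (intro degree_add_le deg_mult[OF b1(1) FG(1)] deg_mult[OF b1(2) FG(2)]) simp_all
  hence dd: "degree (d^11) \<le> 7 * h + 26 * m0 + M" using D0 nd(1) by (simp add: degree_mult_eq)
  have "degree (\<Delta> * n^11) \<le> 7 * h + 26 * m0 + M" unfolding bz2[symmetric]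
    by (intro degree_add_le deg_mult[OF deg_mult[OF p2 b2(1) order_refl] FG(1)] deg_mult[OF deg_mult[OF p2 b2(2) order_refl] FG(2)]) simp_all
  hence nn: "degree (n^11) \<le> 7 * h + 26 * m0 + M"
    using D0 by (cases "n = 0") (simp_all add: degree_mult_eq)
  have "h \<le> max (degree n) (degree d)"
    unfolding h_def nd(3) by (rule height_le) (use nd in auto)
  moreover have "11 * degree n \<le> 7 * h + 26 * m0 + M" using nn by (cases "n = 0") (simp_all add: degree_power_eq)
  moreover have "11 * degree d \<le> 7 * h + 26 * m0 + M" using dd nd(1) by (simp add: degree_power_eq)
  ultimately have "4 * h \<le> 26 * m0 + M" by (simp add: max_def split: if_splits)
  thus ?thesis unfolding h_def M_def Cdbl_def \<Delta>_def s_def p_def by simp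
qed

fun hp :: "'k poly fract point \<Rightarrow> nat" where
  "hp Infinity = 0" | "hp (Affine x y) = height x"

lemma finite_hp: "finite {P \<in> carrier MW. hp P \<le> B}"
proof -
  let ?X = "{x :: 'k poly fract. height x \<le> B}"
  have "{P \<in> carrier MW. hp P \<le> B} \<subseteq> insert Infinity (\<Union>x\<in>?X. (\<lambda>y. Affine x y) ` {y. y^2 = x * (x + \<alpha>) * (x + \<beta>)})"
  proof
    fix P assume P: "P \<in> {P \<in> carrier MW. hp P \<le> B}"
    thus "P \<in> insert Infinity (\<Union>x\<in>?X. (\<lambda>y. Affine x y) ` {y. y^2 = x * (x + \<alpha>) * (x + \<beta>)})"
      by (cases P) (auto simp: onE)
  qed
  moreover have "finite {y. y^2 = c}" for c :: "'k poly fract"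
  proof (cases "\<exists>r. r^2 = c")
    case True
    then obtain r where "r^2 = c" by blast
    hence "{y. y^2 = c} \<subseteq> {r, -r}" by (auto simp: power2_eq_iff)
    thus ?thesis using finite_subset by blast
  qed simp
  hence "finite (insert Infinity (\<Union>x\<in>?X. (\<lambda>y. Affine x y) ` {y. y^2 = x * (x + \<alpha>) * (x + \<beta>)}))"
    using finite_height_le[of B] by (intro finite.insertI finite_UN_I finite_imageI)
  ultimately show ?thesis by (rule finite_subset)
qed

text \<open>The last three summands cover the 2-torsion points, whose double is the point at
  infinity, of height 0.\<close>

lemma hp_double:
  assumes "onE P" shows "4 * hp P \<le> hp (P \<oplus>\<^sub>E P) + (Cdbl + 4 * height (0 :: 'k poly fract) + 4 * height (- \<alpha>) + 4 * height (- \<beta>))"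
proof (cases P)
  case (Affine x y)
  show ?thesis
  proof (cases "y = 0")
    case True
    hence "is_root x" using assms Affine onE_y0 by simp
    thus ?thesis using Affine by (auto simp: is_root_def)
  next
    case False
    obtain X Y where XY: "Affine x y \<oplus>\<^sub>E Affine x y = Affine X Y"
      using double_x[OF _ False] assms Affine by blast
    thus ?thesis using height_double[OF _ False XY] assms Affine by simp
  qed
qed simp

text \<open>The quadratic satisfied by the x-coordinate of P + Q has coefficients of degree 2 in the
  numerator and denominator of x1, and a root is no higher than the coefficients. The last summand
  of \<open>C\<close> covers P = Q.\<close>

lemma hp_add:
  assumes Q: "onE Q"
  shows "\<exists>C. \<forall>P. onE P \<longrightarrow> hp (P \<oplus>\<^sub>E Q) \<le> 2 * hp P + C"
proof (cases Q)
  case Infinity thus ?thesis by (intro exI[of _ 0]) auto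
next
  case (Affine x2 y2)
  obtain r s where rs: "s \<noteq> 0" "x2 = Fract r s" by (cases x2) auto
  define k where "k = max (degree r) (degree s)"
  have k: "degree r \<le> k" "degree s \<le> k" by (auto simp: k_def)
  define a b where "a = a0 + b0" and "b = a0 * b0"
  note sp = degs(1,2)[folded a_def b_def]
  define C where "C = 2 * k + 4 * m0 + hp (Q \<oplus>\<^sub>E Q)"
  have "hp (P \<oplus>\<^sub>E Q) \<le> 2 * hp P + C" if P: "onE P" for P
  proof (cases P)
    case Infinity
    have "hp Q \<le> k" unfolding Affine rs(2) hp.simps by (rule height_le) (use rs k in auto)
    thus ?thesis using Infinity by (simp add: C_def)
  next
    case P1: (Affine x1 y1)
    show ?thesis
    proof (cases "x1 = x2")
      case True
      hence "px P = px Q" using P1 Affine by simp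
      hence "P = Q \<or> P = pneg Q" using px_eq_iff P Q by blast
      thus ?thesis by (auto simp: C_def)
    next
      case False
      obtain X Y where XY: "P \<oplus>\<^sub>E Q = Affine X Y" and quad:
        "(x1 - x2)^2 * X^2 - 2 * ((x1 * x2 + \<alpha> * \<beta>) * (x1 + x2) + 2 * (\<alpha> + \<beta>) * x1 * x2) * X + (x1 * x2 - \<alpha> * \<beta>)^2 = 0"
        using add_x_quadratic[OF _ _ False] P Q P1 Affine by metis
      obtain n d where nd: "d \<noteq> 0" "coprime n d" "x1 = Fract n d" by (rule Fract_coprime)
      define h where "h = height x1"
      have hn: "degree n \<le> h" "degree d \<le> h" using height_coprime[OF nd(1,2)] nd(3) by (simp_all add: h_def)
      \<comment> \<open>The coefficients of the quadratic, multiplied by (d s)^2 to clear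
        denominators.\<close>
      define A B C' where "A = (n * s - r * d)^2"
        and "B = - (2 * ((n * r + b * (d * s)) * (n * s + r * d) + 2 * a * (n * s) * (r * d)))"
        and "C' = (n * r - b * (d * s))^2"
      have ds: "d * s \<noteq> 0" using nd rs by simp
      have eA: "x1 - x2 = Fract (n * s - r * d) (d * s)" using nd rs by simp
      have "Fract (n * s - r * d) (d * s) \<noteq> 0" using False eA by (metis right_minus_eq)
      hence A0: "A \<noteq> 0" using ds by (simp add: A_def)
      have eB: "2 * ((x1 * x2 + \<alpha> * \<beta>) * (x1 + x2) + 2 * (\<alpha> + \<beta>) * x1 * x2) = - Fract B ((d * s)^2)"
        using nd(1) rs(1) unfolding nd(3) rs(2) numeral_Fract[of "num.Bit0 num.One"] B_def a_def b_def
        by (simp add: eq_fract) Groebner_Basis.algebra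
      have eC: "(x1 * x2 - \<alpha> * \<beta>)^2 = Fract C' ((d * s)^2)"
        using nd(1) rs(1) unfolding nd(3) rs(2) C'_def b_def by (simp add: power2_eq_square mult_ac)
      have "(x1 - x2)^2 = Fract A ((d * s)^2)" unfolding eA A_def by (simp add: power2_eq_square)
      hence "Fract A ((d * s)^2) * X^2 + Fract B ((d * s)^2) * X + Fract C' ((d * s)^2) = 0"
        using quad unfolding eB eC by (simp del: minus_fract)
      hence "Fract ((d * s)^2) 1 * (Fract A ((d * s)^2) * X^2 + Fract B ((d * s)^2) * X + Fract C' ((d * s)^2)) = 0" by simp
      moreover have "Fract ((d * s)^2) 1 * Fract Z ((d * s)^2) = Fract Z 1" for Z
        using ds by (simp add: eq_fract)
      ultimately have "Fract A 1 * X^2 + Fract B 1 * X + Fract C' 1 = 0"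
        by (simp only: distrib_left mult.assoc[symmetric])
      moreover have e1: "degree (n * s) \<le> h + k" "degree (r * d) \<le> h + k" "degree (n * r) \<le> h + k + 2 * m0" "degree (d * s) \<le> h + k"
        by (rule deg_mult[OF hn(1) k(2)] deg_mult[OF k(1) hn(2)] deg_mult[OF hn(1) k(1)] deg_mult[OF hn(2) k(2)]; simp)+
      have e2: "degree (b * (d * s)) \<le> h + k + 2 * m0" by (rule deg_mult[OF sp(2) e1(4)]) simp
      have "degree A \<le> 2 * h + 2 * k + 4 * m0" unfolding A_def
        by (rule deg_power[OF degree_diff_le[OF e1(1,2)]]) simp
      moreover have "degree B \<le> 2 * h + 2 * k + 4 * m0" unfolding B_def degree_minus
      proof (rule deg_mult[OF deg_numeral[of _ 0]])
        show "degree ((n * r + b * (d * s)) * (n * s + r * d) + 2 * a * (n * s) * (r * d)) \<le> 2 * h + 2 * k + 4 * m0"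
        proof (rule degree_add_le)
          show "degree ((n * r + b * (d * s)) * (n * s + r * d)) \<le> 2 * h + 2 * k + 4 * m0"
            by (rule deg_mult[OF degree_add_le[OF e1(3) e2] degree_add_le[OF e1(1,2)]]) simp
          show "degree (2 * a * (n * s) * (r * d)) \<le> 2 * h + 2 * k + 4 * m0"
            by (rule deg_mult[OF deg_mult[OF deg_mult[OF deg_numeral[of _ 0] sp(1) order_refl] e1(1) order_refl] e1(2)]) simp
        qed
      qed simp
      moreover have "degree C' \<le> 2 * h + 2 * k + 4 * m0" unfolding C'_def
        by (rule deg_power[OF degree_diff_le[OF e1(3) e2]]) simp
      ultimately have "height X \<le> 2 * h + 2 * k + 4 * m0" using A0 height_quadratic_root by blast
      thus ?thesis using XY P1 by (simp add: C_def h_def)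
    qed
  qed
  thus ?thesis by blast
qed

text \<open>Doubling multiplies the height by 4, while subtracting one of the finitely many r at
  most doubles it. The remaining factor 1/2 is what \<open>height_descent\<close> asks for.\<close>

lemma multiple_in_span:
  assumes R: "finite R" "R \<subseteq> carrier MW"
    and half: "\<And>P. P \<in> carrier MW \<Longrightarrow> \<exists>r\<in>R. \<exists>Q\<in>carrier MW. P = r \<otimes>\<^bsub>MW\<^esub> (Q \<otimes>\<^bsub>MW\<^esub> Q)"
    and P: "P \<in> carrier MW"
  shows "\<exists>n::int. n \<noteq> 0 \<and> P [^]\<^bsub>MW\<^esub> n \<in> Zspan MW R"
proof -
  interpret comm_group MW by (rule comm_group_MW)
  have "\<forall>r\<in>R. \<exists>C. \<forall>P. onE P \<longrightarrow> hp (P \<oplus>\<^sub>E pneg r) \<le> 2 * hp P + C"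
    using R hp_add by auto
  then obtain c where c: "\<And>r P. r \<in> R \<Longrightarrow> onE P \<Longrightarrow> hp (P \<oplus>\<^sub>E pneg r) \<le> 2 * hp P + c r" by metis
  define C where "C = sum c R + (Cdbl + 4 * height (0 :: 'k poly fract) + 4 * height (- \<alpha>) + 4 * height (- \<beta>))"
  show ?thesis
  proof (rule height_descent[OF R _ finite_hp P])
    fix P assume P: "P \<in> carrier MW"
    then obtain r Q where rQ: "r \<in> R" "Q \<in> carrier MW" "P = r \<otimes>\<^bsub>MW\<^esub> (Q \<otimes>\<^bsub>MW\<^esub> Q)" using half by blast
    have on: "onE r" "onE Q" "onE (Q \<oplus>\<^sub>E Q)" "onE P" using rQ R P by (auto intro: point_add_closed)
    have "pneg r \<oplus>\<^sub>E P = Q \<oplus>\<^sub>E Q" using rQ on neg_add_cancel[of r "Q \<oplus>\<^sub>E Q"] by simp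
    hence "P \<oplus>\<^sub>E pneg r = Q \<oplus>\<^sub>E Q" using point_add_commute[of P "pneg r"] on by simp
    hence "hp (Q \<oplus>\<^sub>E Q) \<le> 2 * hp P + c r" using c[OF rQ(1) on(4)] by simp
    moreover have "c r \<le> sum c R" using R rQ by (simp add: member_le_sum)
    ultimately have "4 * hp Q \<le> 2 * hp P + C" using hp_double[OF on(2)] by (simp add: C_def)
    hence "2 * hp Q \<le> hp P + C" by simp
    thus "\<exists>r\<in>R. \<exists>Q\<in>carrier MW. P = r \<otimes>\<^bsub>MW\<^esub> (Q \<otimes>\<^bsub>MW\<^esub> Q) \<and> 2 * hp Q \<le> hp P + C" using rQ by blast
  qed
qed

end

section \<open>The rank of the twist is at most \<open>e\<close>\<close>

declare minus_fract [simp del] mult_fract [simp del] add_fract [simp del] diff_fract [simp del]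

text \<open>At a pole of Z all three factors have the same order, so three times it is even. At a
  zero the other two factors are units.\<close>

lemma vord_even_third:
  fixes Z :: "'k::field poly fract"
  assumes pi: "prime_elem \<pi>" and nz: "Z \<noteq> 0" "\<alpha>' \<noteq> 0" "\<beta>' \<noteq> 0" "y \<noteq> 0"
    and u: "vord \<pi> \<alpha>' = 0" "vord \<pi> \<beta>' = 0" and eq: "Z * (Z + \<alpha>') * (Z + \<beta>') = y^2"
  shows "even (vord \<pi> Z)"
proof -
  have nz': "Z + \<alpha>' \<noteq> 0" "Z + \<beta>' \<noteq> 0" using eq nz by auto
  have sum: "vord \<pi> Z + vord \<pi> (Z + \<alpha>') + vord \<pi> (Z + \<beta>') = 2 * vord \<pi> y"
    using arg_cong[OF eq, of "vord \<pi>"] nz nz' by (simp add: vord_mult[OF pi] vord_square_even[OF pi])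
  consider "vord \<pi> Z < 0" | "vord \<pi> Z = 0" | "vord \<pi> Z > 0" by linarith
  thus ?thesis
  proof cases
    case 1
    hence "vord \<pi> (Z + \<alpha>') = vord \<pi> Z" "vord \<pi> (Z + \<beta>') = vord \<pi> Z"
      using vord_add_less(2)[OF pi, of Z] nz u by simp_all
    hence "3 * vord \<pi> Z = 2 * vord \<pi> y" using sum by simp
    thus ?thesis by presburger
  next
    case 3
    hence "vord \<pi> (\<alpha>' + Z) = 0" "vord \<pi> (\<beta>' + Z) = 0"
      using vord_add_less(2)[OF pi, of _ Z] nz u by simp_all
    hence "vord \<pi> Z = 2 * vord \<pi> y" using sum by (simp add: add.commute)
    thus ?thesis by simp
  qed simp
qed

text \<open>Such an x is a constant times a square. This is the relation between the finite places
  and infinity, modulo 2, and will give the parity at v from that of the degree.\<close>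

lemma all_even_square:
  fixes x :: "'k::field poly fract"
  assumes "x \<noteq> 0" "\<And>\<pi>. prime_elem \<pi> \<Longrightarrow> even (vord \<pi> x)"
  shows "even (vdeg x)"
proof -
  obtain n d where nd: "n \<noteq> 0" "d \<noteq> 0" "x = Fract n d" using assms(1) by (rule nonzero_FractE)
  have "even (pmult \<pi> (n * d))" if "prime_elem \<pi>" for \<pi>
    using assms(2)[OF that] nd by (auto simp: vord_Fract[OF that] pmult_mult[OF that])
  then obtain c g where g: "n * d = [:c:] * g^2" using poly_square_criterion[of "n * d"] nd by auto
  have "[:c:] \<noteq> 0" "g \<noteq> 0" using g nd by auto
  hence "degree n + degree d = 2 * degree g"
    using arg_cong[OF g, of degree] nd by (simp add: degree_mult_eq degree_power_eq)
  hence "vdeg x = 2 * (int (degree g) - int (degree d))" using nd by (simp add: vdeg_Fract)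
  thus ?thesis by simp
qed

lemma vdeg_minus: "vdeg (- x) = vdeg (x :: 'k::field poly fract)"
proof (cases "x = 0")
  case False
  then obtain a b where "a \<noteq> 0" "b \<noteq> 0" "x = Fract a b" by (rule nonzero_FractE)
  thus ?thesis by (simp add: vdeg_Fract minus_fract)
qed simp

lemma lc_minus_one_square: "lc (x^2) = (lc x)^2" if "x \<noteq> (0 :: 'k::field poly fract)"
  using lc_mult[OF that that] by (simp add: power2_eq_square)

context function_field_curve
begin

lemma vord_unit: "prime_elem \<pi> \<Longrightarrow> \<not> \<pi> dvd f \<Longrightarrow> vord \<pi> (Fract f 1) = 0"
proof -
  assume pi: "prime_elem \<pi>" and n: "\<not> \<pi> dvd f"
  hence f0: "f \<noteq> 0" by auto
  have "\<not> \<pi> dvd 1" using pi by (simp add: prime_elem_def)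
  thus ?thesis using f0 n by (simp add: vord_Fract[OF pi] pmult_eq_0[OF pi])
qed

lemma even_vord_dmap_0:
  assumes pi: "prime_elem \<pi>" "\<not> \<pi> dvd a0" "\<not> \<pi> dvd b0" and P: "onE P"
  shows "even (vord \<pi> (dmap 0 P))"
proof (cases P)
  case Infinity thus ?thesis by (simp add: vord_one[OF pi(1)])
next
  case (Affine x y)
  have u: "vord \<pi> \<alpha> = 0" "vord \<pi> \<beta> = 0" using pi by (simp_all add: vord_unit)
  show ?thesis
  proof (cases "y = 0")
    case True
    hence "is_root x" using P Affine onE_y0 by simp
    hence "dmap 0 P = \<alpha> * \<beta> \<or> dmap 0 P = - \<alpha> \<or> dmap 0 P = - \<beta>"
      using Affine nz by (auto simp: is_root_def fder_values )
    thus ?thesis using u nz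
      by (auto simp: vord_minus[OF pi(1)] vord_mult[OF pi(1)] )
  next
    case False
    have eq: "x * (x + \<alpha>) * (x + \<beta>) = y^2" using P Affine onE by simp
    hence "x \<noteq> 0" using False by auto
    thus ?thesis using vord_even_third[OF pi(1) _ nz(1,2) False u eq] Affine by simp
  qed
qed

lemma even_vord_dmap_\<alpha>:
  assumes pi: "prime_elem \<pi>" "\<not> \<pi> dvd a0" "\<not> \<pi> dvd b0 - a0" and P: "onE P"
  shows "even (vord \<pi> (dmap (- \<alpha>) P))"
proof (cases P)
  case Infinity thus ?thesis by (simp add: vord_one[OF pi(1)])
next
  case (Affine x y)
  have u: "vord \<pi> \<alpha> = 0" "vord \<pi> (\<beta> - \<alpha>) = 0"
    using pi by (simp_all add: vord_unit diff_fract)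
  have ba: "\<beta> - \<alpha> \<noteq> 0" using nz by simp
  have u': "vord \<pi> (- \<alpha>) = 0" "vord \<pi> (\<alpha> - \<beta>) = 0"
    using u vord_minus[OF pi(1), of \<alpha>] vord_minus[OF pi(1), of "\<beta> - \<alpha>"] by (metis, metis minus_diff_eq)
  show ?thesis
  proof (cases "y = 0")
    case True
    hence "is_root x" using P Affine onE_y0 by simp
    hence "dmap (- \<alpha>) P = \<alpha> * (\<alpha> - \<beta>) \<or> dmap (- \<alpha>) P = \<alpha> \<or> dmap (- \<alpha>) P = \<alpha> - \<beta>"
      using Affine nz by (auto simp: is_root_def fder_values )
    moreover have "vord \<pi> (\<alpha> * (\<alpha> - \<beta>)) = 0"
      using u u' nz ba vord_mult[OF pi(1), of \<alpha> "\<alpha> - \<beta>"] by (simp )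
    ultimately show ?thesis using u u' by (elim disjE) (simp_all )
  next
    case False
    have "x * (x + \<alpha>) * (x + \<beta>) = y^2" using P Affine onE by simp
    moreover from this have x: "x + \<alpha> \<noteq> 0" using False by auto
    \<comment> \<open>Moving the root -\<alpha> to the origin turns the other two shifts into
      -\<alpha> and \<beta> - \<alpha>, which are units at \<pi>.\<close>
    ultimately have "(x + \<alpha>) * (x + \<alpha> + (- \<alpha>)) * (x + \<alpha> + (\<beta> - \<alpha>)) = y^2"
      by (simp add: algebra_simps)
    moreover have "x \<noteq> - \<alpha>" using x by auto
    ultimately show ?thesis
      using vord_even_third[OF pi(1) x _ ba False u'(1) u(2)] nz(1) Affine by simp
  qed
qed

lemma parity_vord: "is_root c \<Longrightarrow> prime_elem \<pi> \<Longrightarrow> parity_hom MW (\<lambda>P. odd (vord \<pi> (dmap c P)))"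
  by (rule parity_hom_dmap) (auto simp: vord_mult)

lemma parity_vdeg: "is_root c \<Longrightarrow> parity_hom MW (\<lambda>P. odd (vdeg (dmap c P)))"
  by (rule parity_hom_dmap) (auto simp: vdeg_mult)

lemma roots: "is_root 0" "is_root (- \<alpha>)" "is_root (- \<beta>)"
  by (auto simp: is_root_def)

text \<open>Weak Mordell-Weil: \<open>\<kappa>\<close> collects the parities of both descent values
  at finitely many primes and their leading coefficients in the finite field k. Points with the same
  data differ by a double.\<close>

lemma bounded_rank_MW: "bounded_rank MW"
proof -
  interpret G: comm_group MW by (rule comm_group_MW)
  define \<Delta> where "\<Delta> = a0 * b0 * (b0 - a0)"
  have D0: "\<Delta> \<noteq> 0" using ab by (simp add: \<Delta>_def)
  \<comment> \<open>Taking every prime of bounded degree includes all divisors of \<Delta> without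
    choosing among associates; the set is finite because k is.\<close>
  define S where "S = {\<pi> :: 'k poly. prime_elem \<pi> \<and> degree \<pi> \<le> degree \<Delta>}"
  have "finite S" unfolding S_def
    by (rule finite_subset[OF _ finite_degree_le[of "degree \<Delta>"]]) auto
  define \<kappa> where "\<kappa> P = ({\<pi>\<in>S. odd (vord \<pi> (dmap 0 P))}, {\<pi>\<in>S. odd (vord \<pi> (dmap (- \<alpha>) P))},
     lc (dmap 0 P), lc (dmap (- \<alpha>) P))" for P
  have "\<kappa> ` carrier MW \<subseteq> Pow S \<times> Pow S \<times> UNIV \<times> UNIV" by (auto simp: \<kappa>_def)
  moreover have "finite (Pow S \<times> Pow S \<times> (UNIV :: 'k set) \<times> (UNIV :: 'k set))"
    using \<open>finite S\<close> by (intro finite_cartesian_product) auto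
  ultimately have fin: "finite (\<kappa> ` carrier MW)" using finite_subset by blast
  define rep where "rep z = (SOME P. P \<in> carrier MW \<and> \<kappa> P = z)" for z
  have rep: "rep (\<kappa> P) \<in> carrier MW \<and> \<kappa> (rep (\<kappa> P)) = \<kappa> P" if "P \<in> carrier MW" for P
    unfolding rep_def by (rule someI[of "\<lambda>Q. Q \<in> carrier MW \<and> \<kappa> Q = \<kappa> P" P]) (use that in blast)
  define R where "R = rep ` \<kappa> ` carrier MW"
  have R: "finite R" "R \<subseteq> carrier MW"
    unfolding R_def using fin by (rule finite_imageI) (use rep in \<open>intro image_subsetI; blast\<close>)
  have half: "\<exists>r\<in>R. \<exists>Q\<in>carrier MW. P = r \<otimes>\<^bsub>MW\<^esub> (Q \<otimes>\<^bsub>MW\<^esub> Q)" if P: "P \<in> carrier MW" for P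
  proof -
    define r where "r = rep (\<kappa> P)"
    have r: "r \<in> R" "onE r" "\<kappa> r = \<kappa> P" and P': "onE P"
      using rep[OF P] P by (auto simp: r_def R_def)
    define P0 where "P0 = pneg r \<oplus>\<^sub>E P"
    have on0: "onE P0" using r P' by (simp add: P0_def point_add_closed)
    have sq: "is_sq (dmap c P0)" if c: "c = 0 \<or> c = - \<alpha>" for c
    proof -
      have root: "is_root c" using c by (auto simp: is_root_def)
      have nzd: "dmap c Q \<noteq> 0" for Q by (rule dmap_nz[OF root])
      have "is_sq (dmap c r * dmap c P * dmap c P0)"
        using dmap_add[OF root, of "pneg r" P] r P' by (simp add: P0_def)
      then obtain g where g: "dmap c r * dmap c P * dmap c P0 = g^2" by (auto simp: is_sq_def)
      have g0: "g \<noteq> 0" using g nzd by auto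
      show ?thesis
      proof (rule fract_square_criterion[OF nzd])
        fix \<pi> :: "'k poly" assume pi: "prime_elem \<pi>"
        show "even (vord \<pi> (dmap c P0))"
        proof (cases "\<pi> \<in> S")
          case False
          hence "\<not> \<pi> dvd \<Delta>" using pi dvd_imp_degree_le D0 by (auto simp: S_def)
          hence "\<not> \<pi> dvd a0" "\<not> \<pi> dvd b0" "\<not> \<pi> dvd b0 - a0" unfolding \<Delta>_def by (auto intro: dvd_mult dvd_mult2)
          thus ?thesis using even_vord_dmap_0[OF pi] even_vord_dmap_\<alpha>[OF pi] on0 c by blast
        next
          case True
          have "even (vord \<pi> (dmap c r)) = even (vord \<pi> (dmap c P))"
            using r(3) True c unfolding \<kappa>_def by blast
          moreover have "vord \<pi> (dmap c r) + vord \<pi> (dmap c P) + vord \<pi> (dmap c P0) = 2 * vord \<pi> g"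
            using arg_cong[OF g, of "vord \<pi>"] nzd g0 by (simp add: vord_mult[OF pi] vord_square_even[OF pi])
          ultimately show ?thesis by presburger
        qed
      next
        have "lc (dmap c r) = lc (dmap c P)" using r(3) c unfolding \<kappa>_def by blast
        moreover have "lc (dmap c r) * lc (dmap c P) * lc (dmap c P0) = (lc g)^2"
          using arg_cong[OF g, of lc] nzd g0 by (simp add: lc_mult lc_minus_one_square)
        ultimately have "lc (dmap c P0) = (lc g / lc (dmap c P))^2"
          using lc_nz[OF nzd] by (simp add: field_simps power2_eq_square)
        thus "is_sq (lc (dmap c P0))" by simp
      qed
    qed
    obtain Q where Q: "onE Q" "P0 = Q \<oplus>\<^sub>E Q" using halving[OF on0 sq sq] by auto
    have "r \<oplus>\<^sub>E P0 = P" using neg_add_cancel[of "pneg r" P] r P' by (simp add: P0_def)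
    thus ?thesis using Q r(1) by (intro bexI[of _ r] bexI[of _ Q]) auto
  qed
  have "card T \<le> card R" if T: "Z_independent MW T" for T
    using T R multiple_in_span[OF R half]
    by (intro G.independent_card_le) (auto simp: Z_independent_iff simp del: MW_simps)
  thus ?thesis unfolding bounded_rank_def by blast
qed

end

text \<open>Distinct monic primes are not associated, so the product of any finite set of them still
  divides g.\<close>

lemma prime_set_card_le:
  fixes g :: "'k::field poly"
  assumes "g \<noteq> 0"
  shows "finite {\<pi>. prime_elem \<pi> \<and> lead_coeff \<pi> = 1 \<and> \<pi> dvd g}"
    "card {\<pi>. prime_elem \<pi> \<and> lead_coeff \<pi> = 1 \<and> \<pi> dvd g} \<le> degree g"
proof -
  let ?I = "{\<pi>. prime_elem \<pi> \<and> lead_coeff \<pi> = 1 \<and> \<pi> dvd g}"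
  have deg: "degree \<pi> \<ge> 1" if "prime_elem \<pi>" for \<pi> :: "'k poly"
    using that by (metis One_nat_def Suc_leI gr0I poly_is_unit prime_elem_def)
  have eq: "\<pi> = \<rho>" if "\<pi> \<in> ?I" "\<rho> \<in> ?I" "\<pi> dvd \<rho>" for \<pi> \<rho>
  proof -
    obtain c where c: "\<rho> = \<pi> * c" using \<open>\<pi> dvd \<rho>\<close> by (elim dvdE)
    have "irreducible \<rho>" using that by (simp add: prime_elem_imp_irreducible)
    hence "is_unit c" using c that by (metis (mono_tags, lifting) irreducibleD mem_Collect_eq prime_elem_def)
    then obtain k where k: "c = [:k:]" using poly_is_unit degree_eq_zeroE by blast
    have "lead_coeff \<rho> = lead_coeff \<pi> * k" unfolding c k by (simp add: lead_coeff_mult)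
    moreover have "lead_coeff \<rho> = 1" "lead_coeff \<pi> = 1" using that by simp_all
    ultimately have "k = 1" by simp
    thus ?thesis using c k by simp
  qed
  have prod: "\<Prod>I dvd g" if "finite I" "I \<subseteq> ?I" for I
    using that
  proof (induction I)
    case (insert \<pi> I)
    then obtain h where h: "g = \<Prod>I * h" by (auto elim: dvdE)
    have pi: "prime_elem \<pi>" "\<pi> \<in> ?I" using insert by auto
    have "\<not> \<pi> dvd \<Prod>I"
    proof
      assume "\<pi> dvd \<Prod>I"
      moreover have "\<pi> dvd \<Prod>J \<Longrightarrow> \<exists>\<rho>\<in>J. \<pi> dvd \<rho>" if "finite J" for J
        using that
      proof (induction J)
        case empty thus ?case using pi(1) by (simp add: prime_elem_def)
      next
        case (insert x J)
        hence "\<pi> dvd x \<or> \<pi> dvd \<Prod>J" by (simp add: prime_elem_dvd_mult_iff[OF pi(1)])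
        thus ?case using insert by blast
      qed
      ultimately obtain \<rho> where "\<rho> \<in> I" "\<pi> dvd \<rho>" using insert(1) by blast
      thus False using eq[OF pi(2), of \<rho>] insert by auto
    qed
    hence "\<pi> dvd h" using pi h by (metis (mono_tags, lifting) mem_Collect_eq prime_elem_dvd_multD)
    thus ?case using insert h by (auto simp: mult.commute[of \<pi>] intro: mult_dvd_mono)
  qed simp
  have bound: "card I \<le> degree g" if I: "finite I" "I \<subseteq> ?I" for I
  proof -
    have "card I \<le> (\<Sum>\<pi>\<in>I. degree \<pi>)" using I deg sum_mono[of I "\<lambda>_. 1" degree] by auto
    also have "\<dots> = degree (\<Prod>I)"
    proof (rule degree_prod_eq_sum_degree[symmetric, of I "\<lambda>x. x"])
      show "\<forall>i\<in>I. i \<noteq> 0" using I by auto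
    qed
    also have "\<dots> \<le> degree g" using prod[OF I] assms dvd_imp_degree_le by blast
    finally show ?thesis .
  qed
  show fin: "finite ?I"
  proof (rule ccontr)
    assume "infinite ?I"
    from infinite_arbitrarily_large[OF this, of "Suc (degree g)"]
    obtain J where J: "finite J" "card J = Suc (degree g)" "J \<subseteq> ?I" by (elim exE conjE)
    show False using bound[OF J(1,3)] J(2) by linarith
  qed
  show "card ?I \<le> degree g" using bound[OF fin] by simp
qed

section \<open>2-descent on the twist\<close>

abbreviation Xp :: "'k::field poly" where "Xp \<equiv> [:0, 1:]"

lemma degree_Xp_power: "degree ((Xp :: 'k::field poly) ^ n) = n"
  by (simp add: degree_power_eq)

lemma prime_elem_linear: "prime_elem [:c, 1 :: 'k::field:]"
proof (rule field_poly_irreducible_imp_prime, rule irreducibleI)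
  show "[:c, 1:] \<noteq> 0" "\<not> is_unit [:c, 1:]" by (auto simp: poly_is_unit)
  fix a b assume "[:c, 1:] = a * b"
  moreover from this have "a \<noteq> 0" "b \<noteq> 0" by auto
  ultimately have "degree a + degree b = 1" by (metis One_nat_def degree_mult_eq degree_pCons_eq_if one_neq_zero degree_1 one_pCons)
  thus "is_unit a \<or> is_unit b" using \<open>a \<noteq> 0\<close> \<open>b \<noteq> 0\<close> by (auto simp: poly_is_unit)
qed

text \<open>For \<open>v = u^2\<close> and \<open>t = v^e\<close>, this is the twist by \<open>v\<close> of the Legendre curve over \<open>k(v)\<close>.
  Only primes dividing \<open>\<alpha> - \<beta> = v * (1 - v^e)\<close> and the place at infinity matter for its 2-descent.\<close>

locale twisted_curve = function_field_curve a0 b0 for a0 b0 :: "'k::{field,finite} poly" +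
  fixes e :: nat
  assumes e: "even e" "e > 0" and a0: "a0 = Xp" and b0: "b0 = Xp ^ Suc e"
begin

lemma vdegs: "vdeg \<alpha> = 1" "vdeg \<beta> = 1 + int e" "vdeg (\<alpha> - \<beta>) = 1 + int e"
proof -
  show a: "vdeg \<alpha> = 1" by (simp add: vdeg_Fract a0)
  show b: "vdeg \<beta> = 1 + int e" using degree_Xp_power[of "Suc e", where 'k = 'k] vdeg_Fract[of b0 1] ab
    by (simp add: b0 del: power_Suc)
  have "vdeg (- \<beta> + \<alpha>) = vdeg (- \<beta>)"
    using a b e nz by (intro vdeg_lc_add_less) (simp_all add: vdeg_minus)
  thus "vdeg (\<alpha> - \<beta>) = 1 + int e" using b by (simp add: vdeg_minus)
qed

text \<open>The parities at infinity of the two descent maps.\<close>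

definition "\<chi>0 P \<longleftrightarrow> odd (vdeg (dmap 0 P))"
definition "\<chi>1 P \<longleftrightarrow> odd (vdeg (dmap (- \<alpha>) P))"

lemma \<chi>_hom: "parity_hom MW \<chi>0" "parity_hom MW \<chi>1"
  using parity_vdeg[OF roots(1)] parity_vdeg[OF roots(2)] by (simp_all add: \<chi>0_def[abs_def] \<chi>1_def[abs_def])

text \<open>Since e is even, \<alpha>, \<beta> and \<alpha> - \<beta> all have odd degree, and
  products of two of them have even degree. All four values of the pair of parities thus occur on
  the 2-torsion.\<close>

lemma torsion_parity:
  "\<not> \<chi>0 (Affine 0 0)" "\<chi>1 (Affine 0 0)" "\<chi>0 (Affine (- \<alpha>) 0)" "\<not> \<chi>1 (Affine (- \<alpha>) 0)"
  "\<chi>0 (Affine (- \<beta>) 0)" "\<chi>1 (Affine (- \<beta>) 0)"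
  using e nz vdegs vdeg_mult[OF nz(1,2)] vdeg_mult[of \<alpha> "\<alpha> - \<beta>"]
  by (auto simp: \<chi>0_def \<chi>1_def fder_values vdeg_minus)

definition Iset :: "'k poly set" where
  "Iset = {\<pi>. prime_elem \<pi> \<and> lead_coeff \<pi> = 1 \<and> \<pi> dvd Xp ^ e - 1}"

lemma Iset: "finite Iset" "card Iset \<le> e"
proof -
  have d: "degree (Xp ^ e - 1 :: 'k poly) = e"
    using e degree_Xp_power[of e, where 'k = 'k] degree_add_eq_left[of "-1" "Xp ^ e :: 'k poly"] by simp
  hence "Xp ^ e - 1 \<noteq> (0 :: 'k poly)" using e by auto
  from prime_set_card_le[OF this] d show "finite Iset" "card Iset \<le> e" by (simp_all add: Iset_def)
qed

lemma normalize_prime: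
  assumes pi: "prime_elem \<pi>"
  obtains \<rho> :: "'k poly" where "prime_elem \<rho>" "lead_coeff \<rho> = 1" "\<And>f. \<rho> dvd f \<longleftrightarrow> \<pi> dvd f" "\<And>x. vord \<rho> x = vord \<pi> x"
proof -
  define \<rho> where "\<rho> = smult (inverse (lead_coeff \<pi>)) \<pi>"
  have l0: "lead_coeff \<pi> \<noteq> 0" using pi by auto
  have dv: "\<rho> dvd f \<longleftrightarrow> \<pi> dvd f" for f using l0 by (simp add: \<rho>_def smult_dvd_iff)
  have eq: "\<rho> = [:inverse (lead_coeff \<pi>):] * \<pi>" by (simp add: \<rho>_def)
  have "is_unit [:inverse (lead_coeff \<pi>):]" using l0 by (simp add: poly_is_unit)
  hence pr: "prime_elem \<rho>" unfolding eq using pi prime_elem_mult_unit_left by blast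
  have "\<rho> ^ n dvd f \<longleftrightarrow> \<pi> ^ n dvd f" for n f using l0 by (simp add: \<rho>_def smult_power smult_dvd_iff)
  hence "pmult \<rho> = pmult \<pi>" by (intro ext) (simp add: pmult_def)
  hence "vord \<rho> x = vord \<pi> x" for x by (simp add: vord_def)
  thus ?thesis using that pr dv l0 by (simp add: \<rho>_def)
qed

text \<open>A prime other than v can be bad only for the descent at -\<alpha>, and then lies in
  \<open>Iset\<close>. Parity at v follows from the even degree because v itself has degree 1.
  Leading coefficients are squares because x dominates \<alpha> and \<beta> at infinity, so the cube
  of \<open>lc x\<close> is the square of \<open>lc y\<close>.\<close>

lemma halve:
  assumes P: "onE P" and \<chi>: "\<not> \<chi>0 P" "\<not> \<chi>1 P"
    and ev: "\<And>\<pi>. \<pi> \<in> Iset \<Longrightarrow> even (vord \<pi> (dmap (- \<alpha>) P))"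
  shows "\<exists>Q. onE Q \<and> P = Q \<oplus>\<^sub>E Q"
proof -
  have Xprime: "prime_elem (Xp :: 'k poly)" by (rule prime_elem_linear)
  note X1 = a0[symmetric]
  have assoc: "\<rho> = Xp" if "prime_elem \<rho>" "lead_coeff \<rho> = 1" "\<rho> dvd Xp" for \<rho> :: "'k poly"
  proof -
    obtain c where c: "Xp = \<rho> * c" using \<open>\<rho> dvd Xp\<close> by (elim dvdE)
    have "is_unit c" using Xprime c that(1) by (metis irreducibleD prime_elem_imp_irreducible prime_elem_def)
    then obtain k where k: "c = [:k:]" using poly_is_unit degree_eq_zeroE by blast
    have "lead_coeff (Xp :: 'k poly) = lead_coeff \<rho> * k" unfolding c k by (simp add: lead_coeff_mult)
    hence "k = 1" using that(2) by simp
    thus ?thesis using c k by simp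
  qed
  have all_even: "even (vord \<pi> z)"
    if z: "z \<noteq> 0" "even (vdeg z)" and off: "\<And>\<rho>. prime_elem \<rho> \<Longrightarrow> lead_coeff \<rho> = 1 \<Longrightarrow> \<rho> \<noteq> Xp \<Longrightarrow> even (vord \<rho> z)"
      and pi: "prime_elem \<pi>" for z :: "'k poly fract" and \<pi>
  proof -
    \<comment> \<open>If the order at v were odd, \<alpha> z would have even order everywhere but
      odd degree.\<close>
    have evX: "even (vord Xp z)"
    proof (rule ccontr)
      assume odd: "odd (vord Xp z)"
      have "even (vord \<rho> (\<alpha> * z))" if rho: "prime_elem \<rho>" for \<rho>
      proof -
        obtain \<rho>' :: "'k poly" where r: "prime_elem \<rho>'" "lead_coeff \<rho>' = 1" "\<And>f. \<rho>' dvd f \<longleftrightarrow> \<rho> dvd f" "\<And>x. vord \<rho>' x = vord \<rho> x"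
          using normalize_prime[OF rho] by blast
        have m: "vord \<rho>' (\<alpha> * z) = vord \<rho>' \<alpha> + vord \<rho>' z" by (rule vord_mult[OF r(1) nz(1) z(1)])
        show ?thesis
        proof (cases "\<rho>' = Xp")
          case True
          have "pmult Xp (Xp :: 'k poly) = 1"
            by (rule pmult_eqI[OF Xprime, of _ _ 1]) (use Xprime in \<open>auto simp: prime_elem_def\<close>)
          moreover have "pmult Xp (1 :: 'k poly) = 0"
            by (rule pmult_eq_0[OF Xprime]) (use Xprime in \<open>auto simp: prime_elem_def\<close>)
          ultimately have "vord Xp \<alpha> = 1" by (simp add: vord_Fract[OF Xprime] a0)
          thus ?thesis using m odd True r(4) by (metis even_add odd_one)
        next
          case False
          hence "\<not> \<rho>' dvd a0" using assoc r a0 by blast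
          hence "vord \<rho>' \<alpha> = 0" by (rule vord_unit[OF r(1)])
          thus ?thesis using m off[OF r(1,2) False] r(4) by (metis add_0)
        qed
      qed
      hence "even (vdeg (\<alpha> * z))" using all_even_square[of "\<alpha> * z"] nz z by (metis mult_eq_0_iff)
      thus False using vdeg_mult[OF nz(1) z(1)] vdegs z(2) by (simp )
    qed
    obtain \<rho> :: "'k poly" where r: "prime_elem \<rho>" "lead_coeff \<rho> = 1" "\<And>f. \<rho> dvd f \<longleftrightarrow> \<pi> dvd f" "\<And>x. vord \<rho> x = vord \<pi> x"
      using normalize_prime[OF pi] by blast
    show ?thesis using r evX off by (cases "\<rho> = Xp") metis+
  qed
  have notX: "\<not> \<rho> dvd a0" "\<not> \<rho> dvd b0" if "prime_elem \<rho>" "lead_coeff \<rho> = 1" "\<rho> \<noteq> Xp" for \<rho> :: "'k poly"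
    using assoc[OF that(1,2)] that(3) prime_elem_dvd_power[OF that(1)] unfolding a0 b0 by blast+
  have even0: "even (vord \<pi> (dmap 0 P))" if "prime_elem \<pi>" for \<pi>
    by (rule all_even[OF dmap_nz[OF roots(1)] _ _ that])
       (use \<chi> notX even_vord_dmap_0 P in \<open>auto simp: \<chi>0_def\<close>)
  have even1: "even (vord \<pi> (dmap (- \<alpha>) P))" if "prime_elem \<pi>" for \<pi>
  proof (rule all_even[OF dmap_nz[OF roots(2)] _ _ that])
    show "even (vdeg (dmap (- \<alpha>) P))" using \<chi> by (simp add: \<chi>1_def)
    fix \<rho> :: "'k poly" assume r: "prime_elem \<rho>" "lead_coeff \<rho> = 1" "\<rho> \<noteq> Xp"
    show "even (vord \<rho> (dmap (- \<alpha>) P))"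
    proof (cases "\<rho> \<in> Iset")
      case False
      hence n: "\<not> \<rho> dvd Xp ^ e - 1" using r by (simp add: Iset_def)
      have "b0 - a0 = a0 * (Xp ^ e - 1)" unfolding a0 b0 power_Suc by (simp only: right_diff_distrib mult_1_right)
      hence "\<not> \<rho> dvd b0 - a0" using n notX[OF r] r(1) by (simp only: prime_elem_dvd_mult_iff) simp
      thus ?thesis using even_vord_dmap_\<alpha>[OF r(1) notX(1)[OF r]] P by blast
    qed (use ev in auto)
  qed
  have "is_sq (lc (dmap 0 P)) \<and> is_sq (lc (dmap (- \<alpha>) P))"
  proof (cases P)
    case Infinity
    have "lc (1 :: 'k poly fract) = 1" by (simp add: One_fract_def lc_Fract)
    thus ?thesis using Infinity is_sq_square(1)[of "1 :: 'k"] by simp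
  next
    case (Affine x y)
    have y0: "y \<noteq> 0"
    proof
      assume "y = 0"
      hence "is_root x" using P Affine onE_y0 by simp
      thus False using \<open>y = 0\<close> Affine \<chi> torsion_parity unfolding is_root_def by auto
    qed
    have eq: "x * (x + \<alpha>) * (x + \<beta>) = y^2" using P Affine onE by simp
    hence x0: "x \<noteq> 0" "x + \<alpha> \<noteq> 0" "x + \<beta> \<noteq> 0" using y0 by auto
    have dm: "dmap 0 P = x" "dmap (- \<alpha>) P = x + \<alpha>" using Affine x0 by (auto simp: eq_neg_iff_add_eq_0)
    have ev: "even (vdeg x)" "even (vdeg (x + \<alpha>))" using \<chi> unfolding \<chi>0_def \<chi>1_def dm by simp_all
    have "vdeg (y^2) = 2 * vdeg y" using vdeg_mult[OF y0 y0] by (simp add: power2_eq_square)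
    hence sum: "vdeg x + vdeg (x + \<alpha>) + vdeg (x + \<beta>) = 2 * vdeg y"
      using arg_cong[OF eq, of vdeg] x0 by (simp add: vdeg_mult)
    \<comment> \<open>Degree below 1 would give x + \<alpha> degree 1, and degree strictly between 1
      and e + 1 would give the right-hand side the odd degree 2 deg x + e + 1. The values 1 and e +
      1 are themselves odd.\<close>
    have "\<not> vdeg x < 1"
    proof
      assume "vdeg x < 1"
      hence "vdeg (\<alpha> + x) = 1" using vdeg_lc_add_less(2)[OF nz(1) x0(1)] vdegs by simp
      thus False using ev by (simp add: add.commute)
    qed
    hence gt: "vdeg \<alpha> < vdeg x" using ev(1) vdegs by (smt (verit) odd_one)
    have a: "vdeg (x + \<alpha>) = vdeg x" "lc (x + \<alpha>) = lc x"
      using vdeg_lc_add_less[OF x0(1) nz(1) gt] by auto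
    have "\<not> vdeg x < vdeg \<beta>"
    proof
      assume "vdeg x < vdeg \<beta>"
      hence "vdeg (\<beta> + x) = vdeg \<beta>" using vdeg_lc_add_less(2)[OF nz(2) x0(1)] by simp
      hence "2 * vdeg x + (1 + int e) = 2 * vdeg y" using sum a vdegs by (simp add: add.commute)
      thus False using e by presburger
    qed
    moreover have "vdeg x \<noteq> vdeg \<beta>" using ev(1) vdegs e by auto
    ultimately have gt: "vdeg \<beta> < vdeg x" by simp
    have b: "lc (x + \<beta>) = lc x" using vdeg_lc_add_less[OF x0(1) nz(2) gt] by auto
    have "lc x * lc x * lc x = (lc y)^2"
      using arg_cong[OF eq, of lc] x0 y0 a b by (simp add: lc_mult lc_minus_one_square)
    hence "lc x = (lc y / lc x)^2" using lc_nz[OF x0(1)] by (simp add: field_simps power2_eq_square)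
    hence "is_sq (lc x)" unfolding is_sq_def by blast
    thus ?thesis by (simp add: dm a)
  qed
  thus ?thesis
    using halving[OF P] fract_square_criterion[OF dmap_nz[OF roots(1)] even0] fract_square_criterion[OF dmap_nz[OF roots(2)] even1]
    by blast
qed

text \<open>Every point is r + t + 2Q, with t of order at most 2 and r in the span of at most e
  elements of H. The height argument puts a multiple of each point in the span of the r + t, and
  doubling once more removes t.\<close>

lemma rank_upper: "Z_independent MW S \<Longrightarrow> card S \<le> e"
proof -
  assume S: "Z_independent MW S"
  interpret G: comm_group MW by (rule comm_group_MW)
  define H where "H = {P \<in> carrier MW. \<not> \<chi>0 P \<and> \<not> \<chi>1 P}"
  have H: "subgroup H MW"
  proof
    show "H \<subseteq> carrier MW" by (auto simp: H_def)
  next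
    fix x y assume "x \<in> H" "y \<in> H"
    thus "x \<otimes>\<^bsub>MW\<^esub> y \<in> H"
      using G.parity_mult[OF \<chi>_hom(1), of x y] G.parity_mult[OF \<chi>_hom(2), of x y] G.m_closed[of x y] unfolding H_def by blast
  next
    show "\<one>\<^bsub>MW\<^esub> \<in> H" using G.parity_one[OF \<chi>_hom(1)] G.parity_one[OF \<chi>_hom(2)] G.one_closed unfolding H_def by blast
  next
    fix x assume "x \<in> H"
    thus "inv\<^bsub>MW\<^esub> x \<in> H"
      using G.parity_inv[OF \<chi>_hom(1), of x] G.parity_inv[OF \<chi>_hom(2), of x] G.inv_closed[of x] unfolding H_def by blast
  qed
  define \<epsilon> where "\<epsilon> \<pi> P \<longleftrightarrow> odd (vord \<pi> (dmap (- \<alpha>) P))" for \<pi> P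
  have eps: "parity_hom MW (\<epsilon> \<pi>)" if "\<pi> \<in> Iset" for \<pi>
    using parity_vord[OF roots(2), of \<pi>] that by (simp add: \<epsilon>_def[abs_def] Iset_def)
  have "\<exists>B R. finite B \<and> B \<subseteq> H \<and> card B \<le> card Iset \<and> finite R \<and> R \<subseteq> H \<inter> Zspan MW B \<and>
           (\<forall>P\<in>H. \<exists>r\<in>R. \<forall>i\<in>Iset. \<not> \<epsilon> i (P \<otimes>\<^bsub>MW\<^esub> inv\<^bsub>MW\<^esub> r))"
    by (rule G.parity_reps[OF Iset(1) eps H])
  then obtain B R where BR: "finite B" "B \<subseteq> H" "card B \<le> card Iset" "finite R" "R \<subseteq> H \<inter> Zspan MW B"
    and cover: "\<forall>P\<in>H. \<exists>r\<in>R. \<forall>i\<in>Iset. \<not> \<epsilon> i (P \<otimes>\<^bsub>MW\<^esub> inv\<^bsub>MW\<^esub> r)"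
    by (elim exE conjE)
  have BG: "B \<subseteq> carrier MW" "R \<subseteq> carrier MW" using BR by (auto simp: H_def)
  define T where "T = {Infinity, Affine 0 0, Affine (- \<alpha>) 0, Affine (- \<beta>) 0}"
  have T: "finite T" "t \<oplus>\<^sub>E t = Infinity" "t \<in> carrier MW" "pneg t = t" if "t \<in> T" for t
  proof -
    show p: "pneg t = t" using that by (auto simp: T_def)
    show "finite T" by (simp add: T_def)
    show "t \<oplus>\<^sub>E t = Infinity" using add_opp[of t] p by simp
    show "t \<in> carrier MW" using that roots by (auto simp: T_def on_root)
  qed
  define R' where "R' = (\<lambda>(r, t). r \<oplus>\<^sub>E t) ` (R \<times> T)"
  have R': "finite R'" "R' \<subseteq> carrier MW"
  proof -
    show "finite R'" using BR by (simp add: R'_def T_def)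
    show "R' \<subseteq> carrier MW" using BG T by (fastforce simp: R'_def intro: point_add_closed)
  qed
  have half: "\<exists>r\<in>R'. \<exists>Q\<in>carrier MW. P = r \<otimes>\<^bsub>MW\<^esub> (Q \<otimes>\<^bsub>MW\<^esub> Q)" if P: "P \<in> carrier MW" for P
  proof -
    \<comment> \<open>Translation by t moves P into H, the common kernel of the parities at
      infinity.\<close>
    have "\<exists>t\<in>T. \<chi>0 t = \<chi>0 P \<and> \<chi>1 t = \<chi>1 P"
    proof -
      have "\<not> \<chi>0 Infinity" "\<not> \<chi>1 Infinity" using G.parity_one[OF \<chi>_hom(1)] G.parity_one[OF \<chi>_hom(2)] by simp_all
      thus ?thesis using torsion_parity by (cases "\<chi>0 P"; cases "\<chi>1 P") (auto simp: T_def)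
    qed
    then obtain t where t: "t \<in> T" "\<chi>0 t = \<chi>0 P" "\<chi>1 t = \<chi>1 P" by blast
    have tG: "t \<in> carrier MW" using T t by blast
    define P1 where "P1 = P \<otimes>\<^bsub>MW\<^esub> t"
    have P1: "P1 \<in> H"
      using G.parity_mult[OF \<chi>_hom(1) P tG] G.parity_mult[OF \<chi>_hom(2) P tG] t G.m_closed[OF P tG]
      unfolding H_def P1_def by blast
    obtain r where r: "r \<in> R" "\<forall>i\<in>Iset. \<not> \<epsilon> i (P1 \<otimes>\<^bsub>MW\<^esub> inv\<^bsub>MW\<^esub> r)" using cover P1 by meson
    have rH: "r \<in> H" "r \<in> carrier MW" using r BR BG by auto
    define P2 where "P2 = P1 \<otimes>\<^bsub>MW\<^esub> inv\<^bsub>MW\<^esub> r"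
    have P2: "P2 \<in> H" using subgroup.m_closed[OF H P1 subgroup.m_inv_closed[OF H rH(1)]] by (simp add: P2_def)
    have "\<exists>Q. onE Q \<and> P2 = Q \<oplus>\<^sub>E Q"
    proof (rule halve)
      show "onE P2" "\<not> \<chi>0 P2" "\<not> \<chi>1 P2" using P2 by (simp_all add: H_def)
      show "even (vord \<pi> (dmap (- \<alpha>) P2))" if "\<pi> \<in> Iset" for \<pi> using r(2) that by (simp add: \<epsilon>_def P2_def)
    qed
    then obtain Q where Q: "Q \<in> carrier MW" "P2 = Q \<otimes>\<^bsub>MW\<^esub> Q" by auto
    have P1G: "P1 \<in> carrier MW" using P1 by (simp add: H_def)
    have "P1 = r \<otimes>\<^bsub>MW\<^esub> P2" unfolding P2_def using P1G rH(2)
      by (metis G.inv_closed G.m_assoc G.m_comm G.r_inv G.r_one)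
    moreover have "P = P1 \<otimes>\<^bsub>MW\<^esub> t"
    proof -
      have "t \<otimes>\<^bsub>MW\<^esub> t = \<one>\<^bsub>MW\<^esub>" using T(2)[OF t(1)] by simp
      thus ?thesis unfolding P1_def using P tG by (metis G.m_assoc G.r_one)
    qed
    ultimately have "P = (r \<otimes>\<^bsub>MW\<^esub> t) \<otimes>\<^bsub>MW\<^esub> (Q \<otimes>\<^bsub>MW\<^esub> Q)"
      using Q rH(2) tG G.m_closed[OF Q(1) Q(1)] by (metis G.m_assoc G.m_comm)
    moreover have "r \<otimes>\<^bsub>MW\<^esub> t \<in> R'" using r t by (auto simp: R'_def)
    ultimately show ?thesis using Q by blast
  qed
  have sq: "r [^]\<^bsub>MW\<^esub> (2::int) \<in> Zspan MW B" if rR': "r \<in> R'" for r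
  proof -
    obtain r0 t where rt: "r0 \<in> R" "t \<in> T" "r = r0 \<otimes>\<^bsub>MW\<^esub> t" using rR' by (auto simp: R'_def)
    have tG: "t \<in> carrier MW" and rG: "r0 \<in> carrier MW" using T rt BG by blast+
    have "t [^]\<^bsub>MW\<^esub> (2::int) = t \<otimes>\<^bsub>MW\<^esub> t" using G.int_pow_mult[OF tG, of 1 1] tG by simp
    also have "\<dots> = \<one>\<^bsub>MW\<^esub>" using T(2)[OF rt(2)] by simp
    finally have "r [^]\<^bsub>MW\<^esub> (2::int) = r0 [^]\<^bsub>MW\<^esub> (2::int)"
      using rG tG by (simp add: rt(3) G.int_pow_distrib del: MW_simps)
    thus ?thesis using rt BR G.Zspan_pow[OF BG(1)] by auto
  qed
  have "card S \<le> card B"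
  proof (rule G.independent_card_le[OF S BR(1) BG(1)])
    fix s assume "s \<in> S"
    hence s: "s \<in> carrier MW" using S by (auto simp: Z_independent_iff)
    obtain n :: int where n: "n \<noteq> 0" "s [^]\<^bsub>MW\<^esub> n \<in> Zspan MW R'" using multiple_in_span[OF R' half s] by blast
    have "(s [^]\<^bsub>MW\<^esub> n) [^]\<^bsub>MW\<^esub> (2::int) \<in> Zspan MW B"
      by (rule G.Zspan_pow_trans[OF R' BG(1) n(2) sq])
    thus "\<exists>n::int. n \<noteq> 0 \<and> s [^]\<^bsub>MW\<^esub> n \<in> Zspan MW B"
      using n s by (intro exI[of _ "n * 2"]) (simp add: G.int_pow_pow del: MW_simps)
  qed
  thus ?thesis using BR(3) Iset(2) by simp
qed

end

section \<open>Splitting off the twist\<close>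

text \<open>Substitutions, extension of constants and Frobenius are all instances;
  \<open>map_point\<close> lets them act on points.\<close>

locale field_hom =
  fixes j :: "'a::field \<Rightarrow> 'b::field"
  assumes hom_add: "j (x + y) = j x + j y" and hom_mult: "j (x * y) = j x * j y" and hom_1: "j 1 = 1"
begin

lemma hom_0: "j 0 = 0"
  using hom_add[of 0 0] by (metis add_0_left add_left_cancel add.right_neutral)

lemma hom_minus: "j (- x) = - j x"
  using hom_add[of x "- x"] by (simp add: hom_0 eq_neg_iff_add_eq_0 add.commute)

lemma hom_diff: "j (x - y) = j x - j y"
  using hom_add[of x "- y"] by (simp add: hom_minus)

lemma hom_eq_0: "j x = 0 \<longleftrightarrow> x = 0"
proof
  assume "j x = 0"
  show "x = 0"
  proof (rule ccontr)
    assume "x \<noteq> 0"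
    hence "j x * j (inverse x) = 1" by (simp add: hom_1 flip: hom_mult)
    thus False using \<open>j x = 0\<close> by simp
  qed
qed (simp add: hom_0)

lemma hom_eq: "j x = j y \<longleftrightarrow> x = y"
  using hom_eq_0[of "x - y"] by (simp add: hom_diff)

lemma hom_divide: "j (x / y) = j x / j y"
proof (cases "y = 0")
  case False
  hence "j (x / y) * j y = j x" by (simp flip: hom_mult)
  thus ?thesis using False by (simp add: nonzero_eq_divide_eq hom_eq_0)
qed (simp add: hom_0)

lemma hom_power: "j (x ^ n) = j x ^ n"
  by (induction n) (simp_all add: hom_1 hom_mult)

lemma hom_numeral: "j (numeral k) = numeral k"
proof -
  have "j (of_nat n) = of_nat n" for n by (induction n) (simp_all add: hom_0 hom_1 hom_add)
  from this[of "numeral k"] show ?thesis by simp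
qed

lemmas hom_simps = hom_add hom_mult hom_1 hom_0 hom_minus hom_diff hom_eq hom_divide hom_power hom_numeral

lemma on_curve_map: "on_curve (curve (j \<alpha>) (j \<beta>)) (map_point j P) \<longleftrightarrow> on_curve (curve \<alpha> \<beta>) P"
proof (cases P)
  case (Affine x y)
  have "j (y^2) = j (x * (x + \<alpha>) * (x + \<beta>)) \<longleftrightarrow> y^2 = x * (x + \<alpha>) * (x + \<beta>)" by (rule hom_eq)
  thus ?thesis by (simp add: Affine on_curve_affine hom_add hom_mult hom_power)
qed simp

text \<open>The explicit formulas are preserved, including division by 0, and injectivity reflects
  the equalities tested in the case distinction.\<close>

lemma map_point_add:
  "map_point j (point_add (curve \<alpha> \<beta>) P Q) = point_add (curve (j \<alpha>) (j \<beta>)) (map_point j P) (map_point j Q)"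
proof (cases P; cases Q)
  fix x1 y1 x2 y2 assume [simp]: "P = Affine x1 y1" "Q = Affine x2 y2"
  have "y1 + y2 = 0 \<longleftrightarrow> j y1 + j y2 = 0" by (simp add: hom_eq_0 flip: hom_add)
  thus ?thesis by (simp add: point_add.simps(3) curve_def Let_def hom_simps)
qed auto

lemma inj_map_point: "inj (map_point j)"
  by (rule point.inj_map) (simp add: inj_def hom_eq)

lemma map_point_hom:
  "map_point j \<in> hom (mordell_weil_group (curve \<alpha> \<beta>) UNIV) (mordell_weil_group (curve (j \<alpha>) (j \<beta>)) UNIV)"
  by (rule homI) (simp_all add: mordell_weil_group_def rational_points_def map_point_add on_curve_map)

end

text \<open>The condition \<open>eq_0\<close> of \<open>idom_hom\<close> is injectivity, which keeps
  denominators nonzero and makes the value independent of the representation.\<close>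

definition fmap :: "('a::idom \<Rightarrow> 'b::idom) \<Rightarrow> 'a fract \<Rightarrow> 'b fract" where
  "fmap \<phi> x = (THE z. \<exists>a b. b \<noteq> 0 \<and> x = Fract a b \<and> z = Fract (\<phi> a) (\<phi> b))"

locale idom_hom =
  fixes \<phi> :: "'a::idom \<Rightarrow> 'b::idom"
  assumes add: "\<phi> (x + y) = \<phi> x + \<phi> y" and mult: "\<phi> (x * y) = \<phi> x * \<phi> y" and one: "\<phi> 1 = 1"
    and eq_0: "\<phi> x = 0 \<Longrightarrow> x = 0"
begin

lemma fmap_Fract: "b \<noteq> 0 \<Longrightarrow> fmap \<phi> (Fract a b) = Fract (\<phi> a) (\<phi> b)"
  unfolding fmap_def
proof (rule the_equality)
  fix z assume b: "b \<noteq> 0" and "\<exists>c d. d \<noteq> 0 \<and> Fract a b = Fract c d \<and> z = Fract (\<phi> c) (\<phi> d)"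
  then obtain c d where cd: "d \<noteq> 0" "Fract a b = Fract c d" "z = Fract (\<phi> c) (\<phi> d)" by blast
  have "a * d = c * b" using b cd by (simp add: eq_fract)
  hence "\<phi> a * \<phi> d = \<phi> c * \<phi> b" by (metis mult)
  thus "z = Fract (\<phi> a) (\<phi> b)" using cd b eq_0 by (metis eq_fract(1))
qed blast

lemma field_hom_fmap: "field_hom (fmap \<phi>)"
proof
  fix x y :: "'a fract"
  obtain a b where ab: "x = Fract a b" "b \<noteq> 0" by (cases x) auto
  obtain c d where cd: "y = Fract c d" "d \<noteq> 0" by (cases y) auto
  have nz: "\<phi> b \<noteq> 0" "\<phi> d \<noteq> 0" using ab cd eq_0 by blast+
  show "fmap \<phi> (x + y) = fmap \<phi> x + fmap \<phi> y" "fmap \<phi> (x * y) = fmap \<phi> x * fmap \<phi> y"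
    using ab cd nz by (simp_all add: fmap_Fract add_fract mult_fract add mult)
  show "fmap \<phi> 1 = 1" unfolding One_fract_def by (simp add: fmap_Fract one)
qed

end

text \<open>The change of variables between curves whose coefficients differ by a square. Here c =
  1/u will undo the twist.\<close>

fun scale_point :: "'a::field \<Rightarrow> 'a point \<Rightarrow> 'a point" where
  "scale_point c Infinity = Infinity"
| "scale_point c (Affine x y) = Affine (c^2 * x) (c^3 * y)"

lemma on_curve_scale:
  assumes "c \<noteq> 0"
  shows "on_curve (curve (c^2 * \<alpha>) (c^2 * \<beta>)) (scale_point c P) \<longleftrightarrow> on_curve (curve \<alpha> \<beta>) P"
proof (cases P)
  case (Affine x y)
  have "(c^3 * y)^2 = c^2 * x * (c^2 * x + c^2 * \<alpha>) * (c^2 * x + c^2 * \<beta>) \<longleftrightarrow>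
     c^6 * y^2 = c^6 * (x * (x + \<alpha>) * (x + \<beta>))"
  proof -
    have "(c^3 * y)^2 = c^6 * y^2" by Groebner_Basis.algebra
    moreover have "c^2 * x * (c^2 * x + c^2 * \<alpha>) * (c^2 * x + c^2 * \<beta>) = c^6 * (x * (x + \<alpha>) * (x + \<beta>))" by Groebner_Basis.algebra
    ultimately show ?thesis by (simp only:)
  qed
  thus ?thesis using assms by (simp add: Affine on_curve_affine)
qed simp

lemma scale_point_add:
  assumes c: "c \<noteq> (0 :: 'a::field)"
  shows "scale_point c (point_add (curve \<alpha> \<beta>) P Q) =
    point_add (curve (c^2 * \<alpha>) (c^2 * \<beta>)) (scale_point c P) (scale_point c Q)"
proof (cases "P = Infinity \<or> Q = Infinity")
  case True
  thus ?thesis by (cases P; cases Q) auto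
next
  case False
  then obtain x1 y1 x2 y2 where PQ: "P = Affine x1 y1" "Q = Affine x2 y2" by (meson point.exhaust)
  have e1: "c^2 * x1 = c^2 * x2 \<longleftrightarrow> x1 = x2" using c by simp
  have e2: "c^3 * y1 + c^3 * y2 = 0 \<longleftrightarrow> y1 + y2 = 0" using c by (simp flip: distrib_left)
  define l where "l = (if x1 = x2 then (3 * x1^2 + 2 * (\<alpha> + \<beta>) * x1 + \<alpha> * \<beta>) / (2 * y1) else (y2 - y1) / (x2 - x1))"
  have "(if c^2 * x1 = c^2 * x2 then (3 * (c^2 * x1)^2 + 2 * (c^2 * \<alpha> + c^2 * \<beta>) * (c^2 * x1) + (c^2 * \<alpha>) * (c^2 * \<beta>)) / (2 * (c^3 * y1))
     else (c^3 * y2 - c^3 * y1) / (c^2 * x2 - c^2 * x1)) = c * l"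
  proof (cases "x1 = x2")
    case True
    have "3 * (c^2 * x1)^2 + 2 * (c^2 * \<alpha> + c^2 * \<beta>) * (c^2 * x1) + (c^2 * \<alpha>) * (c^2 * \<beta>) =
       c^3 * (c * (3 * x1^2 + 2 * (\<alpha> + \<beta>) * x1 + \<alpha> * \<beta>))" by Groebner_Basis.algebra
    moreover have "2 * (c^3 * y1) = c^3 * (2 * y1)" by Groebner_Basis.algebra
    ultimately show ?thesis using True c by (simp add: l_def)
  next
    case False
    have "c^3 * y2 - c^3 * y1 = c^2 * (c * (y2 - y1))" "c^2 * x2 - c^2 * x1 = c^2 * (x2 - x1)" by Groebner_Basis.algebra+
    thus ?thesis using False c by (simp add: l_def)
  qed
  note l' = this
  have "point_add (curve \<alpha> \<beta>) P Q = (if x1 = x2 \<and> y1 + y2 = 0 then Infinity else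
     Affine (l^2 - (\<alpha> + \<beta>) - x1 - x2) (- l * (l^2 - (\<alpha> + \<beta>) - x1 - x2) - (y1 - l * x1)))"
    unfolding PQ by (simp add: point_add.simps(3) curve_def Let_def l_def)
  moreover have "point_add (curve (c^2 * \<alpha>) (c^2 * \<beta>)) (scale_point c P) (scale_point c Q) =
    (if x1 = x2 \<and> y1 + y2 = 0 then Infinity else
     Affine ((c * l)^2 - (c^2 * \<alpha> + c^2 * \<beta>) - c^2 * x1 - c^2 * x2)
       (- (c * l) * ((c * l)^2 - (c^2 * \<alpha> + c^2 * \<beta>) - c^2 * x1 - c^2 * x2) - (c^3 * y1 - (c * l) * (c^2 * x1))))"
    unfolding PQ scale_point.simps point_add.simps(3) l'[symmetric] using e1 e2 by (simp add: curve_def Let_def)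
  moreover have "(c * l)^2 - (c^2 * \<alpha> + c^2 * \<beta>) - c^2 * x1 - c^2 * x2 = c^2 * (l^2 - (\<alpha> + \<beta>) - x1 - x2)" by Groebner_Basis.algebra
  moreover have "- (c * l) * (c^2 * (l^2 - (\<alpha> + \<beta>) - x1 - x2)) - (c^3 * y1 - (c * l) * (c^2 * x1)) =
     c^3 * (- l * (l^2 - (\<alpha> + \<beta>) - x1 - x2) - (y1 - l * x1))" by Groebner_Basis.algebra
  ultimately show ?thesis by simp
qed

lemma inj_scale_point: "c \<noteq> 0 \<Longrightarrow> inj (scale_point c)"
proof (rule injI)
  fix P Q assume "c \<noteq> 0" "scale_point c P = scale_point c Q"
  thus "P = Q" by (cases P; cases Q) auto
qed

lemma scale_point_hom:
  "c \<noteq> 0 \<Longrightarrow> scale_point c \<in> hom (mordell_weil_group (curve \<alpha> \<beta>) UNIV) (mordell_weil_group (curve (c^2 * \<alpha>) (c^2 * \<beta>)) UNIV)"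
  by (rule homI) (simp_all add: mordell_weil_group_def rational_points_def scale_point_add on_curve_scale)

section \<open>Substitutions, their invariants and intermediate fields\<close>

lemma idom_hom_pcompose:
  assumes "degree h > 0" shows "idom_hom (\<lambda>f :: 'k::field poly. pcompose f h)"
proof
  fix f :: "'k poly" assume "pcompose f h = 0"
  thus "f = 0" using assms by (metis pcompose_eq_0)
qed (simp_all add: pcompose_add pcompose_mult pcompose_1)

text \<open>Split off the constant term and shift by m. The clause on coefficients will keep track
  of the field of constants.\<close>

lemma poly_supported_multiples:
  fixes f :: "'a::comm_ring_1 poly"
  assumes "m > 0" "\<And>i. coeff f i \<noteq> 0 \<Longrightarrow> m dvd i"
  shows "\<exists>g. f = pcompose g (monom 1 m) \<and> (\<forall>i. coeff g i \<in> range (coeff f))"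
  using assms(2)
proof (induction "degree f" arbitrary: f rule: less_induct)
  case less
  show ?case
  proof (cases "degree f = 0")
    case True
    then obtain c where c: "f = [:c:]" using degree_eq_zeroE by blast
    have "coeff [:c:] i \<in> range (coeff f)" for i unfolding c by simp
    thus ?thesis using c by (intro exI[of _ "[:c:]"]) simp
  next
    case False
    define f' where "f' = poly_shift m f"
    have cf: "coeff f' i = coeff f (i + m)" for i by (simp add: f'_def coeff_poly_shift)
    have "degree f' \<le> degree f - 1"
    proof (rule degree_le, intro allI impI)
      fix i assume "degree f - 1 < i"
      hence "degree f < i + m" using assms(1) by simp
      thus "coeff f' i = 0" by (simp add: cf coeff_eq_0)
    qed
    hence "degree f' < degree f" using False by simp
    moreover have "m dvd i" if "coeff f' i \<noteq> 0" for i
      using less.prems[of "i + m"] that by (simp add: cf)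
    ultimately obtain g where g: "f' = pcompose g (monom 1 m)" "\<And>i. coeff g i \<in> range (coeff f')"
      using less.hyps by blast
    have "f = [:coeff f 0:] + monom 1 m * f'"
    proof (rule poly_eqI)
      fix n
      consider "n = 0" | "0 < n" "n < m" | "m \<le> n" by linarith
      thus "coeff f n = coeff ([:coeff f 0:] + monom 1 m * f') n"
      proof cases
        case 2
        hence "\<not> m dvd n" by (simp add: nat_dvd_not_less)
        hence "coeff f n = 0" using less.prems by blast
        thus ?thesis using 2 by (simp add: coeff_monom_mult coeff_pCons split: nat.split)
      qed (use assms(1) in \<open>simp_all add: coeff_monom_mult coeff_pCons cf split: nat.split\<close>)
    qed
    hence "f = pcompose (pCons (coeff f 0) g) (monom 1 m)" by (simp add: pcompose_pCons g(1))
    moreover have "coeff (pCons (coeff f 0) g) i \<in> range (coeff f)" for i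
    proof (cases i)
      case (Suc n)
      obtain k where "coeff g n = coeff f' k" using g(2)[of n] by blast
      thus ?thesis using Suc cf by auto
    qed simp
    ultimately show ?thesis by blast
  qed
qed

lemma Fract_eq_coprime:
  fixes n d n' d' :: "'k::field poly"
  assumes "d \<noteq> 0" "d' \<noteq> 0" "coprime n d" "coprime n' d'" "Fract n d = Fract n' d'"
  obtains c where "c \<noteq> 0" "n' = smult c n" "d' = smult c d"
proof -
  have e: "n * d' = n' * d" using assms by (simp add: eq_fract)
  have "d dvd n * d'" using e by simp
  hence "d dvd d'" using poly_coprime_dvd_mult assms(3) coprime_commute by blast
  then obtain h where h: "d' = d * h" by (elim dvdE)
  have "d' dvd n' * d" using e by (metis dvd_triv_right)
  hence "d' dvd d" using poly_coprime_dvd_mult assms(4) coprime_commute by blast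
  hence "degree d' \<le> degree d" using assms(1) dvd_imp_degree_le by blast
  moreover have "h \<noteq> 0" using h assms(2) by auto
  ultimately have "degree h = 0" using h assms(1) by (simp add: degree_mult_eq)
  then obtain c where c: "h = [:c:]" using degree_eq_zeroE by blast
  have "d' = smult c d" using h c by simp
  moreover have "n' = smult c n"
  proof -
    have "d * n' = d * smult c n" using e h c by (simp add: mult.commute)
    thus ?thesis using assms(1) mult_left_cancel by blast
  qed
  moreover have "c \<noteq> 0" using \<open>h \<noteq> 0\<close> c by auto
  ultimately show ?thesis using that by blast
qed

lemma coeff_scale_var: "coeff (pcompose f [:0, \<eta> :: 'a::comm_ring_1:]) i = \<eta> ^ i * coeff f i"
  using coeff_pcompose_monom_linear[of f \<eta> i] by (simp add: monom_altdef)

text \<open>A rational function that is invariant under \<open>v \<mapsto> \<eta> v\<close> for enough roots of unity \<open>\<eta>\<close> has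
  numerator and denominator supported on multiples of \<open>m\<close>: they are homogeneous of the same
  degree modulo \<open>m\<close>, and this degree is \<open>0\<close> because they are not both divisible by \<open>v\<close>.\<close>

lemma invariant_support:
  fixes n d :: "'k::field poly"
  assumes "d \<noteq> 0" "coprime n d" and Z: "\<forall>\<eta>\<in>Z. \<eta> \<noteq> 0"
    and inv: "\<forall>\<eta>\<in>Z. Fract (pcompose n [:0, \<eta>:]) (pcompose d [:0, \<eta>:]) = Fract n d"
    and Zm: "\<forall>i. (\<forall>\<eta>\<in>Z. \<eta> ^ i = 1) \<longrightarrow> m dvd i"
    and i: "coeff n i \<noteq> 0 \<or> coeff d i \<noteq> 0"
  shows "m dvd i"
proof -
  have sc: "\<exists>c. (\<forall>i. \<eta> ^ i * coeff n i = c * coeff n i) \<and> (\<forall>i. \<eta> ^ i * coeff d i = c * coeff d i)" if eta: "\<eta> \<in> Z" for \<eta>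
  proof -
    have h: "idom_hom (\<lambda>f. pcompose f [:0, \<eta>:])" using Z eta by (intro idom_hom_pcompose) simp
    have "pcompose d [:0, \<eta>:] \<noteq> 0" using idom_hom.eq_0[OF h] assms(1) by blast
    moreover have "coprime (pcompose n [:0, \<eta>:]) (pcompose d [:0, \<eta>:])"
    proof -
      obtain r s where "r * n + s * d = 1" using poly_bezout[OF assms(2)] by blast
      hence "pcompose (r * n + s * d) [:0, \<eta>:] = 1" by (simp add: pcompose_1)
      hence "pcompose r [:0, \<eta>:] * pcompose n [:0, \<eta>:] + pcompose s [:0, \<eta>:] * pcompose d [:0, \<eta>:] = 1"
        by (simp add: pcompose_add pcompose_mult)
      thus ?thesis by (rule poly_coprimeI)
    qed
    ultimately obtain c where "pcompose n [:0, \<eta>:] = smult c n" "pcompose d [:0, \<eta>:] = smult c d"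
      using Fract_eq_coprime[OF assms(1) _ assms(2) _ inv[rule_format, OF eta, symmetric]] by blast
    hence "\<eta> ^ i * coeff n i = c * coeff n i" "\<eta> ^ i * coeff d i = c * coeff d i" for i
      by (metis coeff_scale_var coeff_smult)+
    thus ?thesis by blast
  qed
  have "coeff n 0 \<noteq> 0 \<or> coeff d 0 \<noteq> 0"
  proof (rule ccontr)
    assume "\<not> ?thesis"
    hence "[:0, 1:] dvd n" "[:0, 1:] dvd d" by (metis minus_zero poly_0_coeff_0 poly_eq_0_iff_dvd)+
    hence "is_unit [:0, 1 :: 'k:]" using assms(2) by (meson not_coprimeI)
    thus False by (simp add: poly_is_unit)
  qed
  hence one: "\<exists>c. c = 1 \<and> (\<forall>i. \<eta> ^ i * coeff n i = c * coeff n i) \<and> (\<forall>i. \<eta> ^ i * coeff d i = c * coeff d i)" if "\<eta> \<in> Z" for \<eta>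
    using sc[OF that] by (metis mult_cancel_right1 power_0)
  hence "\<eta> ^ i = 1" if "\<eta> \<in> Z" for \<eta> using that i by auto
  thus ?thesis using Zm by blast
qed

lemma const_fract_hom: "poly (map_poly const_fract f) (Fract h 1) = Fract (pcompose f h) (1 :: 'k::field poly)"
proof (induction f)
  case 0 thus ?case by (simp add: Zero_fract_def)
next
  case (pCons a f)
  have "const_fract (0 :: 'k) = 0" by (simp add: const_fract_def Zero_fract_def)
  thus ?case using pCons
    by (simp add: map_poly_pCons pcompose_pCons const_fract_def add_fract mult_fract)
qed

text \<open>Presents the intermediate field as the image of k(u) under u -> h, so that its elements
  can be recognised as invariants of a substitution.\<close>

lemma adjoin_eq:
  fixes h :: "'k::field poly"
  assumes h: "degree h > 0"
  shows "adjoin (Fract h 1) = range (fmap (\<lambda>f. pcompose f h))"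
proof -
  interpret idom_hom "\<lambda>f. pcompose f h" by (rule idom_hom_pcompose[OF h])
  have dv: "Fract (pcompose f h) 1 / Fract (pcompose g h) 1 = fmap (\<lambda>f. pcompose f h) (Fract f g)" if "g \<noteq> 0" for f g
    using that by (simp add: fmap_Fract)
  show ?thesis unfolding adjoin_def const_fract_hom
  proof (intro equalityI subsetI)
    fix x assume "x \<in> {Fract (pcompose f h) 1 / Fract (pcompose g h) 1 | f g. Fract (pcompose g h) 1 \<noteq> 0}"
    then obtain f g where fg: "x = Fract (pcompose f h) 1 / Fract (pcompose g h) 1" "Fract (pcompose g h) 1 \<noteq> 0" by blast
    hence "g \<noteq> 0" by (auto simp: fract_collapse)
    thus "x \<in> range (fmap (\<lambda>f. pcompose f h))" using fg dv by simp
  next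
    fix x assume "x \<in> range (fmap (\<lambda>f. pcompose f h))"
    then obtain y where y: "x = fmap (\<lambda>f. pcompose f h) y" by blast
    obtain f g where fg: "y = Fract f g" "g \<noteq> 0" by (cases y) auto
    have "pcompose g h \<noteq> 0" using fg eq_0 by blast
    thus "x \<in> {Fract (pcompose f h) 1 / Fract (pcompose g h) 1 | f g. Fract (pcompose g h) 1 \<noteq> 0}"
      using y fg dv[of g f] by (intro CollectI exI[of _ f] exI[of _ g]) (simp del: divide_fract)
  qed
qed

lemma subfield_range: "field_hom j \<Longrightarrow> subfield_set (range j)"
proof -
  assume "field_hom j"
  then interpret field_hom j .
  show ?thesis unfolding subfield_set_def
    by (auto simp flip: hom_diff hom_mult hom_divide) (metis hom_1 rangeI)
qed

lemma subgroup_bounded_rank: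
  assumes "ecurve \<alpha> \<beta>" "subfield_set K" "\<alpha> \<in> K" "\<beta> \<in> K"
    and bd: "bounded_rank (mordell_weil_group (curve \<alpha> \<beta>) UNIV)"
  shows "bounded_rank (mordell_weil_group (curve \<alpha> \<beta>) K)"
proof -
  interpret ecurve \<alpha> \<beta> by fact
  let ?G = "mordell_weil_group (curve \<alpha> \<beta>) K"
  have G: "comm_group ?G" "comm_group MW" using comm_group_subfield[OF assms(2-4)] comm_group_MW by blast+
  have h: "(\<lambda>x. x) \<in> hom ?G MW" by (rule homI) (simp_all del: point_add.simps)
  have "Z_independent MW S" if "Z_independent ?G S" for S
    using independent_hom[OF G h, of S] that by (simp add: Z_independent_iff)
  thus ?thesis using bd unfolding bounded_rank_def by blast
qed

text \<open>The twist is written with u in the role of v; \<open>j\<close>, which substitutes u^2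
  for u, moves it into k(u^2). Scaling by c = 1/u then lands on the Legendre curve, and because c
  changes sign under \<open>\<sigma>\<close>, the image is anti-invariant: x is scaled by c^2 and y
  by c^3.\<close>

lemma rank_decomposition:
  fixes e :: nat and kt :: "'k::{field,finite} itself"
  assumes e: "even e" "e > 0" and two: "(2::'k) \<noteq> 0"
  defines "u \<equiv> fract_var :: 'k poly fract"
  shows "group_rank (mordell_weil_group (curve 1 (u ^ (2 * e))) UNIV) =
     group_rank (mordell_weil_group (curve 1 (u ^ (2 * e))) (adjoin (u^2)))
     + group_rank (mordell_weil_group (curve u (u ^ Suc e)) UNIV)"
proof -
  have upow: "u ^ n = Fract (Xp ^ n) 1" for n
    by (induction n) (simp_all add: u_def fract_var_def One_fract_def mult_fract)
  have u1: "u = Fract Xp 1" using upow[of 1] by simp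
  have u0: "u \<noteq> 0" by (simp add: u1)
  define t where "t = u ^ (2 * e)"
  have ne: "(1 :: 'k poly) \<noteq> Xp ^ (2 * e)"
  proof
    assume "(1 :: 'k poly) = Xp ^ (2 * e)"
    hence "degree (1 :: 'k poly) = 2 * e" using degree_Xp_power[of "2 * e", where 'k = 'k] by metis
    thus False using e by simp
  qed
  interpret E: function_field_curve "1 :: 'k poly" "Xp ^ (2 * e)"
    using two ne by unfold_locales simp_all
  have cE: "E.E = curve 1 t" by (simp add: t_def upow One_fract_def)
  interpret W: twisted_curve "Xp :: 'k poly" "Xp ^ Suc e" e
  proof
    show "(Xp :: 'k poly) \<noteq> Xp ^ Suc e"
    proof
      assume "(Xp :: 'k poly) = Xp ^ Suc e"
      hence "degree (Xp :: 'k poly) = Suc e" using degree_Xp_power[of "Suc e", where 'k = 'k] by metis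
      thus False using e by simp
    qed
  qed (use two e in simp_all)
  have cW: "W.E = curve u (u ^ Suc e)" by (simp only: upow u1[symmetric])
  define \<phi>j \<phi>s :: "'k poly \<Rightarrow> 'k poly" where "\<phi>j = (\<lambda>f. pcompose f (monom 1 2))" and "\<phi>s = (\<lambda>f. pcompose f [:0, -1:])"
  interpret pj: idom_hom \<phi>j unfolding \<phi>j_def by (rule idom_hom_pcompose) (simp add: degree_monom_eq)
  interpret ps: idom_hom \<phi>s unfolding \<phi>s_def by (rule idom_hom_pcompose) simp
  define j \<sigma> where "j = fmap \<phi>j" and "\<sigma> = fmap \<phi>s"
  interpret j: field_hom j unfolding j_def by (rule pj.field_hom_fmap)
  interpret \<sigma>: field_hom \<sigma> unfolding \<sigma>_def by (rule ps.field_hom_fmap)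
  have X2: "monom 1 2 = (Xp ^ 2 :: 'k poly)" by (simp add: monom_altdef)
  have ju: "j u = u^2" unfolding u1 j_def upow[of 2, unfolded u1]
    by (subst pj.fmap_Fract) (simp_all add: \<phi>j_def X2 pcompose_pCons pcompose_1)
  have \<sigma>u: "\<sigma> u = - u" unfolding u1 \<sigma>_def
    by (subst ps.fmap_Fract) (simp_all add: \<phi>s_def pcompose_pCons pcompose_1 minus_fract)
  have \<sigma>t: "\<sigma> t = t" by (simp add: t_def \<sigma>.hom_power \<sigma>u)
  have \<sigma>j: "\<sigma> (j x) = j x" for x
  proof -
    obtain a b where ab: "x = Fract a b" "b \<noteq> 0" by (cases x) auto
    have "\<phi>s (\<phi>j f) = \<phi>j f" for f
      by (simp add: \<phi>s_def \<phi>j_def pcompose_assoc[symmetric] X2 power2_eq_square pcompose_mult pcompose_pCons)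
    moreover have "\<phi>j b \<noteq> 0" using ab pj.eq_0 by blast
    ultimately show ?thesis using ab by (simp add: j_def \<sigma>_def pj.fmap_Fract ps.fmap_Fract)
  qed
  \<comment> \<open>An invariant element has numerator and denominator in u^2 alone, as -1 differs
    from 1.\<close>
  have fixed: "x \<in> range j" if x: "\<sigma> x = x" for x
  proof -
    obtain n d where nd: "d \<noteq> 0" "coprime n d" "x = Fract n d" by (rule Fract_coprime)
    have inv: "Fract (pcompose n [:0, \<eta>:]) (pcompose d [:0, \<eta>:]) = Fract n d" if "\<eta> \<in> {-1}" for \<eta>
    proof -
      have "\<sigma> x = Fract (\<phi>s n) (\<phi>s d)" unfolding nd(3) \<sigma>_def by (rule ps.fmap_Fract[OF nd(1)])
      thus ?thesis using x that nd(3) by (simp add: \<phi>s_def)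
    qed
    have Z: "\<eta> \<noteq> 0" if "\<eta> \<in> {-1}" for \<eta> :: 'k using that by auto
    have Zm: "2 dvd i" if h: "\<And>\<eta>. \<eta> \<in> {-1 :: 'k} \<Longrightarrow> \<eta> ^ i = 1" for i
    proof (rule ccontr)
      assume "odd i"
      hence "(-1 :: 'k) = 1" using h[of "-1"] by simp
      hence "(2 :: 'k) = 0" by (metis add.right_inverse one_add_one)
      thus False using two by simp
    qed
    have "\<forall>\<eta>\<in>{-1}. Fract (pcompose n [:0, \<eta>:]) (pcompose d [:0, \<eta>:]) = Fract n d" using inv by blast
    moreover have "\<forall>\<eta>\<in>{-1 :: 'k}. \<eta> \<noteq> 0" by simp
    moreover have "\<forall>i. (\<forall>\<eta>\<in>{-1 :: 'k}. \<eta> ^ i = 1) \<longrightarrow> 2 dvd i" using Zm by blast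
    ultimately have sup: "2 dvd i" if "coeff n i \<noteq> 0 \<or> coeff d i \<noteq> 0" for i
      using invariant_support[OF nd(1,2)] that by blast
    have pos2: "(2::nat) > 0" by simp
    obtain g where g: "n = pcompose g (monom 1 2)" using poly_supported_multiples[of 2 n, OF pos2] sup by blast
    obtain k where k: "d = pcompose k (monom 1 2)" using poly_supported_multiples[of 2 d, OF pos2] sup by blast
    have "k \<noteq> 0" using k nd(1) by auto
    hence "j (Fract g k) = Fract (\<phi>j g) (\<phi>j k)" unfolding j_def by (rule pj.fmap_Fract)
    hence "j (Fract g k) = x" using nd(3) g k by (simp add: \<phi>j_def)
    thus ?thesis by (metis rangeI)
  qed
  define K where "K = range j"
  have K: "adjoin (u^2) = K"
    unfolding K_def j_def \<phi>j_def upow[of 2] X2 by (rule adjoin_eq) (simp add: degree_power_eq)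
  have sK: "subfield_set K" unfolding K_def by (rule subfield_range) unfold_locales
  have tK: "t \<in> K" using fixed[OF \<sigma>t] by (simp add: K_def)
  have oneK: "1 \<in> K" using sK by (simp add: subfield_set_def)
  define c where "c = 1 / u"
  have c0: "c \<noteq> 0" using u0 by (simp add: c_def)
  have jue: "j (u ^ Suc e) = u^2 * t"
  proof -
    have "j (u ^ Suc e) = (u^2) ^ Suc e" by (simp only: j.hom_power ju)
    thus ?thesis by (simp add: t_def power_mult)
  qed
  have c2: "c^2 * j u = 1" "c^2 * j (u ^ Suc e) = t"
    unfolding jue ju using u0 by (simp_all add: c_def power_divide)
  define G GK GW where "G = mordell_weil_group (curve 1 t) UNIV" and "GK = mordell_weil_group (curve 1 t) K"
    and "GW = mordell_weil_group (curve u (u ^ Suc e)) UNIV"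
  define \<psi> where "\<psi> = scale_point c \<circ> map_point j"
  have \<psi>: "\<psi> \<in> hom GW G"
    using hom_compose[OF j.map_point_hom[of u "u ^ Suc e"] scale_point_hom[OF c0, of "j u" "j (u ^ Suc e)"]]
    unfolding \<psi>_def GW_def G_def c2 comp_def .
  have inj\<psi>: "inj \<psi>" unfolding \<psi>_def by (rule inj_compose[OF inj_scale_point[OF c0] j.inj_map_point])
  interpret G: comm_group G using E.comm_group_MW unfolding G_def cE .
  have one_t: "E.\<alpha> = 1" "E.\<beta> = t" by (simp_all add: t_def upow One_fract_def)
  have GS: "carrier G = {P. on_curve (curve 1 t) P}" "carrier GK = {P. on_curve (curve 1 t) P \<and> set_point P \<subseteq> K}"
    "x \<otimes>\<^bsub>G\<^esub> y = point_add (curve 1 t) x y" "x \<otimes>\<^bsub>GK\<^esub> y = point_add (curve 1 t) x y" "\<one>\<^bsub>G\<^esub> = Infinity"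
    "carrier GW = {P. on_curve (curve u (u ^ Suc e)) P}" for x y
    by (auto simp: G_def GK_def GW_def mordell_weil_group_def rational_points_def)
  have invG: "inv\<^bsub>G\<^esub> P = pneg P" if "P \<in> carrier G" for P
    using E.inv_MW[of P] that unfolding G_def cE[symmetric] by simp
  have two_pow: "P [^]\<^bsub>G\<^esub> (2::int) = P \<otimes>\<^bsub>G\<^esub> P" if "P \<in> carrier G" for P
    using G.int_pow_mult[OF that, of 1 1] that by simp
  have \<sigma>hom: "map_point \<sigma> (P \<otimes>\<^bsub>G\<^esub> Q) = map_point \<sigma> P \<otimes>\<^bsub>G\<^esub> map_point \<sigma> Q" for P Q
    using \<sigma>.map_point_add[of 1 t P Q] by (simp add: GS \<sigma>t \<sigma>.hom_1)
  have \<sigma>car: "map_point \<sigma> P \<in> carrier G" if "P \<in> carrier G" for P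
    using \<sigma>.on_curve_map[of 1 t P] that by (simp add: GS \<sigma>t \<sigma>.hom_1)
  have \<sigma>\<sigma>: "map_point \<sigma> (map_point \<sigma> P) = P" for P
  proof -
    have "\<sigma> (\<sigma> x) = x" for x
    proof -
      obtain a b where ab: "x = Fract a b" "b \<noteq> 0" by (cases x) auto
      have "\<phi>s (\<phi>s f) = f" for f by (simp add: \<phi>s_def pcompose_assoc[symmetric] pcompose_pCons)
      moreover have "\<phi>s b \<noteq> 0" using ab ps.eq_0 by blast
      ultimately show ?thesis using ab by (simp add: \<sigma>_def ps.fmap_Fract)
    qed
    thus ?thesis by (cases P) simp_all
  qed
  have \<sigma>neg: "map_point \<sigma> (pneg P) = pneg (map_point \<sigma> P)" for P
    by (cases P) (simp_all add: \<sigma>.hom_minus)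
  have fixK: "P \<in> carrier GK" if "P \<in> carrier G" "map_point \<sigma> P = P" for P
    using that fixed by (cases P) (auto simp: GS K_def)
  have Kfix: "map_point \<sigma> P = P" if "P \<in> carrier GK" for P
    using that \<sigma>j by (cases P) (auto simp: GS K_def)
  have anti: "P \<in> \<psi> ` carrier GW" if P: "P \<in> carrier G" and "map_point \<sigma> P = pneg P" for P
  proof (cases P)
    case Infinity
    thus ?thesis by (intro image_eqI[of _ _ Infinity]) (simp_all add: \<psi>_def GS)
  next
    case (Affine x y)
    have sx: "\<sigma> x = x" "\<sigma> y = - y" using that(2) Affine by simp_all
    \<comment> \<open>The odd power of u absorbs the sign of y, so both products descend to
      k(u^2).\<close>
    have "\<sigma> (u^2 * x) = u^2 * x" "\<sigma> (u^3 * y) = u^3 * y"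
      by (simp_all add: \<sigma>.hom_mult \<sigma>.hom_power \<sigma>u sx)
    then obtain X Y where XY: "u^2 * x = j X" "u^3 * y = j Y" using fixed by (metis imageE)
    have e1: "c^2 * j X = x" "c^3 * j Y = y" unfolding XY[symmetric] c_def using u0 by (simp_all add: power_divide)
    hence ps: "\<psi> (Affine X Y) = P" by (simp add: \<psi>_def Affine)
    have "on_curve (curve 1 t) (scale_point c (map_point j (Affine X Y)))" using ps P by (simp add: \<psi>_def GS)
    hence "on_curve (curve u (u ^ Suc e)) (Affine X Y)"
      using on_curve_scale[OF c0, of "j u" "j (u ^ Suc e)" "map_point j (Affine X Y)"]
        j.on_curve_map[of u "u ^ Suc e" "Affine X Y"]
      unfolding c2 by blast
    thus ?thesis using ps by (intro image_eqI[of _ _ "Affine X Y"]) (simp_all add: GS)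
  qed
  have \<psi>anti: "map_point \<sigma> (\<psi> w) = pneg (\<psi> w)" for w
  proof (cases w)
    case (Affine X Y)
    have "\<sigma> c = - c" by (simp add: c_def \<sigma>.hom_divide \<sigma>.hom_1 \<sigma>u)
    thus ?thesis by (simp add: \<psi>_def Affine \<sigma>.hom_mult \<sigma>.hom_power \<sigma>j)
  qed (simp add: \<psi>_def)
  have comm: "comm_group GK" "comm_group GW" "comm_group G"
  proof -
    show "comm_group GK" unfolding GK_def using E.comm_group_subfield[OF sK] oneK tK one_t by simp
    show "comm_group GW" using W.comm_group_MW unfolding GW_def cW .
  qed unfold_locales
  have "group_rank G = group_rank GK + group_rank GW"
  proof (rule rank_add[OF comm, where ?\<phi>1.0 = "\<lambda>x. x" and ?\<phi>2.0 = \<psi>])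
    show "(\<lambda>x. x) \<in> hom GK G" by (rule homI) (auto simp: GS)
    show "inj_on (\<lambda>x. x) (carrier GK)" by simp
    show "\<psi> \<in> hom GW G" by (rule \<psi>)
    show "inj_on \<psi> (carrier GW)" using inj\<psi> by (rule inj_on_subset) simp
    show "bounded_rank GW" using W.bounded_rank_MW unfolding GW_def cW .
    show "bounded_rank GK" unfolding GK_def
      using subgroup_bounded_rank[OF _ sK, of 1 t] E.bounded_rank_MW E.ecurve_axioms oneK tK unfolding one_t by blast
  next
    fix x y assume x: "x \<in> carrier GK" and y: "y \<in> carrier GW" and eq: "x \<otimes>\<^bsub>G\<^esub> \<psi> y = \<one>\<^bsub>G\<^esub>"
    have xG: "x \<in> carrier G" using x by (simp add: GS)
    have yG: "\<psi> y \<in> carrier G" using \<psi> y by (auto simp: hom_def)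
    have "inv\<^bsub>G\<^esub> x = \<psi> y" using eq xG yG by (metis G.inv_equality G.m_comm)
    hence py: "\<psi> y = pneg x" using invG[OF xG] by simp
    \<comment> \<open>x is invariant and -x, being the image of y, is anti-invariant; so x =
      -x.\<close>
    have "pneg x = pneg (pneg x)" using \<psi>anti[of y] Kfix[OF x] unfolding py \<sigma>neg by simp
    hence "x = inv\<^bsub>G\<^esub> x" using invG[OF xG] by simp
    hence "x \<otimes>\<^bsub>G\<^esub> x = \<one>\<^bsub>G\<^esub>" using xG by (metis G.r_inv)
    thus "\<exists>n::int. n \<noteq> 0 \<and> x [^]\<^bsub>G\<^esub> n = \<one>\<^bsub>G\<^esub>" using two_pow[OF xG] by (intro exI[of _ 2]) simp
  next
    fix g assume g: "g \<in> carrier G"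
    define s where "s = map_point \<sigma> g"
    have s: "s \<in> carrier G" "map_point \<sigma> s = g" using \<sigma>car[OF g] \<sigma>\<sigma> by (simp_all add: s_def)
    have ns: "pneg s \<in> carrier G" using invG[OF s(1)] s(1) by (metis G.inv_closed)
    have "map_point \<sigma> (g \<otimes>\<^bsub>G\<^esub> s) = g \<otimes>\<^bsub>G\<^esub> s" using g s by (simp add: \<sigma>hom s_def[symmetric] G.m_comm)
    hence 1: "g \<otimes>\<^bsub>G\<^esub> s \<in> carrier GK" using fixK g s by blast
    have "map_point \<sigma> (g \<otimes>\<^bsub>G\<^esub> pneg s) = s \<otimes>\<^bsub>G\<^esub> pneg g" by (simp add: \<sigma>hom \<sigma>neg s(2) s_def[symmetric])
    also have "\<dots> = inv\<^bsub>G\<^esub> (g \<otimes>\<^bsub>G\<^esub> pneg s)"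
      using g s by (simp add: invG[symmetric] G.inv_mult_group)
    also have "\<dots> = pneg (g \<otimes>\<^bsub>G\<^esub> pneg s)" using g ns by (intro invG) simp
    finally have "g \<otimes>\<^bsub>G\<^esub> pneg s \<in> \<psi> ` carrier GW" using anti g ns by blast
    then obtain w where w: "w \<in> carrier GW" "g \<otimes>\<^bsub>G\<^esub> pneg s = \<psi> w" by blast
    \<comment> \<open>The sum of the invariant g + s and the anti-invariant g - s is 2g.\<close>
    have "(g \<otimes>\<^bsub>G\<^esub> s) \<otimes>\<^bsub>G\<^esub> (g \<otimes>\<^bsub>G\<^esub> pneg s) = (g \<otimes>\<^bsub>G\<^esub> g) \<otimes>\<^bsub>G\<^esub> (s \<otimes>\<^bsub>G\<^esub> pneg s)"
      using g s(1) ns by (simp add: G.m_ac)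
    also have "s \<otimes>\<^bsub>G\<^esub> pneg s = \<one>\<^bsub>G\<^esub>" using s(1) invG[OF s(1)] by (metis G.r_inv)
    finally have "g [^]\<^bsub>G\<^esub> (2::int) = (g \<otimes>\<^bsub>G\<^esub> s) \<otimes>\<^bsub>G\<^esub> \<psi> w"
      using g w(2) two_pow[OF g] by simp
    thus "\<exists>n::int. n \<noteq> 0 \<and> (\<exists>x\<in>carrier GK. \<exists>y\<in>carrier GW. g [^]\<^bsub>G\<^esub> n = x \<otimes>\<^bsub>G\<^esub> \<psi> y)"
      using 1 w(1) by (intro exI[of _ 2] conjI bexI[of _ "g \<otimes>\<^bsub>G\<^esub> s"] bexI[of _ w]) auto
  qed
  thus ?thesis unfolding G_def GK_def GW_def K t_def .
qed

section \<open>Roots of unity\<close>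

lemma roots_of_unity_card_le:
  assumes "n > 0"
  shows "finite {x :: 'a::field. x ^ n = c}" "card {x :: 'a. x ^ n = c} \<le> n"
proof -
  let ?p = "monom 1 n - [:c:] :: 'a poly"
  have d: "degree ?p = n"
  proof -
    have "degree (monom 1 n - [:c:] :: 'a poly) = degree (monom 1 n :: 'a poly)"
      by (subst diff_conv_add_uminus, rule degree_add_eq_left) (use assms in \<open>simp add: degree_monom_eq\<close>)
    thus ?thesis by (simp add: degree_monom_eq)
  qed
  have p0: "?p \<noteq> 0" using d assms by auto
  have e: "{x. x ^ n = c} = {x. poly ?p x = 0}" by (auto simp: poly_monom)
  show "finite {x :: 'a. x ^ n = c}" unfolding e by (rule poly_roots_finite[OF p0])
  show "card {x :: 'a. x ^ n = c} \<le> n" unfolding e using card_poly_roots_bound[OF p0] d by simp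
qed

text \<open>Over an algebraically closed field X^n - 1 splits, and it has no common root with its
  derivative n X^(n-1), so its roots are simple.\<close>

lemma roots_of_unity_card:
  assumes "n > 0" and n: "of_nat n \<noteq> (0 :: 'a::alg_closed_field)"
  shows "card {x :: 'a. x ^ n = 1} = n"
proof -
  define p :: "'a poly" where "p = monom 1 n - 1"
  have d: "degree p = n"
  proof -
    have "degree (monom 1 n - 1 :: 'a poly) = degree (monom 1 n :: 'a poly)"
      by (subst diff_conv_add_uminus, rule degree_add_eq_left) (use assms in \<open>simp add: degree_monom_eq\<close>)
    thus ?thesis by (simp add: p_def degree_monom_eq)
  qed
  have p0: "p \<noteq> 0" using d assms by auto
  obtain A where A: "size A = degree p" "p = smult (lead_coeff p) (\<Prod>x\<in>#A. [:-x, 1:])"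
    using alg_closed_imp_factorization[OF p0] by blast
  have root: "poly p x = 0 \<longleftrightarrow> x \<in># A" for x
  proof -
    have "poly p x = lead_coeff p * (\<Prod>y\<in>#A. x - y)" by (subst A(2)) (simp add: poly_prod_mset)
    thus ?thesis using p0 by (auto simp: prod_mset_zero_iff)
  qed
  have le: "count A x \<le> 1" for x
  proof (rule ccontr)
    assume "\<not> count A x \<le> 1"
    hence "{#x, x#} \<subseteq># A" by (simp add: subseteq_mset_def)
    then obtain B where B: "A = {#x, x#} + B" by (metis subset_mset.add_diff_inverse)
    hence "p = [:-x, 1:] * ([:-x, 1:] * smult (lead_coeff p) (\<Prod>x\<in>#B. [:-x, 1:]))"
      using A(2) by (simp add: mult_ac)
    then obtain r where r: "p = [:-x, 1:] * ([:-x, 1:] * r)" by blast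
    have "poly (pderiv p) x = 0" unfolding r by (simp add: pderiv_mult del: mult_pCons_left)
    moreover have "pderiv p = monom (of_nat n) (n - 1)" by (simp add: p_def pderiv_diff pderiv_monom pderiv_1)
    ultimately have "of_nat n * x ^ (n - 1) = 0" by (simp add: poly_monom)
    hence "x = 0" using n by simp
    moreover have "x \<in># A" using B by simp
    ultimately have "poly p 0 = 0" using root by blast
    thus False using assms(1) by (simp add: p_def poly_monom power_0_left)
  qed
  have "size A = (\<Sum>x\<in>set_mset A. 1)"
    unfolding size_multiset_overloaded_eq
    by (rule sum.cong) (use le in \<open>simp_all add: le_antisym\<close>)
  hence "card (set_mset A) = size A" by simp
  moreover have "{x. x ^ n = 1} = set_mset A" using root by (auto simp: p_def poly_monom)
  ultimately show ?thesis using A(1) d by simp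
qed

lemma power_gcd_eq_1:
  fixes x :: "'a::field"
  assumes "x ^ a = 1" "x ^ b = 1" "a \<noteq> 0"
  shows "x ^ gcd a b = 1"
proof -
  obtain y z where "a * y = b * z + gcd a b" using bezout_nat[OF assms(3)] by blast
  hence "(x ^ a) ^ y = (x ^ b) ^ z * x ^ gcd a b" by (simp add: power_mult[symmetric] power_add[symmetric])
  thus ?thesis using assms by simp
qed

lemma idom_hom_map_poly:
  assumes "field_hom h" shows "idom_hom (map_poly h :: 'a::field poly \<Rightarrow> 'b::field poly)"
proof -
  interpret field_hom h by fact
  have c: "coeff (map_poly h f) i = h (coeff f i)" for f i by (simp add: coeff_map_poly hom_0)
  have hs: "h (sum g A) = (\<Sum>i\<in>A. h (g i))" for g :: "nat \<Rightarrow> 'a" and A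
    by (induction A rule: infinite_finite_induct) (simp_all add: hom_0 hom_add)
  show ?thesis
  proof
    fix f g :: "'a poly"
    show "map_poly h (f + g) = map_poly h f + map_poly h g" by (rule poly_eqI) (simp add: c hom_add)
    show "map_poly h (f * g) = map_poly h f * map_poly h g"
      by (rule poly_eqI) (simp add: c coeff_mult hs hom_mult)
    show "map_poly h 1 = 1" by (rule poly_eqI) (simp add: c one_pCons coeff_pCons hom_0 hom_1 split: nat.split)
    show "f = 0" if "map_poly h f = 0"
    proof (rule poly_eqI)
      fix i show "coeff f i = coeff 0 i" using arg_cong[OF that, of "\<lambda>p. coeff p i"] by (simp add: c hom_eq_0)
    qed
  qed
qed

lemma idom_hom_comp: "idom_hom \<phi> \<Longrightarrow> idom_hom \<psi> \<Longrightarrow> idom_hom (\<lambda>x. \<psi> (\<phi> x))"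
  by (simp add: idom_hom_def)

lemma idom_hom_power: "idom_hom \<phi> \<Longrightarrow> \<phi> (x ^ n) = \<phi> x ^ n"
  by (induction n) (simp_all add: idom_hom_def)

section \<open>Independent points on the twist\<close>

lemma pcompose_monom_scale: "pcompose (monom c k) [:0, \<eta> :: 'a::comm_ring_1:] = monom (c * \<eta> ^ k) k"
  by (rule poly_eqI) (simp add: coeff_scale_var coeff_monom mult.commute)

lemma pcompose_monom_monom: "pcompose (monom c k) (monom 1 m :: 'a::comm_ring_1 poly) = monom c (k * m)"
proof (induction k)
  case (Suc k)
  have "monom c (Suc k) = pCons 0 (monom c k)" by (simp add: monom_Suc)
  thus ?case using Suc by (simp add: pcompose_pCons mult_monom)
qed (simp add: monom_0)

context comm_group
begin

lemma parity_finprod: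
  assumes "parity_hom G \<epsilon>" "finite S" "f \<in> S \<rightarrow> carrier G"
  shows "\<epsilon> (\<Otimes>x\<in>S. f x) \<longleftrightarrow> odd (card {x \<in> S. \<epsilon> (f x)})"
  using assms(2,3)
proof (induction S)
  case empty thus ?case using parity_one[OF assms(1)] by simp
next
  case (insert x S)
  have "{y \<in> insert x S. \<epsilon> (f y)} = (if \<epsilon> (f x) then insert x {y \<in> S. \<epsilon> (f y)} else {y \<in> S. \<epsilon> (f y)})" by auto
  moreover have "finite {y \<in> S. \<epsilon> (f y)}" "x \<notin> {y \<in> S. \<epsilon> (f y)}" using insert by auto
  moreover have "\<epsilon> (\<Otimes>y\<in>insert x S. f y) = (\<epsilon> (f x) \<noteq> \<epsilon> (\<Otimes>y\<in>S. f y))"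
  proof -
    have "(\<Otimes>y\<in>insert x S. f y) = f x \<otimes> (\<Otimes>y\<in>S. f y)" using insert by (intro finprod_insert) auto
    moreover have "f x \<in> carrier G" "(\<Otimes>y\<in>S. f y) \<in> carrier G" using insert by (auto intro!: finprod_closed)
    ultimately show ?thesis by (simp only: parity_mult[OF assms(1)])
  qed
  ultimately show ?case using insert by (auto simp del: finprod_insert)
qed

lemma Zspan_parity:
  assumes "parity_hom G \<epsilon>" "finite B" "B \<subseteq> carrier G" "\<And>b. b \<in> B \<Longrightarrow> \<not> \<epsilon> b" "g \<in> Zspan G B"
  shows "\<not> \<epsilon> g"
  using assms(2,3,5)
proof (induction rule: Zspan_induct)
  case one thus ?case by (rule parity_one[OF assms(1)])
next
  case (step x y n)
  have x: "x \<in> carrier G" using step assms(3) by auto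
  show ?case using step x assms(4)[OF step(1)] by (simp add: parity_mult[OF assms(1)] parity_int_pow[OF assms(1) x])
qed

text \<open>The endomorphism permutes the summands and so fixes their sum. \<open>b\<close> is the
  inverse permutation of the indices.\<close>

lemma finprod_endo:
  assumes h: "h \<in> hom G G" and S: "finite S" "f \<in> S \<rightarrow> carrier G"
    and b: "inj_on b S" "b ` S = S" and eq: "\<And>x. x \<in> S \<Longrightarrow> h (f (b x)) = f x"
  shows "h (\<Otimes>x\<in>S. f x) = (\<Otimes>x\<in>S. f x)"
proof -
  have hp: "h (\<Otimes>x\<in>T. f x) = (\<Otimes>x\<in>T. h (f x))" if "finite T" "f \<in> T \<rightarrow> carrier G" for T
    using that
  proof (induction T)
    case empty thus ?case using h hom_one[OF h] is_group by simp
  next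
    case (insert x T)
    have "h (f y) \<in> carrier G" if "y \<in> insert x T" for y using h insert that by (auto simp: hom_def)
    thus ?case using insert h by (subst (1 2) finprod_insert) (auto simp: hom_def intro!: finprod_closed)
  qed
  have c: "h (f x) \<in> carrier G" if "x \<in> S" for x using h S that by (auto simp: hom_def)
  have "h (\<Otimes>x\<in>S. f x) = (\<Otimes>x\<in>b ` S. h (f x))" using hp[OF S] b by simp
  also have "\<dots> = (\<Otimes>x\<in>S. h (f (b x)))" using c b by (intro finprod_reindex) auto
  also have "\<dots> = (\<Otimes>x\<in>S. f x)" using S eq by (intro finprod_cong') auto
  finally show ?thesis .
qed

end

text \<open>\<open>\<iota>\<close> embeds k into an algebraically closed field; f belongs to Q = p^f
  and n to q = p^n. The halves r = (m - 1) / 2 and s = (Q + 1) / 2 are exponents in the explicit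
  square roots.\<close>

locale lower_bound = twisted_curve a0 b0 e for a0 b0 :: "'k::finite_field poly" and e +
  fixes \<iota> :: "'k \<Rightarrow> 'l::alg_closed_field" and p n f m r s :: nat
  assumes iota: "field_hom \<iota>" and p: "prime p" "CHAR('l) = p" and f: "f \<ge> 1"
    and m: "e * m = p ^ f - 1" "m = 2 * r + 1" and s: "p ^ f + 1 = 2 * s"
    and q: "CARD('k) = p ^ n" "2 * e dvd CARD('k) - 1"
begin

interpretation iota: field_hom \<iota> by (rule iota)

definition Q where "Q = p ^ f"
definition q where "q = CARD('k)"

lemma Q_pos: "Q > 1" "p dvd Q" "e * m + 1 = Q"
proof -
  have "p > 1" using p prime_gt_1_nat by blast
  hence "p ^ f > 1" using f by (metis one_less_power less_eq_Suc_le One_nat_def)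
  thus "Q > 1" "e * m + 1 = Q" using m by (simp_all add: Q_def)
  show "p dvd Q" using f by (simp add: Q_def dvd_power)
qed

lemma m_nz: "of_nat m \<noteq> (0 :: 'l)"
proof
  assume "of_nat m = (0 :: 'l)"
  hence "p dvd m" using of_nat_eq_0_iff_char_dvd[where ?'a = 'l, of m] p by simp
  hence "p dvd e * m" by simp
  hence "p dvd 1" using Q_pos(2,3) by (metis dvd_add_right_iff)
  thus False using p by (simp add: prime_nat_iff)
qed

definition mu where "mu = {\<theta> :: 'l. \<theta> ^ m = 1}"

text \<open>m is odd and prime to p, so there are m roots of unity of order dividing m. They cannot
  all satisfy \<theta>^g = 1 for g = gcd(m, 2i) smaller than m. Squares appear since \<gamma> ->
  \<gamma>\<theta> multiplies \<gamma>^2 by \<theta>^2.\<close>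

lemma mu_support: "(\<forall>\<theta>\<in>mu. (\<theta>^2) ^ i = 1) \<Longrightarrow> m dvd i"
proof -
  assume h: "\<forall>\<theta>\<in>mu. (\<theta>^2) ^ i = 1"
  have m0: "m > 0" "odd m" using m by simp_all
  define g where "g = gcd m (2 * i)"
  have g0: "g > 0" using m0 by (simp add: g_def)
  have "mu \<subseteq> {\<theta>. \<theta> ^ g = 1}"
  proof
    fix \<theta> :: 'l assume t: "\<theta> \<in> mu"
    hence "\<theta> ^ (2 * i) = 1" using h by (simp add: power_mult)
    thus "\<theta> \<in> {\<theta>. \<theta> ^ g = 1}" using t m0 power_gcd_eq_1[of \<theta> m "2 * i"] by (simp add: g_def mu_def)
  qed
  hence "card mu \<le> g"
    using roots_of_unity_card_le[OF g0, of "1 :: 'l"] by (meson card_mono le_trans)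
  moreover have "card mu = m" unfolding mu_def by (rule roots_of_unity_card[OF m0(1) m_nz])
  moreover have "g dvd m" by (simp add: g_def)
  ultimately have "g = m" using m0 by (metis dvd_imp_le le_antisym)
  hence "m dvd 2 * i" by (metis g_def gcd_dvd2)
  moreover have "coprime m 2" using m0(2) by simp
  ultimately show ?thesis by (simp add: coprime_dvd_mult_right_iff)
qed

section \<open>Frobenius, and the embedding of k(v) over the closure\<close>

definition frob :: "'l \<Rightarrow> 'l" where "frob x = x ^ q"

lemma field_hom_frob: "field_hom frob"
proof
  fix x y :: 'l
  show "frob (x + y) = frob x + frob y"
    unfolding frob_def q_def q by (rule freshmans_dream') (simp_all add: p)
qed (simp_all add: frob_def power_mult_distrib)

text \<open>The image of k already supplies q roots of X^q - X, which is as many as its degree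
  allows.\<close>

lemma frob_fixed: "frob x = x \<longleftrightarrow> x \<in> range \<iota>"
proof -
  have sub: "range \<iota> \<subseteq> {x. frob x = x}"
  proof
    fix x assume "x \<in> range \<iota>"
    then obtain y where y: "x = \<iota> y" by blast
    have "y ^ q = y" unfolding q_def by (rule finite_field_power_card_eq_same)
    thus "x \<in> {x. frob x = x}" unfolding y frob_def by (simp flip: iota.hom_power)
  qed
  have q1: "q > 1"
  proof -
    have "card {0, 1 :: 'k} \<le> card (UNIV :: 'k set)" by (rule card_mono) simp_all
    thus ?thesis by (simp add: q_def)
  qed
  let ?p = "monom 1 q - [:0, 1:] :: 'l poly"
  have d: "degree ?p = q"
  proof -
    have "degree (monom 1 q - [:0, 1:] :: 'l poly) = degree (monom 1 q :: 'l poly)"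
      by (subst diff_conv_add_uminus, rule degree_add_eq_left) (use q1 in \<open>simp add: degree_monom_eq\<close>)
    thus ?thesis by (simp add: degree_monom_eq)
  qed
  hence p0: "?p \<noteq> 0" using q1 by auto
  have e: "{x. frob x = x} = {x. poly ?p x = 0}" by (auto simp: frob_def poly_monom)
  have "finite {x. frob x = x}" "card {x. frob x = x} \<le> q"
    unfolding e using poly_roots_finite[OF p0] card_poly_roots_bound[OF p0] d by simp_all
  moreover have "card (range \<iota>) = q" unfolding q_def by (rule card_image) (simp add: inj_def iota.hom_eq)
  ultimately have "range \<iota> = {x. frob x = x}" using sub by (intro card_seteq) auto
  thus ?thesis by blast
qed

text \<open>Extends the constants and substitutes w^m for v.\<close>

definition \<phi>J :: "'k poly \<Rightarrow> 'l poly" where "\<phi>J g = pcompose (map_poly \<iota> g) (monom 1 m)"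
definition J where "J = fmap \<phi>J"

lemma hom_\<phi>J: "idom_hom \<phi>J"
  unfolding \<phi>J_def[abs_def]
  by (rule idom_hom_comp[OF idom_hom_map_poly[OF iota] idom_hom_pcompose]) (simp add: degree_monom_eq m)

lemma hom_J: "field_hom J"
  unfolding J_def by (rule idom_hom.field_hom_fmap[OF hom_\<phi>J])

definition "\<alpha>L = (Fract (monom 1 m) 1 :: 'l poly fract)"
definition "\<beta>L = (Fract (monom 1 (m * Suc e)) 1 :: 'l poly fract)"

lemma J_coeffs: "J \<alpha> = \<alpha>L" "J \<beta> = \<beta>L"
proof -
  have mX: "map_poly \<iota> (monom 1 k) = monom 1 k" for k
    by (rule poly_eqI) (simp add: coeff_map_poly iota.hom_0 coeff_monom iota.hom_1)
  have "a0 = monom 1 1" "b0 = monom 1 (Suc e)" using a0 b0 by (simp_all add: monom_altdef)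
  hence "\<phi>J a0 = monom 1 m" "\<phi>J b0 = monom 1 (m * Suc e)" "\<phi>J 1 = 1"
    using idom_hom.one[OF hom_\<phi>J] by (simp_all add: \<phi>J_def mX pcompose_monom_monom mult.commute)
  thus "J \<alpha> = \<alpha>L" "J \<beta> = \<beta>L" unfolding J_def \<alpha>L_def \<beta>L_def
    by (simp_all add: idom_hom.fmap_Fract[OF hom_\<phi>J])
qed

sublocale L: ecurve \<alpha>L \<beta>L
proof
  show "\<alpha>L \<noteq> 0" "\<beta>L \<noteq> 0" "\<alpha>L \<noteq> \<beta>L"
    using field_hom.hom_eq[OF hom_J, of \<alpha> \<beta>] field_hom.hom_eq_0[OF hom_J] nz by (simp_all add: J_coeffs[symmetric])
  show "(2 :: 'l poly fract) \<noteq> 0"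
    using field_hom.hom_numeral[OF hom_J, of "num.Bit0 num.One"] field_hom.hom_eq_0[OF hom_J, of 2] two by metis
qed

definition Px :: "'l \<Rightarrow> 'l poly" where "Px \<gamma> = monom (\<gamma>^2) (2 * r)"
text \<open>The square root of x (x + v)(x + v^(e+1)), whose factors contribute \<gamma>^2 w^(6r)
  and (\<gamma>^2 + w)^(Q+1), with Q + 1 = 2s. It is odd in \<gamma> while \<open>Px\<close> is
  even, so opposite \<gamma> give opposite points.\<close>

definition Py :: "'l \<Rightarrow> 'l poly" where "Py \<gamma> = monom \<gamma> (3 * r) * [:\<gamma>^2, 1:] ^ s"
definition P where "P \<gamma> = Affine (Fract (Px \<gamma>) 1) (Fract (Py \<gamma>) 1)"

lemma Px_\<alpha>: "Px \<gamma> + monom 1 m = monom 1 (2 * r) * [:\<gamma>^2, 1:]"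
proof -
  have "monom 1 m = monom 1 (2 * r) * (monom 1 1 :: 'l poly)" using m by (simp add: mult_monom)
  moreover have "Px \<gamma> = monom 1 (2 * r) * [:\<gamma>^2:]" by (simp add: Px_def smult_monom)
  moreover have "[:\<gamma>^2:] + monom 1 1 = [:\<gamma>^2, 1 :: 'l:]" by (simp add: monom_altdef)
  ultimately show ?thesis by (metis distrib_left)
qed

lemma P_on_curve:
  assumes "\<gamma> ^ (2 * (Q - 1)) = 1"
  shows "L.onE (P \<gamma>)"
proof -
  have "(\<gamma>^2) ^ Q = \<gamma>^2"
  proof -
    have "(\<gamma>^2) ^ Q = (\<gamma>^2) ^ (Q - 1) * \<gamma>^2" using Q_pos(1) by (metis Suc_diff_1 less_trans power_Suc2 zero_less_one)
    thus ?thesis using assms by (simp add: power_mult)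
  qed
  hence cQ: "[:\<gamma>^2:] ^ Q = [:\<gamma>^2:]" by (simp add: poly_const_pow)
  have "prime CHAR('l poly)" using p by simp
  \<comment> \<open>Raising to the power Q is additive and fixes \<gamma>^2, so (\<gamma>^2 + w)^Q =
    \<gamma>^2 + w^Q.\<close>
  hence "([:\<gamma>^2:] + monom 1 1) ^ Q = [:\<gamma>^2:] ^ Q + (monom 1 1 :: 'l poly) ^ Q"
    by (rule freshmans_dream') (simp add: Q_def p)
  hence fr: "[:\<gamma>^2, 1:] ^ Q = [:\<gamma>^2:] + monom 1 Q" unfolding cQ by (simp add: monom_altdef)
  \<comment> \<open>m (e + 1) = (Q - 1) + m, which is where w^(2r) w^Q comes from.\<close>
  have mE: "m * Suc e = 2 * r + Q" using Q_pos(3) m(2) by (simp add: algebra_simps)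
  have "Px \<gamma> + monom 1 (m * Suc e) = monom 1 (2 * r) * [:\<gamma>^2, 1:] ^ Q"
    unfolding fr mE Px_def distrib_left by (simp add: mult_monom smult_monom)
  hence "Px \<gamma> * (Px \<gamma> + monom 1 m) * (Px \<gamma> + monom 1 (m * Suc e)) =
     (Px \<gamma> * monom 1 (2 * r) * monom 1 (2 * r)) * [:\<gamma>^2, 1:] ^ (Suc Q)"
    unfolding Px_\<alpha> by (simp only: power_Suc mult_ac)
  also have "Px \<gamma> * monom 1 (2 * r) * monom 1 (2 * r) = (monom \<gamma> (3 * r))^2"
    by (simp add: Px_def mult_monom power2_eq_square)
  also have "Suc Q = s * 2" using s by (simp add: Q_def)
  finally have "(Py \<gamma>)^2 = Px \<gamma> * (Px \<gamma> + monom 1 m) * (Px \<gamma> + monom 1 (m * Suc e))"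
    by (simp add: Py_def power_mult_distrib power_mult)
  thus ?thesis unfolding P_def unfolding L.onE unfolding \<alpha>L_def \<beta>L_def
    by (simp add: power2_eq_square mult_fract add_fract)
qed

text \<open>A fibre of the m-th power map, on which the m-th roots of unity act by multiplication.
  For l in \<open>Lam\<close> its members satisfy \<gamma>^(2(Q-1)) = 1, because 2(Q - 1) = m times
  2e.\<close>

definition \<Gamma> where "\<Gamma> l = {\<gamma>. \<gamma> ^ m = \<iota> l}"
definition Lam where "Lam = {l :: 'k. l ^ (2 * e) = 1}"

lemma m_pos: "m > 0" using m by simp

lemma \<Gamma>_finite: "finite (\<Gamma> l)"
  unfolding \<Gamma>_def by (rule roots_of_unity_card_le[OF m_pos])

lemma \<Gamma>_nonempty: "\<exists>\<gamma>. \<gamma> \<in> \<Gamma> l"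
  unfolding \<Gamma>_def using nth_root_exists[OF m_pos, of "\<iota> l"] by blast

lemma \<Gamma>_root:
  assumes "l \<in> Lam" "\<gamma> \<in> \<Gamma> l" shows "\<gamma> ^ (2 * (Q - 1)) = 1" "\<gamma> \<noteq> 0"
proof -
  have "2 * (Q - 1) = m * (2 * e)" using m(1) by (simp add: Q_def mult_ac)
  hence "\<gamma> ^ (2 * (Q - 1)) = (\<gamma> ^ m) ^ (2 * e)" by (simp only: power_mult[of \<gamma> m])
  also have "\<dots> = \<iota> l ^ (2 * e)" using assms(2) by (simp add: \<Gamma>_def)
  also have "\<dots> = 1" using assms(1) by (simp add: Lam_def iota.hom_1 flip: iota.hom_power)
  finally show *: "\<gamma> ^ (2 * (Q - 1)) = 1" .
  show "\<gamma> \<noteq> 0" using * Q_pos(1) by (auto simp: power_0_left)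
qed

lemma P_carrier: "l \<in> Lam \<Longrightarrow> P \<in> \<Gamma> l \<rightarrow> carrier L.MW"
  using P_on_curve \<Gamma>_root by auto

definition T where "T l = (\<Otimes>\<^bsub>L.MW\<^esub>\<gamma>\<in>\<Gamma> l. P \<gamma>)"

lemma T_carrier: "l \<in> Lam \<Longrightarrow> T l \<in> carrier L.MW"
  unfolding T_def by (rule comm_monoid.finprod_closed[OF comm_group.axioms(1)[OF L.comm_group_MW] P_carrier])

definition \<phi>S :: "'l \<Rightarrow> 'l poly \<Rightarrow> 'l poly" where "\<phi>S \<theta> g = pcompose g [:0, \<theta>^2:]"

text \<open>The substitution w -> \<theta>^2 w takes the point of \<gamma>\<theta> to that of
  \<gamma> and so permutes the summands. The powers of \<theta> that arise are \<theta>^(2m) in x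
  and \<theta>^(3m + em) in y, both equal to 1.\<close>

lemma T_invariant_S:
  assumes lam: "l \<in> Lam" and th: "\<theta> \<in> mu"
  shows "map_point (fmap (\<phi>S \<theta>)) (T l) = T l"
proof -
  have t0: "\<theta> \<noteq> 0" "\<theta> ^ m = 1" using th m_pos by (auto simp: mu_def power_0_left)
  have hS: "idom_hom (\<phi>S \<theta>)" unfolding \<phi>S_def[abs_def] using t0 by (intro idom_hom_pcompose) simp
  interpret S: field_hom "fmap (\<phi>S \<theta>)" by (rule idom_hom.field_hom_fmap[OF hS])
  have F1: "fmap (\<phi>S \<theta>) (Fract g 1) = Fract (\<phi>S \<theta> g) 1" for g
    using idom_hom.one[OF hS] by (simp add: idom_hom.fmap_Fract[OF hS])
  have Sm: "\<phi>S \<theta> (monom 1 (m * k)) = monom 1 (m * k)" for k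
  proof -
    have "(\<theta>^2) ^ (m * k) = (\<theta> ^ m) ^ (2 * k)" by (simp only: power_mult[symmetric] mult_ac)
    thus ?thesis using t0 by (simp add: \<phi>S_def pcompose_monom_scale)
  qed
  have fix_ab: "fmap (\<phi>S \<theta>) \<alpha>L = \<alpha>L" "fmap (\<phi>S \<theta>) \<beta>L = \<beta>L"
    using Sm[of 1] Sm[of "Suc e"] by (simp_all add: \<alpha>L_def \<beta>L_def F1)
  have hom: "map_point (fmap (\<phi>S \<theta>)) \<in> hom L.MW L.MW"
    using S.map_point_hom[of \<alpha>L \<beta>L] unfolding fix_ab .
  have SP: "map_point (fmap (\<phi>S \<theta>)) (P (\<delta> * \<theta>)) = P \<delta>" for \<delta>
  proof -
    have t1: "\<theta> ^ (k * m) = 1" for k using t0 by (metis power_mult power_one mult.commute)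
    have "\<theta>^2 * (\<theta>^2) ^ (2 * r) = \<theta> ^ (2 * m)" using m(2) by (simp add: power_mult[symmetric] power_add[symmetric])
    hence e1: "\<theta>^2 * (\<theta>^2) ^ (2 * r) = 1" using t1[of 2] by simp
    have ex: "\<phi>S \<theta> (Px (\<delta> * \<theta>)) = Px \<delta>"
      unfolding \<phi>S_def Px_def pcompose_monom_scale using e1 by (simp add: power_mult_distrib mult.assoc)
    have "2 * s = e * m + 2" using s Q_pos(3) by (simp add: Q_def)
    hence "(\<theta>^2) ^ s = \<theta> ^ (e * m) * \<theta>^2" by (simp only: power_mult[symmetric] power_add)
    hence es: "(\<theta>^2) ^ s = \<theta>^2" using t1[of e] by simp
    have "3 * m = 1 + 2 * (3 * r) + 2" using m(2) by simp
    hence "\<theta> * (\<theta>^2) ^ (3 * r) * (\<theta>^2) = \<theta> ^ (3 * m)"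
      by (simp only: power_add power_mult power_one_right)
    hence e3: "\<theta> * (\<theta>^2) ^ (3 * r) * (\<theta>^2) = 1" using t1[of 3] by simp
    have "\<phi>S \<theta> [:(\<delta> * \<theta>)^2, 1:] = smult (\<theta>^2) [:\<delta>^2, 1:]"
      by (simp add: \<phi>S_def pcompose_pCons power_mult_distrib mult.commute)
    hence "\<phi>S \<theta> ([:(\<delta> * \<theta>)^2, 1:] ^ s) = smult (\<theta>^2) ([:\<delta>^2, 1:] ^ s)"
      by (simp only: idom_hom_power[OF hS] smult_power es)
    moreover have "\<phi>S \<theta> (monom (\<delta> * \<theta>) (3 * r)) = monom (\<delta> * \<theta> * (\<theta>^2) ^ (3 * r)) (3 * r)"
      by (simp add: \<phi>S_def pcompose_monom_scale)
    ultimately have "\<phi>S \<theta> (Py (\<delta> * \<theta>)) = monom (\<delta> * \<theta> * (\<theta>^2) ^ (3 * r)) (3 * r) * smult (\<theta>^2) ([:\<delta>^2, 1:] ^ s)"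
      unfolding Py_def by (simp only: idom_hom.mult[OF hS])
    also have "\<dots> = monom (\<delta> * (\<theta> * (\<theta>^2) ^ (3 * r) * \<theta>^2)) (3 * r) * [:\<delta>^2, 1:] ^ s"
      by (simp only: mult_smult_right mult_smult_left[symmetric] smult_monom) (simp only: mult_ac)
    finally have ey: "\<phi>S \<theta> (Py (\<delta> * \<theta>)) = Py \<delta>" unfolding e3 by (simp add: Py_def)
    show ?thesis by (simp add: P_def F1 ex ey)
  qed
  show ?thesis unfolding T_def
  proof (rule comm_group.finprod_endo[OF L.comm_group_MW hom \<Gamma>_finite P_carrier[OF lam], where b = "\<lambda>\<delta>. \<delta> * \<theta>"])
    show inj: "inj_on (\<lambda>\<delta>. \<delta> * \<theta>) (\<Gamma> l)" using t0 by (simp add: inj_on_def)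
    have "(\<lambda>\<delta>. \<delta> * \<theta>) ` \<Gamma> l \<subseteq> \<Gamma> l" using t0 by (auto simp: \<Gamma>_def power_mult_distrib)
    thus "(\<lambda>\<delta>. \<delta> * \<theta>) ` \<Gamma> l = \<Gamma> l" using endo_inj_surj[OF \<Gamma>_finite _ inj] by blast
  qed (rule SP)
qed

text \<open>Frobenius on coefficients takes the point of \<gamma> to that of \<gamma>^q, which lies
  in the same fibre because l is in k.\<close>

lemma T_invariant_frob:
  assumes lam: "l \<in> Lam"
  shows "map_point (fmap (map_poly frob)) (T l) = T l"
proof -
  interpret F: field_hom frob by (rule field_hom_frob)
  have hF: "idom_hom (map_poly frob)" by (rule idom_hom_map_poly[OF field_hom_frob])
  interpret S: field_hom "fmap (map_poly frob)" by (rule idom_hom.field_hom_fmap[OF hF])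
  have F1: "fmap (map_poly frob) (Fract g 1) = Fract (map_poly frob g) 1" for g
    using idom_hom.one[OF hF] by (simp add: idom_hom.fmap_Fract[OF hF])
  have Fm: "map_poly frob (monom c k) = monom (frob c) k" for c k
    by (rule poly_eqI) (simp add: coeff_map_poly F.hom_0 coeff_monom)
  have fix_ab: "fmap (map_poly frob) \<alpha>L = \<alpha>L" "fmap (map_poly frob) \<beta>L = \<beta>L"
    by (simp_all add: \<alpha>L_def \<beta>L_def F1 Fm F.hom_1)
  have hom: "map_point (fmap (map_poly frob)) \<in> hom L.MW L.MW"
    using S.map_point_hom[of \<alpha>L \<beta>L] unfolding fix_ab .
  have FP: "map_point (fmap (map_poly frob)) (P \<gamma>) = P (frob \<gamma>)" for \<gamma>
  proof -
    have "map_poly frob [:\<gamma>^2, 1:] = [:(frob \<gamma>)^2, 1:]"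
      by (simp add: map_poly_pCons F.hom_0 F.hom_1 F.hom_power)
    hence "map_poly frob (Py \<gamma>) = Py (frob \<gamma>)"
      unfolding Py_def by (simp only: idom_hom.mult[OF hF] idom_hom_power[OF hF] Fm)
    thus ?thesis by (simp add: P_def F1 Px_def Fm F.hom_power)
  qed
  have sub: "frob ` \<Gamma> l \<subseteq> \<Gamma> l"
  proof
    fix x assume "x \<in> frob ` \<Gamma> l"
    then obtain \<gamma> where "\<gamma> ^ m = \<iota> l" "x = frob \<gamma>" by (auto simp: \<Gamma>_def)
    hence "x ^ m = frob (\<iota> l)" by (simp flip: F.hom_power)
    thus "x \<in> \<Gamma> l" using frob_fixed[of "\<iota> l"] by (simp add: \<Gamma>_def)
  qed
  have inj: "inj_on frob (\<Gamma> l)" by (simp add: inj_on_def F.hom_eq)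
  have surj: "frob ` \<Gamma> l = \<Gamma> l" by (rule endo_inj_surj[OF \<Gamma>_finite sub inj])
  define b where "b = inv_into (\<Gamma> l) frob"
  have fb: "frob (b x) = x" if "x \<in> \<Gamma> l" for x using that surj f_inv_into_f[of x frob "\<Gamma> l"] by (simp add: b_def)
  show ?thesis unfolding T_def
  proof (rule comm_group.finprod_endo[OF L.comm_group_MW hom \<Gamma>_finite P_carrier[OF lam], where b = b])
    show injb: "inj_on b (\<Gamma> l)" using fb by (metis inj_onI)
    have "b ` \<Gamma> l \<subseteq> \<Gamma> l" unfolding b_def using surj inv_into_into by (metis image_subsetI)
    thus "b ` \<Gamma> l = \<Gamma> l" using endo_inj_surj[OF \<Gamma>_finite _ injb] by blast
  qed (simp add: FP fb)
qed

text \<open>Invariance under roots of unity confines the exponents to multiples of m. Invariance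
  under Frobenius confines the coefficients to k, once the fraction is in lowest terms and
  normalised.\<close>

lemma descend:
  assumes S: "\<And>\<theta>. \<theta> \<in> mu \<Longrightarrow> fmap (\<phi>S \<theta>) x = x" and F: "fmap (map_poly frob) x = x"
  shows "x \<in> range J"
proof -
  interpret F: field_hom frob by (rule field_hom_frob)
  have hF: "idom_hom (map_poly frob)" by (rule idom_hom_map_poly[OF field_hom_frob])
  obtain n1 d1 where nd1: "d1 \<noteq> 0" "coprime n1 d1" "x = Fract n1 d1" by (rule Fract_coprime)
  \<comment> \<open>A monic denominator forces the constant k below, by which Frobenius could scale
    numerator and denominator, to be 1.\<close>
  define c n d where "c = inverse (lead_coeff d1)" and "n = smult c n1" and "d = smult c d1"
  have c0: "c \<noteq> 0" using nd1 by (simp add: c_def)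
  have d: "d \<noteq> 0" "lead_coeff d = 1" using c0 nd1 by (simp_all add: d_def c_def)
  have x: "x = Fract n d" using nd1 d c0 by (simp add: n_def d_def eq_fract)
  have cop: "coprime n d"
  proof -
    obtain r1 s1 where "r1 * n1 + s1 * d1 = 1" using poly_bezout[OF nd1(2)] by blast
    hence "smult (inverse c) r1 * n + smult (inverse c) s1 * d = 1" using c0 by (simp add: n_def d_def)
    thus ?thesis by (rule poly_coprimeI)
  qed
  have "\<forall>\<eta>\<in>(\<lambda>\<theta>. \<theta>^2) ` mu. Fract (pcompose n [:0, \<eta>:]) (pcompose d [:0, \<eta>:]) = Fract n d"
  proof
    fix \<eta> assume "\<eta> \<in> (\<lambda>\<theta>. \<theta>^2) ` mu"
    then obtain \<theta> where t: "\<theta> \<in> mu" "\<eta> = \<theta>^2" by blast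
    have "\<theta> \<noteq> 0" using t m_pos by (auto simp: mu_def power_0_left)
    hence hS: "idom_hom (\<phi>S \<theta>)" unfolding \<phi>S_def[abs_def] by (intro idom_hom_pcompose) simp
    have "Fract (\<phi>S \<theta> n) (\<phi>S \<theta> d) = Fract n d"
      using S[OF t(1)] unfolding x by (simp add: idom_hom.fmap_Fract[OF hS d(1)])
    thus "Fract (pcompose n [:0, \<eta>:]) (pcompose d [:0, \<eta>:]) = Fract n d" by (simp add: \<phi>S_def t(2))
  qed
  moreover have "\<forall>\<eta>\<in>(\<lambda>\<theta>. \<theta>^2) ` mu. \<eta> \<noteq> 0" using m_pos by (auto simp: mu_def power_0_left)
  moreover have "\<forall>i. (\<forall>\<eta>\<in>(\<lambda>\<theta>. \<theta>^2) ` mu. \<eta> ^ i = 1) \<longrightarrow> m dvd i" using mu_support by blast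
  ultimately have sup: "m dvd i" if "coeff n i \<noteq> 0 \<or> coeff d i \<noteq> 0" for i
    using invariant_support[OF d(1) cop] that by blast
  have eqF: "Fract n d = Fract (map_poly frob n) (map_poly frob d)"
    using F unfolding x by (simp add: idom_hom.fmap_Fract[OF hF d(1)])
  have Fd0: "map_poly frob d \<noteq> 0" using idom_hom.eq_0[OF hF] d by blast
  have Fcop: "coprime (map_poly frob n) (map_poly frob d)"
  proof -
    obtain r1 s1 where "r1 * n + s1 * d = 1" using poly_bezout[OF cop] by blast
    hence "map_poly frob (r1 * n + s1 * d) = 1" using idom_hom.one[OF hF] by simp
    hence "map_poly frob r1 * map_poly frob n + map_poly frob s1 * map_poly frob d = 1"
      by (simp only: idom_hom.add[OF hF] idom_hom.mult[OF hF])
    thus ?thesis by (rule poly_coprimeI)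
  qed
  obtain k where k: "map_poly frob n = smult k n" "map_poly frob d = smult k d"
    by (rule Fract_eq_coprime[OF d(1) Fd0 cop Fcop eqF])
  have cF: "coeff (map_poly frob g) i = frob (coeff g i)" for g i by (simp add: coeff_map_poly F.hom_0)
  have "frob (lead_coeff d) = k * lead_coeff d" using arg_cong[OF k(2), of "\<lambda>g. coeff g (degree d)"] by (simp add: cF)
  hence "k = 1" using d F.hom_1 by simp
  hence rat: "coeff n i \<in> range \<iota>" "coeff d i \<in> range \<iota>" for i
    using k cF frob_fixed by (metis smult_1_left)+
  have lift: "\<exists>g. h = \<phi>J g" if h: "\<And>i. coeff h i \<in> range \<iota>" "\<And>i. coeff h i \<noteq> 0 \<Longrightarrow> m dvd i" for h
  proof -
    obtain g where g: "h = pcompose g (monom 1 m)" "\<And>i. coeff g i \<in> range (coeff h)"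
      using poly_supported_multiples[OF m_pos h(2)] by blast
    have gr: "coeff g i \<in> range \<iota>" for i using g(2)[of i] h(1) by auto
    define g' where "g' = map_poly (inv_into UNIV \<iota>) g"
    have inj: "inj \<iota>" by (simp add: inj_def iota.hom_eq)
    have i0: "inv_into UNIV \<iota> 0 = 0" using inv_into_f_f[OF inj, of 0] by (simp add: iota.hom_0)
    have "map_poly \<iota> g' = g"
      by (rule poly_eqI) (simp add: g'_def coeff_map_poly i0 iota.hom_0 f_inv_into_f[OF gr])
    thus ?thesis using g(1) by (auto simp: \<phi>J_def)
  qed
  obtain gn where gn: "n = \<phi>J gn" using lift[of n] rat sup by blast
  obtain gd where gd: "d = \<phi>J gd" using lift[of d] rat sup by blast
  have "gd \<noteq> 0" using gd d(1) by (auto simp: \<phi>J_def)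
  hence "J (Fract gn gd) = x" unfolding J_def x gn gd by (rule idom_hom.fmap_Fract[OF hom_\<phi>J])
  thus ?thesis by (metis rangeI)
qed

lemma T_descends:
  assumes lam: "l \<in> Lam"
  shows "\<exists>w. onE w \<and> map_point J w = T l"
proof -
  interpret J: field_hom J by (rule hom_J)
  have "\<exists>w. map_point J w = T l"
  proof (cases "T l")
    case Infinity thus ?thesis by (intro exI[of _ Infinity]) simp
  next
    case (Affine x y)
    have "fmap (\<phi>S \<theta>) x = x" "fmap (\<phi>S \<theta>) y = y" if "\<theta> \<in> mu" for \<theta>
      using T_invariant_S[OF lam that] by (simp_all add: Affine)
    moreover have "fmap (map_poly frob) x = x" "fmap (map_poly frob) y = y"
      using T_invariant_frob[OF lam] by (simp_all add: Affine)
    ultimately have "x \<in> range J" "y \<in> range J" using descend by blast+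
    then obtain X Y where "x = J X" "y = J Y" by blast
    thus ?thesis using Affine by (intro exI[of _ "Affine X Y"]) simp
  qed
  then obtain w where w: "map_point J w = T l" by blast
  have "L.onE (map_point J w)" using T_carrier[OF lam] by (simp add: w)
  hence "onE w" using J.on_curve_map[of \<alpha> \<beta> w] by (simp add: J_coeffs)
  thus ?thesis using w by blast
qed

text \<open>The parity at w = -c. For c = \<gamma>^2 it separates the points; for c = 0 it serves,
  together with \<open>\<epsilon>0\<close>, to exclude 2-torsion.\<close>

definition \<epsilon>L :: "'l \<Rightarrow> 'l poly fract point \<Rightarrow> bool" where
  "\<epsilon>L c R \<longleftrightarrow> odd (vord [:c, 1:] (L.dmap (- \<alpha>L) R))"
definition \<epsilon>0 :: "'l poly fract point \<Rightarrow> bool" where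
  "\<epsilon>0 R \<longleftrightarrow> odd (vord [:0, 1:] (L.dmap 0 R))"

section \<open>Independence of the sums over fibres\<close>

lemma L_roots: "L.is_root 0" "L.is_root (- \<alpha>L)" "L.is_root (- \<beta>L)"
  by (auto simp: L.is_root_def)

lemma parity_L: "parity_hom L.MW (\<epsilon>L c)" "parity_hom L.MW \<epsilon>0"
  unfolding \<epsilon>L_def[abs_def] \<epsilon>0_def[abs_def]
  by (rule L.parity_hom_dmap; (rule L_roots)?; simp add: vord_mult[OF prime_elem_linear])+

lemma vord_linear:
  "vord [:c, 1:] (Fract [:c', 1 :: 'l:] 1) = (if c = c' then 1 else 0)"
proof -
  have pr: "prime_elem [:c, 1:]" by (rule prime_elem_linear)
  have nu: "\<not> [:c, 1:] dvd 1" using pr by (simp add: prime_elem_def)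
  have p1: "pmult [:c, 1:] 1 = 0" by (rule pmult_eq_0[OF pr nu])
  show ?thesis
  proof (cases "c = c'")
    case True
    have "pmult [:c, 1:] [:c, 1:] = 1" by (rule pmult_eqI[OF pr, of _ _ 1]) (use nu in simp_all)
    hence "vord [:c, 1:] (Fract [:c, 1:] 1) = 1" by (simp add: vord_Fract[OF pr] p1)
    thus ?thesis using True by simp
  next
    case False
    have "\<not> [:c, 1:] dvd [:c', 1:]"
      using poly_eq_0_iff_dvd[of "[:c', 1:]" "- c"] False by simp
    hence "pmult [:c, 1:] [:c', 1:] = 0" by (rule pmult_eq_0[OF pr])
    thus ?thesis using False p1 by (simp add: vord_Fract[OF pr])
  qed
qed

lemma \<epsilon>L_P:
  assumes "\<gamma> \<noteq> 0" shows "\<epsilon>L c (P \<gamma>) \<longleftrightarrow> \<gamma>^2 = c"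
proof -
  have pr: "prime_elem [:c, 1:]" by (rule prime_elem_linear)
  define z where "z = (Fract (monom 1 r) 1 :: 'l poly fract)"
  have z0: "z \<noteq> 0" by (simp add: z_def)
  have l0: "Fract [:\<gamma>^2, 1:] 1 \<noteq> (0 :: 'l poly fract)" by simp
  have "Fract (Px \<gamma>) 1 + \<alpha>L = Fract (monom 1 (2 * r) * [:\<gamma>^2, 1:]) 1"
    by (simp add: \<alpha>L_def add_fract Px_\<alpha>)
  also have "\<dots> = z^2 * Fract [:\<gamma>^2, 1:] 1"
    by (simp add: z_def power2_eq_square mult_fract mult_monom mult_2)
  finally have e: "Fract (Px \<gamma>) 1 + \<alpha>L = z^2 * Fract [:\<gamma>^2, 1:] 1" .
  hence "Fract (Px \<gamma>) 1 + \<alpha>L \<noteq> 0" using z0 l0 by simp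
  hence "Fract (Px \<gamma>) 1 \<noteq> - \<alpha>L" by (simp add: eq_neg_iff_add_eq_0)
  hence "L.dmap (- \<alpha>L) (P \<gamma>) = z^2 * Fract [:\<gamma>^2, 1:] 1" using e by (simp add: P_def)
  moreover have "vord [:c, 1:] (z^2 * Fract [:\<gamma>^2, 1:] 1) = 2 * vord [:c, 1:] z + (if c = \<gamma>^2 then 1 else 0)"
    using vord_mult[OF pr, of "z^2" "Fract [:\<gamma>^2, 1:] 1"] z0 l0 vord_linear[of c "\<gamma>^2"] by (simp add: vord_square_even[OF pr])
  ultimately show ?thesis by (auto simp: \<epsilon>L_def)
qed

lemma \<epsilon>0_P:
  assumes "\<gamma> \<noteq> 0" shows "\<not> \<epsilon>0 (P \<gamma>)"
proof -
  have pr: "prime_elem [:0, 1 :: 'l:]" by (rule prime_elem_linear)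
  define z where "z = (Fract (monom \<gamma> r) 1 :: 'l poly fract)"
  have z0: "z \<noteq> 0" using assms by (simp add: z_def)
  have "Fract (Px \<gamma>) 1 = z^2"
    by (simp add: z_def power2_eq_square mult_fract mult_monom mult_2 Px_def)
  thus ?thesis using z0 by (simp add: \<epsilon>0_def P_def vord_square_even[OF pr])
qed

text \<open>At w = 0 the coefficients have orders m and m (e + 1), both odd as m is odd and e even.
  So each nontrivial 2-torsion point has an odd value under one of the two parities.\<close>

lemma L_torsion:
  assumes "L.onE R" "point_add L.E R R = Infinity" "\<not> \<epsilon>0 R" "\<not> \<epsilon>L 0 R"
  shows "R = Infinity"
proof (rule ccontr)
  assume "R \<noteq> Infinity"
  then obtain c where c: "L.is_root c" "R = Affine c 0" using L.two_torsion[OF assms(1,2)] by blast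
  have pr: "prime_elem [:0, 1 :: 'l:]" by (rule prime_elem_linear)
  have v: "vord [:0, 1:] (Fract (monom 1 k) (1 :: 'l poly)) = int k" for k
  proof -
    have "pmult [:0, 1:] (monom 1 k :: 'l poly) = k"
      by (rule pmult_eqI[OF pr, of _ _ 1]) (use pr in \<open>simp_all add: monom_altdef prime_elem_def\<close>)
    moreover have "pmult [:0, 1:] (1 :: 'l poly) = 0"
      by (rule pmult_eq_0[OF pr]) (use pr in \<open>simp add: prime_elem_def\<close>)
    ultimately show ?thesis by (simp add: vord_Fract[OF pr])
  qed
  have vo: "odd (vord [:0, 1:] \<alpha>L)" "odd (vord [:0, 1:] (- \<alpha>L))" "odd (vord [:0, 1:] (- \<beta>L))"
  proof -
    have "odd m" "odd (m * Suc e)" using m(2) e(1) by simp_all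
    thus "odd (vord [:0, 1:] \<alpha>L)" "odd (vord [:0, 1:] (- \<alpha>L))" "odd (vord [:0, 1:] (- \<beta>L))"
      unfolding \<alpha>L_def \<beta>L_def vord_minus[OF pr] v by (simp_all only: even_of_nat not_False_eq_True)
  qed
  consider "c = 0" | "c = - \<alpha>L" | "c = - \<beta>L" using c(1) unfolding L.is_root_def by blast
  thus False
  proof cases
    case 1
    have "L.dmap (- \<alpha>L) R = \<alpha>L" using c 1 L.nz by simp
    thus False using assms(4) vo by (simp add: \<epsilon>L_def)
  next
    case 2
    have "L.dmap 0 R = - \<alpha>L" using c 2 L.nz by simp
    thus False using assms(3) vo by (simp add: \<epsilon>0_def)
  next
    case 3
    have "L.dmap 0 R = - \<beta>L" using c 3 L.nz by simp
    thus False using assms(3) vo by (simp add: \<epsilon>0_def)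
  qed
qed

text \<open>With q - 1 = 2e h every nonzero x is a root of X^(2e) - 1 or of the cofactor S, the
  geometric sum. S has at most 2e (h - 1) roots, leaving at least 2e to \<open>Lam\<close>.\<close>

lemma card_Lam: "card Lam \<ge> 2 * e"
proof -
  define N where "N = CARD('k) - 1"
  have N: "N > 0"
  proof -
    have "card {0, 1 :: 'k} \<le> card (UNIV :: 'k set)" by (rule card_mono) simp_all
    thus ?thesis by (simp add: N_def)
  qed
  obtain h where h: "N = 2 * e * h" using q(2) by (auto simp: N_def elim: dvdE)
  have h0: "h > 0" using N h by (cases h) auto
  define S :: "'k poly" where "S = (\<Sum>i<h. monom 1 (2 * e * i))"
  have dS: "degree S \<le> 2 * e * (h - 1)" unfolding S_def
    by (rule degree_sum_le) (use h0 in \<open>auto simp: degree_monom_eq\<close>)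
  have "coeff S 0 = 1"
  proof -
    have "coeff S 0 = (\<Sum>i<h. if i = 0 then 1 else 0)" unfolding S_def coeff_sum
      using e by (intro sum.cong) (auto simp: coeff_monom)
    thus ?thesis using h0 by simp
  qed
  hence S0: "S \<noteq> 0" by auto
  have cover: "UNIV - {0} \<subseteq> Lam \<union> {x. poly S x = 0}"
  proof
    fix x :: 'k assume "x \<in> UNIV - {0}"
    hence x: "x \<noteq> 0" by simp
    have "x ^ CARD('k) = x" by (rule finite_field_power_card_eq_same)
    moreover have "CARD('k) = Suc N" using N by (simp add: N_def)
    ultimately have "x ^ N = 1" using x by simp
    hence "(x ^ (2 * e)) ^ h = 1" by (simp add: h power_mult)
    moreover have "(x ^ (2 * e)) ^ h - 1 = (x ^ (2 * e) - 1) * (\<Sum>i<h. (x ^ (2 * e)) ^ i)"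
      by (rule power_diff_1_eq)
    ultimately have "x ^ (2 * e) = 1 \<or> (\<Sum>i<h. (x ^ (2 * e)) ^ i) = 0" by simp
    moreover have "poly S x = (\<Sum>i<h. (x ^ (2 * e)) ^ i)" by (simp add: S_def poly_sum poly_monom power_mult)
    ultimately show "x \<in> Lam \<union> {x. poly S x = 0}" by (auto simp: Lam_def)
  qed
  have "N = card (UNIV - {0 :: 'k})" by (simp add: N_def)
  also have "\<dots> \<le> card (Lam \<union> {x. poly S x = 0})" by (rule card_mono[OF _ cover]) simp
  also have "\<dots> \<le> card Lam + card {x. poly S x = 0}" by (rule card_Un_le)
  also have "card {x. poly S x = 0} \<le> 2 * e * (h - 1)" using card_poly_roots_bound[OF S0] dS by simp
  finally have "2 * e * h \<le> card Lam + 2 * e * (h - 1)" using h by simp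
  moreover have "2 * e * h = 2 * e * (h - 1) + 2 * e" using h0 by (cases h) simp_all
  ultimately show ?thesis by linarith
qed

text \<open>One l is kept from each pair l, -l, indexed by \<kappa> = l^2. The value \<gamma>^2
  determines \<kappa>, as its m-th power, and within a fibre it determines \<gamma>. Hence the
  parity at w = -\<gamma>^2 is odd for exactly one of the sums.\<close>

theorem independent_points: "\<exists>S. Z_independent MW S \<and> card S \<ge> e"
proof -
  interpret LG: comm_group L.MW by (rule L.comm_group_MW)
  interpret J: field_hom J by (rule hom_J)
  define K where "K = (\<lambda>l. l^2) ` Lam"
  define sq where "sq = inv_into Lam (\<lambda>l. l^2)"
  have sq: "sq \<kappa> \<in> Lam" "(sq \<kappa>)^2 = \<kappa>" if "\<kappa> \<in> K" for \<kappa>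
    using that inv_into_into[of \<kappa> "\<lambda>l. l^2" Lam] f_inv_into_f[of \<kappa> "\<lambda>l. l^2" Lam] by (simp_all add: sq_def K_def)
  \<comment> \<open>Each \<kappa> comes from at most two l, so the 2e elements of \<open>Lam\<close>
    yield at least e values.\<close>
  have "Lam \<subseteq> sq ` K \<union> (\<lambda>\<kappa>. - sq \<kappa>) ` K"
  proof
    fix l assume "l \<in> Lam"
    hence k: "l^2 \<in> K" by (simp add: K_def)
    have "l = sq (l^2) \<or> l = - sq (l^2)" using sq(2)[OF k] power2_eq_iff by metis
    thus "l \<in> sq ` K \<union> (\<lambda>\<kappa>. - sq \<kappa>) ` K" using k by blast
  qed
  hence "card Lam \<le> card (sq ` K \<union> (\<lambda>\<kappa>. - sq \<kappa>) ` K)" by (intro card_mono) simp_all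
  also have "\<dots> \<le> card (sq ` K) + card ((\<lambda>\<kappa>. - sq \<kappa>) ` K)" by (rule card_Un_le)
  also have "\<dots> \<le> card K + card K" by (intro add_mono card_image_le) simp_all
  finally have cardK: "e \<le> card K" using card_Lam by simp
  define g where "g \<kappa> = (SOME \<gamma>. \<gamma> \<in> \<Gamma> (sq \<kappa>))" for \<kappa>
  have g: "g \<kappa> \<in> \<Gamma> (sq \<kappa>)" for \<kappa> unfolding g_def using \<Gamma>_nonempty by (rule someI_ex)
  define B where "B = (\<lambda>\<kappa>. T (sq \<kappa>)) ` K"
  have eps: "\<epsilon>L ((g \<kappa>)^2) (T (sq \<kappa>')) \<longleftrightarrow> \<kappa> = \<kappa>'" if k: "\<kappa> \<in> K" "\<kappa>' \<in> K" for \<kappa> \<kappa>'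
  proof -
    have "\<epsilon>L ((g \<kappa>)^2) (T (sq \<kappa>')) \<longleftrightarrow> odd (card {\<gamma> \<in> \<Gamma> (sq \<kappa>'). \<epsilon>L ((g \<kappa>)^2) (P \<gamma>)})"
      unfolding T_def by (rule LG.parity_finprod[OF parity_L(1) \<Gamma>_finite P_carrier[OF sq(1)[OF k(2)]]])
    also have "{\<gamma> \<in> \<Gamma> (sq \<kappa>'). \<epsilon>L ((g \<kappa>)^2) (P \<gamma>)} = {\<gamma> \<in> \<Gamma> (sq \<kappa>'). \<gamma>^2 = (g \<kappa>)^2}"
      using \<Gamma>_root(2)[OF sq(1)[OF k(2)]] \<epsilon>L_P by blast
    also have "\<dots> = (if \<kappa> = \<kappa>' then {g \<kappa>} else {})"
    proof (cases "\<kappa> = \<kappa>'")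
      case True
      have "\<gamma> = g \<kappa>" if "\<gamma> \<in> \<Gamma> (sq \<kappa>)" "\<gamma>^2 = (g \<kappa>)^2" for \<gamma>
      proof -
        have "\<gamma> ^ m = g \<kappa> ^ m" using that(1) g[of \<kappa>] by (simp add: \<Gamma>_def)
        \<comment> \<open>Since m = 2r + 1, equal squares and equal m-th powers give equal
          \<gamma>.\<close>
        hence "\<gamma> * (\<gamma>^2) ^ r = g \<kappa> * ((g \<kappa>)^2) ^ r" by (simp add: m(2) power_mult)
        moreover have "g \<kappa> \<noteq> 0" using \<Gamma>_root(2)[OF sq(1)[OF k(1)] g] .
        ultimately show ?thesis using that(2) by simp
      qed
      thus ?thesis using True g[of \<kappa>] by auto
    next
      case False
      have "False" if "\<gamma> \<in> \<Gamma> (sq \<kappa>')" "\<gamma>^2 = (g \<kappa>)^2" for \<gamma>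
      proof -
        have pc: "(x ^ m)^2 = (x^2) ^ m" for x :: 'l by (simp only: power_mult[symmetric] mult.commute[of m 2])
        have "(\<gamma> ^ m)^2 = (g \<kappa> ^ m)^2" unfolding pc that(2) by (rule refl)
        hence "\<iota> ((sq \<kappa>')^2) = \<iota> ((sq \<kappa>)^2)" using that(1) g[of \<kappa>] by (simp add: \<Gamma>_def iota.hom_power)
        thus False using False sq(2) k by (simp add: iota.hom_eq)
      qed
      thus ?thesis using False by auto
    qed
    finally show ?thesis by simp
  qed
  have injT: "inj_on (\<lambda>\<kappa>. T (sq \<kappa>)) K" using eps by (intro inj_onI) metis
  have B: "finite B" "B \<subseteq> carrier L.MW" "card B = card K"
  proof -
    show "finite B" by (simp add: B_def K_def)
    show "B \<subseteq> carrier L.MW" unfolding B_def by (intro image_subsetI T_carrier sq(1))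
    show "card B = card K" unfolding B_def by (rule card_image[OF injT])
  qed
  define kap where "kap = the_inv_into K (\<lambda>\<kappa>. T (sq \<kappa>))"
  have kap: "kap (T (sq \<kappa>)) = \<kappa>" if "\<kappa> \<in> K" for \<kappa> using the_inv_into_f_f[OF injT that] by (simp add: kap_def)
  have even: "\<not> \<epsilon>0 b" "\<not> \<epsilon>L 0 b" if bB: "b \<in> B" for b
  proof -
    obtain \<kappa> where k: "\<kappa> \<in> K" "b = T (sq \<kappa>)" using bB by (auto simp: B_def)
    have nz': "\<gamma> \<noteq> 0" if "\<gamma> \<in> \<Gamma> (sq \<kappa>)" for \<gamma> using \<Gamma>_root(2)[OF sq(1)[OF k(1)] that] .
    have e: "{\<gamma> \<in> \<Gamma> (sq \<kappa>). \<epsilon>0 (P \<gamma>)} = {}" "{\<gamma> \<in> \<Gamma> (sq \<kappa>). \<epsilon>L 0 (P \<gamma>)} = {}"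
      using nz' \<epsilon>0_P \<epsilon>L_P by auto
    show "\<not> \<epsilon>0 b" "\<not> \<epsilon>L 0 b"
      unfolding k(2) T_def LG.parity_finprod[OF parity_L(2) \<Gamma>_finite P_carrier[OF sq(1)[OF k(1)]]]
        LG.parity_finprod[OF parity_L(1)[of 0] \<Gamma>_finite P_carrier[OF sq(1)[OF k(1)]]] e
      by simp_all
  qed
  have indB: "Z_independent L.MW B"
  proof (rule LG.parity_independent[OF B(1,2), where \<epsilon> = "\<lambda>b. \<epsilon>L ((g (kap b))^2)"])
    fix b show "parity_hom L.MW (\<epsilon>L ((g (kap b))^2))" by (rule parity_L)
  next
    fix b b' assume "b \<in> B" "b' \<in> B"
    then obtain \<kappa> \<kappa>' where k: "\<kappa> \<in> K" "b = T (sq \<kappa>)" "\<kappa>' \<in> K" "b' = T (sq \<kappa>')" by (auto simp: B_def)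
    show "\<epsilon>L ((g (kap b))^2) b' = (b = b')"
      using eps[OF k(1,3)] injT k by (auto simp: kap inj_on_def)
  next
    \<comment> \<open>Both parities that detect 2-torsion are even on all of B, hence on its span,
      so relations can be halved.\<close>
    fix x assume x: "x \<in> Zspan L.MW B" "x \<otimes>\<^bsub>L.MW\<^esub> x = \<one>\<^bsub>L.MW\<^esub>"
    have "x \<in> carrier L.MW" using LG.Zspan_closed[OF B(2) x(1)] .
    hence "x = Infinity"
      using x L_torsion[of x] LG.Zspan_parity[OF parity_L(2) B(1,2) even(1) x(1)]
        LG.Zspan_parity[OF parity_L(1)[of 0] B(1,2) even(2) x(1)] by simp
    thus "x = \<one>\<^bsub>L.MW\<^esub>" by simp
  qed
  have "\<forall>b\<in>B. \<exists>w. onE w \<and> map_point J w = b" using T_descends sq(1) by (auto simp: B_def)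
  then obtain w where w: "\<And>b. b \<in> B \<Longrightarrow> onE (w b) \<and> map_point J (w b) = b" by metis
  define S where "S = w ` B"
  have S: "S \<subseteq> carrier MW" "map_point J ` S = B" using w by (auto simp: S_def image_image)
  have hom: "map_point J \<in> hom MW L.MW" using J.map_point_hom[of \<alpha> \<beta>] unfolding J_coeffs .
  have "Z_independent MW S"
    using independent_hom[OF comm_group_MW L.comm_group_MW hom _ S(1)] indB S(2) J.inj_map_point inj_on_subset
    by (metis subset_UNIV)
  moreover have "card S = card B" unfolding S_def by (rule card_image) (metis inj_onI w)
  ultimately show ?thesis using B(3) cardK by auto
qed

theorem rank_twist: "group_rank MW = e"
proof -
  obtain S where S: "Z_independent MW S" "card S \<ge> e" using independent_points by blast
  hence "card S = e" using rank_upper by (simp add: le_antisym)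
  thus ?thesis unfolding group_rank_def
    by (intro Greatest_equality) (use S rank_upper in auto)
qed

end

theorem proposition5p1:
  fixes p d f q :: nat
    and u t :: "'k::finite_field poly fract"
  assumes "prime p" and "odd p"
    and "f \<ge> 1" and "d > 0"
    and "d dvd 2 * (p ^ f - 1)" and "odd (2 * (p ^ f - 1) div d)"
    and "\<exists>n\<ge>1. q = p ^ n" and "[q = 1] (mod d)"
    and "CARD('k) = q"
    and "u = fract_var" and "u ^ d = t"
  shows "mw_rank (legendre_curve t) UNIV
           = mw_rank (legendre_curve t) (adjoin (u\<^sup>2)) + d div 2"
proof -
  obtain n where n: "q = p ^ n" using assms(7) by blast
  define m where "m = 2 * (p ^ f - 1) div d"
  define e where "e = d div 2"
  have dm: "d * m = 2 * (p ^ f - 1)" using assms(5) by (simp add: m_def)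
  have odd_m: "odd m" using assms(6) by (simp add: m_def)
  have odd_pf: "odd (p ^ f)" using assms(2) by simp
  \<comment> \<open>p^f - 1 is even; the odd cofactor m then passes the factor 4 on to d.\<close>
  have "4 dvd d * m"
  proof -
    have "2 dvd p ^ f - 1" using odd_pf by simp
    hence "2 * 2 dvd 2 * (p ^ f - 1)" by (rule mult_dvd_mono[OF dvd_refl])
    thus ?thesis using dm by simp
  qed
  moreover have "coprime (2 ^ 2) m" unfolding coprime_power_left_iff using odd_m by simp
  hence "coprime 4 m" by simp
  ultimately have d4: "4 dvd d" by (simp add: coprime_dvd_mult_left_iff)
  have d2: "d = 2 * e" using d4 by (auto simp: e_def)
  have e: "even e" "e > 0" using d4 assms(4) d2 by (auto elim!: dvdE)
  have char: "CHAR('k) = p"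
  proof -
    have "prime CHAR('k)" by (rule CHAR_prime)
    moreover have "CHAR('k) dvd p ^ n" using CHAR_dvd_CARD[where 'a = 'k] assms(9) n by simp
    ultimately show ?thesis using assms(1) by (metis prime_dvd_power primes_dvd_imp_eq)
  qed
  have two: "(2::'k) \<noteq> 0"
  proof
    assume "(2::'k) = 0"
    hence "of_nat 2 = (0::'k)" by simp
    hence "p dvd 2" unfolding of_nat_eq_0_iff_char_dvd char .
    hence "p = 2" using assms(1) by (simp add: primes_dvd_imp_eq)
    thus False using assms(2) by simp
  qed
  have dq: "2 * e dvd CARD('k) - 1"
  proof -
    have "q \<ge> 1" using n prime_gt_0_nat[OF assms(1)] by (simp add: Suc_le_eq)
    hence "d dvd q - 1" using assms(8) by (metis cong_altdef_nat)
    thus ?thesis using d2 assms(9) by simp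
  qed
  obtain r where r: "m = 2 * r + 1" using odd_m by (rule oddE)
  have "even (p ^ f + 1)" using odd_pf by simp
  then obtain s where s: "p ^ f + 1 = 2 * s" by (rule evenE)
  interpret W: lower_bound "Xp :: 'k poly" "Xp ^ Suc e" e "to_ac :: 'k \<Rightarrow> 'k alg_closure" p n f m r s
  proof
    show "(Xp :: 'k poly) \<noteq> Xp ^ Suc e"
    proof
      assume "(Xp :: 'k poly) = Xp ^ Suc e"
      hence "degree (Xp :: 'k poly) = Suc e" using degree_Xp_power[of "Suc e", where 'k = 'k] by metis
      thus False using e by simp
    qed
    show "e * m = p ^ f - 1" using dm d2 by simp
    show "CARD('k) = p ^ n" using n assms(9) by simp
  qed (use two e assms(1,3) char r s dq in simp_all)
  have upow: "u ^ k = Fract (Xp ^ k) 1" for k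
    by (induction k) (simp_all add: assms(10) fract_var_def One_fract_def mult_fract)
  have u1: "u = Fract Xp 1" using upow[of 1] by simp
  have t: "t = u ^ (2 * e)" using assms(11) d2 by simp
  have "group_rank (mordell_weil_group (curve u (u ^ Suc e)) UNIV) = e"
    using W.rank_twist unfolding upow[symmetric] u1[symmetric] .
  thus ?thesis
    using rank_decomposition[OF e two, folded assms(10)]
    by (simp add: mw_rank_def legendre_curve_eq t e_def[symmetric])
qed

end
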